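(* Let $\ell\in\mathbb{N}$ and $j\ge2$ be integers, and let $\nu_\ell,\nu_{\ell+j}$, $\psi_\ell,\psi_{\ell+j}$, $V$, $\sigma_0$, $w$ be as in the context. Then \[ \int_{-\infty}^{\infty}w(t)\,|V(\sigma_0+it)|^2\,\psi_\ell(\sigma_0+it)\overline{\psi_{\ell+j}(\sigma_0+it)}\,dt\ll_\ell TL^{-1+\varepsilon}. \]
   Context: $f$ is a holomorphic primitive cusp form of even weight $k$ for $\Gamma_0(N)$, $N$ square-free, trivial character, with $f(z)=\sum_{n\ge1}\lambda_f(n)n^{(k-1)/2}e^{2\pi inz}$, $\lambda_f(1)=1$, $L(f,s)=\sum_n\lambda_f(n)n^{-s}$ (entire continuation). $L_\infty(f,s)=(\sqrt N/2\pi)^s\Gamma(s+\frac{k-1}{2})$, $\varepsilon(f)=\pm1$ the sign in $L_\infty(f,s)L(f,s)=\varepsilon(f)L_\infty(f,1-s)L(f,1-s)$, $\chi_f(s)=\varepsilon(f)L_\infty(f,1-s)/L_\infty(f,s)$. $\boldsymbol\theta\ge0$ is an exponent with $|\lambda_f(n)|\le\tau(n)n^{\boldsymbol\theta}$ for all $n$. $T$ large, $L=\log T$. $L(f,s)^{-\ell}=\sum_n\mu_{f,\ell}(n)n^{-s}$; $\lambda_f^{*m}$ is the $m$-fold Dirichlet convolution of $\lambda_f$ ($\lambda_f^{*0}$ the indicator of $n=1$). $R>0$ bounded, $\sigma_0=1/2-R/L$. $Q$ polynomial with $Q(0)=1$, $Q(x)+Q(1-x)$ constant, $V(s)=Q\big(-\frac{1}{2\log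 T}\frac{d}{ds}\big)L(f,s)$. $\nu_1=\frac{1-2\boldsymbol\theta}{4+2\boldsymbol\theta}-\varepsilon$, $\nu_m=\frac{1-2\boldsymbol\theta}{4+6\boldsymbol\theta}-\varepsilon$ for $m\ge2$ ($\varepsilon>0$ small), $M_m=T^{\nu_m}$. $P_m$ polynomials with $P_1(0)=0$, $P_1(1)=1$, and for $m>1$, $P_m^{(i)}(0)=0$ for $0\le i\le m(m-1)$; $P_m[n]=P_m\big(\frac{\log(M_m/n)}{\log M_m}\big)$. $\psi_m(s)=\chi_f^{m-1}(s+\tfrac12-\sigma_0)\sum_{hk\le M_m}\frac{\mu_{f,m}(h)\lambda_f^{*(m-1)}(k)h^{\sigma_0-1/2}k^{1/2-\sigma_0}}{h^sk^{1-s}}P_m[hk]$. $w$ smooth, $0\le w\le1$, support in $[T/4,2T]$, $w^{(i)}\ll_i(T/L)^{-i}$. *)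

theory Defs
  imports
    "HOL-Complex_Analysis.Complex_Analysis"
    "HOL-Computational_Algebra.Computational_Algebra"
begin

section \<open>Primitive cusp forms of level \<open>\<Gamma>\<^sub>0(N)\<close> and trivial character\<close>

definition upper_half_plane :: "complex set" where
  "upper_half_plane = {z. Im z > 0}"

definition SL2Z :: "(int ^ 2 ^ 2) set" where
  "SL2Z = {A. det A = 1}"

definition Gamma0 :: "nat \<Rightarrow> (int ^ 2 ^ 2) set" where
  "Gamma0 N = {A \<in> SL2Z. int N dvd A $ 2 $ 1}"

definition automorphy :: "int ^ 2 ^ 2 \<Rightarrow> complex \<Rightarrow> complex" where
  "automorphy A z = of_int (A $ 2 $ 1) * z + of_int (A $ 2 $ 2)"

definition moebius :: "int ^ 2 ^ 2 \<Rightarrow> complex \<Rightarrow> complex" where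
  "moebius A z = (of_int (A $ 1 $ 1) * z + of_int (A $ 1 $ 2)) / automorphy A z"

definition slash :: "nat \<Rightarrow> int ^ 2 ^ 2 \<Rightarrow> (complex \<Rightarrow> complex) \<Rightarrow> complex \<Rightarrow> complex" where
  "slash k A f z = f (moebius A z) / automorphy A z ^ k"

text \<open>The last condition is vanishing at all cusps: every cusp is the image of infinity under
  some element of the full modular group, and convergence is along \<open>Im z \<rightarrow> \<infinity>\<close>, uniformly in
  \<open>Re z\<close>. Values of \<open>f\<close> outside the upper half plane are irrelevant throughout.\<close>

definition cusp_forms :: "nat \<Rightarrow> nat \<Rightarrow> (complex \<Rightarrow> complex) set" where
  "cusp_forms k N = {f. f holomorphic_on upper_half_plane
     \<and> (\<forall>A\<in>Gamma0 N. \<forall>z\<in>upper_half_plane. slash k A f z = f z)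
     \<and> (\<forall>A\<in>SL2Z. (slash k A f \<longlongrightarrow> 0) (filtercomap Im at_top))}"

definition fundamental_domain :: "complex set" where
  "fundamental_domain = {z. Im z > 0 \<and> \<bar>Re z\<bar> \<le> 1/2 \<and> 1 \<le> norm z}"

text \<open>The cosets \<open>\<Gamma>\<^sub>0(N)A\<close> in the full modular group. A fundamental domain for \<open>\<Gamma>\<^sub>0(N)\<close> is the union
  of the translates of the standard one by coset representatives; the choice of representatives
  is immaterial, since \<open>f(z) cnj(g(z)) Im(z)^k\<close> is invariant under \<open>\<Gamma>\<^sub>0(N)\<close>.\<close>

definition Gamma0_cosets :: "nat \<Rightarrow> (int ^ 2 ^ 2) set set" where
  "Gamma0_cosets N = (\<lambda>A. (\<lambda>G. G ** A) ` Gamma0 N) ` SL2Z"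

definition petersson ::
    "nat \<Rightarrow> nat \<Rightarrow> (complex \<Rightarrow> complex) \<Rightarrow> (complex \<Rightarrow> complex) \<Rightarrow> complex" where
  "petersson k N f g = (\<Sum>C\<in>Gamma0_cosets N.
     set_lebesgue_integral lborel fundamental_domain (\<lambda>z.
       let z' = moebius (SOME A. A \<in> C) z
       in f z' * cnj (g z') * of_real (Im z' ^ k) / of_real (Im z ^ 2)))"

text \<open>Orthogonality to the functions \<open>g(dz)\<close>, which span the space of old forms.\<close>

definition new_cusp_forms :: "nat \<Rightarrow> nat \<Rightarrow> (complex \<Rightarrow> complex) set" where
  "new_cusp_forms k N = {f \<in> cusp_forms k N.
     \<forall>M d g. M dvd N \<and> M < N \<and> d * M dvd N \<and> g \<in> cusp_forms k M
       \<longrightarrow> petersson k N f (\<lambda>z. g (of_nat d * z)) = 0}"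

text \<open>The condition \<open>coprime a N\<close> is the trivial character modulo \<open>N\<close>, so that for primes dividing
  the level this is the usual operator \<open>U\<^sub>p\<close>.\<close>

definition hecke_operator ::
    "nat \<Rightarrow> nat \<Rightarrow> nat \<Rightarrow> (complex \<Rightarrow> complex) \<Rightarrow> complex \<Rightarrow> complex" where
  "hecke_operator k N n f z = of_nat n powi (int k - 1) *
     (\<Sum>a | a dvd n \<and> coprime a N. \<Sum>b<n div a.
        f ((of_nat a * z + of_nat b) / of_nat (n div a)) / of_nat (n div a) ^ k)"

text \<open>\<open>lam n\<close> is the Hecke eigenvalue \<open>\<lambda>\<^sub>f(n)\<close>, normalised by \<open>f(z) = \<Sum> \<lambda>\<^sub>f(n) n^((k-1)/2) e(nz)\<close>.
  Only its values at \<open>n \<ge> 1\<close> are constrained, and only these are ever used.\<close>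

definition primitive_cusp_form ::
    "nat \<Rightarrow> nat \<Rightarrow> (complex \<Rightarrow> complex) \<Rightarrow> (nat \<Rightarrow> complex) \<Rightarrow> bool" where
  "primitive_cusp_form k N f lam \<longleftrightarrow>
     f \<in> new_cusp_forms k N
     \<and> (\<forall>n\<ge>1. \<exists>c. \<forall>z\<in>upper_half_plane. hecke_operator k N n f z = c * f z)
     \<and> (\<forall>z\<in>upper_half_plane.
          (\<lambda>n. lam (Suc n) * of_nat (Suc n) powr of_real ((real k - 1) / 2)
                 * exp (2 * of_real pi * \<i> * of_nat (Suc n) * z)) sums f z)
     \<and> lam 1 = 1"

section \<open>The \<open>L\<close>-function and its functional equation\<close>

text \<open>\<open>F(s) = \<Sum>\<^sub>n\<^sub>\<ge>\<^sub>1 a(n) n^(-s)\<close> in some right half plane.\<close>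

definition has_dirichlet_series :: "(nat \<Rightarrow> complex) \<Rightarrow> (complex \<Rightarrow> complex) \<Rightarrow> bool" where
  "has_dirichlet_series a F \<longleftrightarrow>
     (\<exists>c. \<forall>s. Re s > c \<longrightarrow> (\<lambda>n. a (Suc n) * of_nat (Suc n) powr (- s)) sums F s)"

definition is_L_function :: "(nat \<Rightarrow> complex) \<Rightarrow> (complex \<Rightarrow> complex) \<Rightarrow> bool" where
  "is_L_function lam L \<longleftrightarrow> L holomorphic_on UNIV \<and> has_dirichlet_series lam L"

definition gamma_factor :: "nat \<Rightarrow> nat \<Rightarrow> complex \<Rightarrow> complex" where
  "gamma_factor k N s =
     of_real (sqrt (real N) / (2 * pi)) powr s * Gamma (s + of_real ((real k - 1) / 2))"

text \<open>The functional equation is an identity of meromorphic functions. As \<^const>\<open>Gamma\<close> takes the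
  value 0 at its poles, the poles of the two gamma factors have to be excluded.\<close>

definition is_root_number :: "nat \<Rightarrow> nat \<Rightarrow> (complex \<Rightarrow> complex) \<Rightarrow> complex \<Rightarrow> bool" where
  "is_root_number k N L eps \<longleftrightarrow> (eps = 1 \<or> eps = -1) \<and>
     (\<forall>s. s + of_real ((real k - 1) / 2) \<notin> \<int>\<^sub>\<le>\<^sub>0 \<and> 1 - s + of_real ((real k - 1) / 2) \<notin> \<int>\<^sub>\<le>\<^sub>0 \<longrightarrow>
        gamma_factor k N s * L s = eps * gamma_factor k N (1 - s) * L (1 - s))"

definition chi :: "nat \<Rightarrow> nat \<Rightarrow> complex \<Rightarrow> complex \<Rightarrow> complex" where
  "chi k N eps s = eps * gamma_factor k N (1 - s) / gamma_factor k N s"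

section \<open>The mollifier pieces\<close>

definition dirichlet_conv :: "(nat \<Rightarrow> complex) \<Rightarrow> (nat \<Rightarrow> complex) \<Rightarrow> nat \<Rightarrow> complex" where
  "dirichlet_conv a b n = (\<Sum>d | d dvd n. a d * b (n div d))"

primrec dirichlet_conv_power :: "(nat \<Rightarrow> complex) \<Rightarrow> nat \<Rightarrow> nat \<Rightarrow> complex" where
  "dirichlet_conv_power a 0 = (\<lambda>n. if n = 1 then 1 else 0)"
| "dirichlet_conv_power a (Suc m) = dirichlet_conv a (dirichlet_conv_power a m)"

definition sigma0 :: "real \<Rightarrow> real \<Rightarrow> real" where
  "sigma0 R T = 1 / 2 - R / ln T"

definition nu :: "real \<Rightarrow> real \<Rightarrow> nat \<Rightarrow> real" where
  "nu \<theta> \<epsilon> m = (if m = 1 then (1 - 2 * \<theta>) / (4 + 2 * \<theta>) - \<epsilon> else (1 - 2 * \<theta>) / (4 + 6 * \<theta>) - \<epsilon>)"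

definition mollifier_poly :: "nat \<Rightarrow> complex poly \<Rightarrow> bool" where
  "mollifier_poly m P \<longleftrightarrow>
     (if m = 1 then poly P 0 = 0 \<and> poly P 1 = 1
      else \<forall>i\<le>m * (m - 1). poly ((pderiv ^^ i) P) 0 = 0)"

definition poly_bracket :: "complex poly \<Rightarrow> real \<Rightarrow> nat \<Rightarrow> complex" where
  "poly_bracket P M n = poly P (of_real (ln (M / real n) / ln M))"

text \<open>In the following, \<open>X\<close> is \<open>\<chi>\<^sub>f\<close>, \<open>lam\<close> is \<open>\<lambda>\<^sub>f\<close>, \<open>mu\<close> is \<open>\<mu>\<^sub>f\<^sub>,\<^sub>m\<close>, \<open>\<sigma>\<close> is \<open>\<sigma>\<^sub>0\<close> and \<open>M\<close> is \<open>M\<^sub>m\<close>.\<close>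

definition psi :: "(complex \<Rightarrow> complex) \<Rightarrow> (nat \<Rightarrow> complex) \<Rightarrow> (nat \<Rightarrow> complex) \<Rightarrow> complex poly
    \<Rightarrow> real \<Rightarrow> real \<Rightarrow> nat \<Rightarrow> complex \<Rightarrow> complex" where
  "psi X lam mu P \<sigma> M m s = X (s + 1 / 2 - of_real \<sigma>) ^ (m - 1) *
     (\<Sum>(h, k) | h > 0 \<and> k > 0 \<and> real (h * k) \<le> M.
        mu h * dirichlet_conv_power lam (m - 1) k
          * of_nat h powr of_real (\<sigma> - 1 / 2) * of_nat k powr of_real (1 / 2 - \<sigma>)
          / (of_nat h powr s * of_nat k powr (1 - s)) * poly_bracket P M (h * k))"

text \<open>\<open>V(s) = Q(-1/(2 log T) d/ds) L(s)\<close>\<close>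

definition V_op :: "complex poly \<Rightarrow> real \<Rightarrow> (complex \<Rightarrow> complex) \<Rightarrow> complex \<Rightarrow> complex" where
  "V_op Q T L s =
     (\<Sum>i\<le>degree Q. coeff Q i * of_real (- 1 / (2 * ln T)) ^ i * (deriv ^^ i) L s)"

text \<open>\<open>B i\<close> is the implied constant in the bound for the \<open>i\<close>-th derivative.\<close>

definition admissible_weight :: "(nat \<Rightarrow> real) \<Rightarrow> real \<Rightarrow> (real \<Rightarrow> real) \<Rightarrow> bool" where
  "admissible_weight B T w \<longleftrightarrow>
     (\<forall>i t. (deriv ^^ i) w field_differentiable (at t))
     \<and> (\<forall>t. 0 \<le> w t \<and> w t \<le> 1)
     \<and> (\<forall>t. w t \<noteq> 0 \<longrightarrow> T / 4 \<le> t \<and> t \<le> 2 * T)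
     \<and> (\<forall>i t. \<bar>(deriv ^^ i) w t\<bar> \<le> B i * (T / ln T) powi (- int i))"

end

theory Submission
  imports Defs
begin

text \<open>The whole integral is in fact bounded. On the line of integration the integrand is \<open>w\<close> times the
  restriction of a function \<open>G\<close> that is holomorphic for \<open>Re z > 0\<close>, and the surplus factor
  \<open>conj(chi)^j\<close> with \<open>j \<ge> 2\<close> oscillates faster than \<open>|V|\<^sup>2\<close> and the two Dirichlet polynomials together
  (conductor \<open>T^(2j)\<close> against \<open>T^2\<close> and \<open>T^(1/2)\<close>). Hence \<open>G\<close> is smaller than any power of \<open>1/T\<close> after a
  sufficiently large shift of the contour; the weight is not holomorphic, but its derivatives save
  \<open>ln T / T\<close> each, so the error terms of the shift are controlled by any polynomial bound for \<open>G\<close>.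
  Polynomial growth of \<open>L\<close> comes from the functional equation, the absolutely convergent range and
  a Phragmen-Lindelof argument, whose a priori growth condition is read off the Mellin transform of the cusp form.
  For a given \<open>P'\<close> only finitely many \<open>j\<close> occur unless \<open>P' = 0\<close>, which makes the bound uniform in \<open>j\<close>.\<close>

section \<open>The gamma factors in vertical strips\<close>

text \<open>On the original line chi is taken at 1/2 + i t, where it has modulus 1, so absolute
  values give nothing and the gain appears only off the line. The conjugated factors are continued
  by reflection: at distance y the plain factors sit at real part sigma0 - y and the conjugated ones
  at sigma0 + y. There chi grows on one side and decays on the other, and since the conjugated side
  carries j more powers, the decay wins. Splitting |V|^2 as V times its conjugate sends only one of
  the two V to the left, where it grows like T^(2y); each Dirichlet polynomial costs T^(y/4). For j
  = 1 the gain T^(-2y) would be cancelled by V alone; j >= 2 leaves at least T^(-3y/2). All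
  remaining losses must be powers of T that are fixed before the length A of the shift is chosen.
  This dictates the form of the growth lemmas: in each of them the part of the exponent that does
  not come from the shift is independent of it.\<close>

lemma norm_Gamma_mono:
  fixes x d t :: real
  assumes "x > 0" "d \<ge> 0"
  shows "norm (Gamma (Complex x t)) * Gamma (x + d) \<le> Gamma x * norm (Gamma (Complex (x + d) t))"
proof -
  have poch: "norm (pochhammer (Complex x t) n) = (\<Prod>i<n. norm (Complex (x + real i) t))" for x n
  proof -
    have "Complex x t + of_nat i = Complex (x + real i) t" for i by (simp add: complex_eq_iff)
    then show ?thesis by (simp add: pochhammer_prod prod_norm[symmetric] atLeast0LessThan)
  qed
  have ser: "norm (Gamma_series (Complex x t) n) * (\<Prod>i\<le>n. norm (Complex (x + real i) t))
      = Gamma_series x n * (\<Prod>i\<le>n. x + real i)" if "x > 0" for x n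
  proof -
    have nz: "norm (Complex (x + real i) t) \<noteq> 0" "x + real i \<noteq> 0" for i
      using that by (auto simp: complex_eq_iff)
    have "Re (Complex x t * of_real (ln (real n))) = x * ln (real n)" by simp
    then have "norm (exp (Complex x t * of_real (ln (real n)))) = exp (x * ln (real n))"
      by (metis norm_exp_eq_Re)
    moreover have "pochhammer x (Suc n) = (\<Prod>i\<le>n. x + real i)"
      by (simp add: pochhammer_prod atLeast0LessThan lessThan_Suc_atMost del: prod.lessThan_Suc prod.atMost_Suc)
    moreover have "norm (pochhammer (Complex x t) (Suc n)) = (\<Prod>i\<le>n. norm (Complex (x + real i) t))"
      by (simp add: poch lessThan_Suc_atMost del: pochhammer_Suc prod.lessThan_Suc prod.atMost_Suc)
    ultimately show ?thesis using nz
      by (simp add: Gamma_series_def norm_divide norm_mult del: pochhammer_Suc prod.lessThan_Suc prod.atMost_Suc)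
  qed
  \<comment> \<open>By \<open>ser\<close>, |Gamma (x + i t)| / Gamma x is in the limit the product
    of a / |a + i t| over a = x, x + 1, x + 2, ... Each factor increases with a, so the quotient
    increases with x.\<close>
  have main: "norm (Gamma_series (Complex x t) n) * Gamma_series (x + d) n
      \<le> Gamma_series x n * norm (Gamma_series (Complex (x + d) t) n)" for n
  proof -
    define p q p' q' where "p = (\<Prod>i\<le>n. norm (Complex (x + real i) t))" and "q = (\<Prod>i\<le>n. x + real i)"
      and "p' = (\<Prod>i\<le>n. norm (Complex (x + d + real i) t))" and "q' = (\<Prod>i\<le>n. x + d + real i)"
    have pos: "p > 0" "q > 0" "p' > 0" "q' > 0"
      using assms by (auto simp: p_def q_def p'_def q'_def complex_eq_iff intro!: prod_pos)
    have "q * p' \<le> p * q'"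
      unfolding p_def q_def p'_def q'_def prod.distrib[symmetric]
    proof (rule prod_mono, safe)
      fix i
      define a b where "a = x + real i" and "b = x + d + real i"
      have ab: "0 < a" "a \<le> b" using assms by (auto simp: a_def b_def)
      then have "a\<^sup>2 * t\<^sup>2 \<le> b\<^sup>2 * t\<^sup>2" by (intro mult_right_mono power_mono) auto
      then have "(a * norm (Complex b t))\<^sup>2 \<le> (norm (Complex a t) * b)\<^sup>2"
        by (simp add: power_mult_distrib cmod_power2 algebra_simps)
      then show "(x + real i) * norm (Complex (x + d + real i) t) \<le> norm (Complex (x + real i) t) * (x + d + real i)"
        using ab by (auto simp: a_def[symmetric] b_def[symmetric] intro: power2_le_imp_le)
    qed (use assms in auto)
    have e: "norm (Gamma_series (Complex x t) n) = Gamma_series x n * q / p"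
      "norm (Gamma_series (Complex (x + d) t) n) = Gamma_series (x + d) n * q' / p'"
      using ser[of x n] ser[of "x + d" n] assms pos
      by (simp_all add: p_def[symmetric] q_def[symmetric] p'_def[symmetric] q'_def[symmetric] nonzero_eq_divide_eq)
    have g: "Gamma_series x n \<ge> 0" "Gamma_series (x + d) n \<ge> 0"
      using assms by (auto simp: Gamma_series_def intro!: divide_nonneg_nonneg mult_nonneg_nonneg pochhammer_nonneg)
    have "q / p \<le> q' / p'" using \<open>q * p' \<le> p * q'\<close> pos by (simp add: field_simps)
    then have "Gamma_series x n * Gamma_series (x + d) n * (q / p) \<le> Gamma_series x n * Gamma_series (x + d) n * (q' / p')"
      using g by (intro mult_left_mono) auto
    then show ?thesis unfolding e by (simp add: mult_ac)
  qed
  show ?thesis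
    by (rule LIMSEQ_le[where X = "\<lambda>n. norm (Gamma_series (Complex x t) n) * Gamma_series (x + d) n"
          and Y = "\<lambda>n. Gamma_series x n * norm (Gamma_series (Complex (x + d) t) n)"])
      (use main in \<open>auto intro!: tendsto_intros Gamma_series_LIMSEQ\<close>)
qed

lemma Gamma_real_bounds:
  fixes b :: real
  shows "\<exists>m M. 0 < m \<and> 0 < M \<and> (\<forall>x\<in>{1..b}. m \<le> Gamma x \<and> Gamma x \<le> M)"
proof (cases "b \<ge> 1")
  case True
  have c: "continuous_on {1..b} (Gamma :: real \<Rightarrow> real)"
    by (intro continuous_intros) (auto elim!: nonpos_Ints_cases)
  obtain u where u: "u \<in> {1..b}" "\<And>x. x \<in> {1..b} \<Longrightarrow> Gamma u \<le> Gamma x"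
    using continuous_attains_inf[OF _ _ c] True by auto
  obtain v where v: "v \<in> {1..b}" "\<And>x. x \<in> {1..b} \<Longrightarrow> Gamma x \<le> Gamma v"
    using continuous_attains_sup[OF _ _ c] True by auto
  show ?thesis
    by (rule exI[of _ "Gamma u"], rule exI[of _ "Gamma v"]) (use u v in auto)
next
  case False
  then show ?thesis by (intro exI[of _ 1]) auto
qed

lemma Gamma_shift:
  assumes "t \<noteq> 0"
  shows "Gamma (Complex (a + real n) t) = (\<Prod>i<n. Complex (a + real i) t) * Gamma (Complex a t)"
proof (induction n)
  case (Suc n)
  have "Complex (a + real n) t \<notin> \<int>\<^sub>\<le>\<^sub>0" using assms by (auto elim!: nonpos_Ints_cases simp: complex_eq_iff)
  then have "Gamma (Complex (a + real n) t + 1) = Complex (a + real n) t * Gamma (Complex (a + real n) t)"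
    by (rule Gamma_plus1)
  moreover have "Complex (a + real n) t + 1 = Complex (a + real (Suc n)) t" by (simp add: complex_eq_iff)
  ultimately show ?case using Suc by (simp add: mult_ac)
qed simp

lemma prod_Complex_upper:
  assumes "\<bar>a\<bar> \<le> K" "\<bar>t\<bar> \<ge> 1"
  shows "norm (\<Prod>i<n. Complex (a + real i) t) \<le> (K + real n + 1) ^ n * \<bar>t\<bar> ^ n"
proof -
  have "norm (Complex (a + real i) t) \<le> (K + real n + 1) * \<bar>t\<bar>" if "i < n" for i
  proof -
    have "norm (Complex (a + real i) t) \<le> \<bar>a + real i\<bar> + \<bar>t\<bar>"
      using cmod_le[of "Complex (a + real i) t"] by simp
    also have "\<dots> \<le> (K + real n) * 1 + \<bar>t\<bar>" using assms that by auto
    also have "\<dots> \<le> (K + real n) * \<bar>t\<bar> + \<bar>t\<bar>" using assms by (intro add_right_mono mult_left_mono) auto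
    finally show ?thesis by (simp add: algebra_simps)
  qed
  then have "(\<Prod>i<n. norm (Complex (a + real i) t)) \<le> (\<Prod>i<n. (K + real n + 1) * \<bar>t\<bar>)"
    by (intro prod_mono) auto
  then show ?thesis by (simp add: prod_norm power_mult_distrib)
qed

lemma prod_Complex_lower: "norm (\<Prod>i<n. Complex (a + real i) t) \<ge> \<bar>t\<bar> ^ n"
proof -
  have "(\<Prod>i<n. \<bar>t\<bar>) \<le> (\<Prod>i<n. norm (Complex (a + real i) t))"
    using abs_Im_le_cmod by (intro prod_mono) (metis abs_ge_zero complex.sel(2))
  then show ?thesis by (simp add: prod_norm)
qed

text \<open>A comparison at equal height, uniform in t, that stands in for Stirling's formula.
  Moving both points m steps to the right reaches real parts at least 1, where
  \<open>norm_Gamma_mono\<close> applies and Gamma on the real axis is bounded above and below. The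
  m linear factors picked up on either side are both of order |t|^m and cancel.\<close>

lemma norm_Gamma_compare:
  fixes K :: real
  shows "\<exists>C>0. \<forall>a b t. \<bar>a\<bar> \<le> K \<and> \<bar>b\<bar> \<le> K \<and> b \<le> a \<and> \<bar>t\<bar> \<ge> 1 \<longrightarrow>
     norm (Gamma (Complex b t)) \<le> C * norm (Gamma (Complex a t))"
proof -
  define m where "m = nat \<lceil>K\<rceil> + 1"
  have m: "real m \<ge> K + 1" by (simp add: m_def) linarith
  obtain g M where gM: "0 < g" "0 < M" "\<And>x. x \<in> {1..K + real m} \<Longrightarrow> g \<le> Gamma x \<and> Gamma x \<le> M"
    using Gamma_real_bounds[of "K + real m"] by blast
  define C where "C = (M / g) * (\<bar>K\<bar> + real m + 1) ^ m"
  show ?thesis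
  proof (intro exI[of _ C] conjI allI impI)
    show "C > 0" using gM by (auto simp: C_def)
    fix a b t :: real assume h: "\<bar>a\<bar> \<le> K \<and> \<bar>b\<bar> \<le> K \<and> b \<le> a \<and> \<bar>t\<bar> \<ge> 1"
    then have t: "t \<noteq> 0" by auto
    have am: "a + real m \<in> {1..K + real m}" "b + real m \<in> {1..K + real m}" using h m by auto
    define pa pb where "pa = (\<Prod>i<m. Complex (a + real i) t)" and "pb = (\<Prod>i<m. Complex (b + real i) t)"
    have "norm (Gamma (Complex (b + real m) t)) * g \<le> norm (Gamma (Complex (b + real m) t)) * Gamma (a + real m)"
      using gM(3)[OF am(1)] by (intro mult_left_mono) auto
    also have "\<dots> \<le> Gamma (b + real m) * norm (Gamma (Complex (a + real m) t))"
      using norm_Gamma_mono[of "b + real m" "a - b" t] h am by (simp add: algebra_simps)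
    also have "\<dots> \<le> M * norm (Gamma (Complex (a + real m) t))"
      using gM(3)[OF am(2)] by (intro mult_right_mono) auto
    finally have *: "norm pb * norm (Gamma (Complex b t)) * g \<le> M * (norm pa * norm (Gamma (Complex a t)))"
      unfolding Gamma_shift[OF t] norm_mult pa_def pb_def by simp
    have pa: "norm pa \<le> (\<bar>K\<bar> + real m + 1) ^ m * \<bar>t\<bar> ^ m"
      unfolding pa_def using h by (intro prod_Complex_upper) auto
    have pb: "\<bar>t\<bar> ^ m \<le> norm pb" unfolding pb_def by (rule prod_Complex_lower)
    have "\<bar>t\<bar> ^ m * (norm (Gamma (Complex b t)) * g) \<le> norm pb * (norm (Gamma (Complex b t)) * g)"
      using pb gM by (intro mult_right_mono) auto
    also have "\<dots> \<le> M * (norm pa * norm (Gamma (Complex a t)))" using * by (simp add: mult_ac)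
    also have "\<dots> \<le> M * (((\<bar>K\<bar> + real m + 1) ^ m * \<bar>t\<bar> ^ m) * norm (Gamma (Complex a t)))"
      using pa gM by (intro mult_left_mono mult_right_mono) auto
    also have "\<dots> = \<bar>t\<bar> ^ m * (M * (\<bar>K\<bar> + real m + 1) ^ m * norm (Gamma (Complex a t)))" by (simp add: mult_ac)
    finally have "norm (Gamma (Complex b t)) * g \<le> M * (\<bar>K\<bar> + real m + 1) ^ m * norm (Gamma (Complex a t))"
      using t by (subst (asm) mult_le_cancel_left_pos) auto
    then show "norm (Gamma (Complex b t)) \<le> C * norm (Gamma (Complex a t))"
      using gM by (simp add: C_def field_simps)
  qed
qed

text \<open>n steps of the functional equation carry a past b, each at the price of a factor of
  order |t|; \<open>norm_Gamma_compare_down\<close> estimates the same factors from below.\<close>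

lemma norm_Gamma_compare_up:
  fixes K :: real
  shows "\<exists>C>0. \<forall>a b t. \<bar>a\<bar> \<le> K \<and> \<bar>b\<bar> \<le> K \<and> b \<le> a + real n \<and> \<bar>t\<bar> \<ge> 1 \<longrightarrow>
     norm (Gamma (Complex b t)) \<le> C * \<bar>t\<bar> ^ n * norm (Gamma (Complex a t))"
proof -
  obtain C where C: "C > 0" "\<And>a b t. \<bar>a\<bar> \<le> K + real n \<Longrightarrow> \<bar>b\<bar> \<le> K + real n \<Longrightarrow> b \<le> a \<Longrightarrow> \<bar>t\<bar> \<ge> 1 \<Longrightarrow>
     norm (Gamma (Complex b t)) \<le> C * norm (Gamma (Complex a t))"
    using norm_Gamma_compare[of "K + real n"] by blast
  show ?thesis
  proof (intro exI[of _ "C * (\<bar>K\<bar> + real n + 1) ^ n"] conjI allI impI)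
    show "C * (\<bar>K\<bar> + real n + 1) ^ n > 0" using C by auto
    fix a b t :: real assume h: "\<bar>a\<bar> \<le> K \<and> \<bar>b\<bar> \<le> K \<and> b \<le> a + real n \<and> \<bar>t\<bar> \<ge> 1"
    have "norm (Gamma (Complex b t)) \<le> C * norm (Gamma (Complex (a + real n) t))"
      using h by (intro C) auto
    also have "\<dots> = C * (norm (\<Prod>i<n. Complex (a + real i) t) * norm (Gamma (Complex a t)))"
      using h by (subst Gamma_shift) (auto simp: norm_mult)
    also have "\<dots> \<le> C * (((\<bar>K\<bar> + real n + 1) ^ n * \<bar>t\<bar> ^ n) * norm (Gamma (Complex a t)))"
      using h C by (intro mult_left_mono mult_right_mono prod_Complex_upper) auto
    finally show "norm (Gamma (Complex b t)) \<le> C * (\<bar>K\<bar> + real n + 1) ^ n * \<bar>t\<bar> ^ n * norm (Gamma (Complex a t))"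
      by (simp add: mult_ac)
  qed
qed

lemma norm_Gamma_compare_down:
  fixes K :: real
  shows "\<exists>C>0. \<forall>a b t. \<bar>a\<bar> \<le> K \<and> \<bar>b\<bar> \<le> K \<and> b + real n \<le> a \<and> \<bar>t\<bar> \<ge> 1 \<longrightarrow>
     \<bar>t\<bar> ^ n * norm (Gamma (Complex b t)) \<le> C * norm (Gamma (Complex a t))"
proof -
  obtain C where C: "C > 0" "\<And>a b t. \<bar>a\<bar> \<le> K + real n \<Longrightarrow> \<bar>b\<bar> \<le> K + real n \<Longrightarrow> b \<le> a \<Longrightarrow> \<bar>t\<bar> \<ge> 1 \<Longrightarrow>
     norm (Gamma (Complex b t)) \<le> C * norm (Gamma (Complex a t))"
    using norm_Gamma_compare[of "K + real n"] by blast
  show ?thesis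
  proof (intro exI[of _ C] conjI allI impI)
    show "C > 0" by fact
    fix a b t :: real assume h: "\<bar>a\<bar> \<le> K \<and> \<bar>b\<bar> \<le> K \<and> b + real n \<le> a \<and> \<bar>t\<bar> \<ge> 1"
    have "\<bar>t\<bar> ^ n * norm (Gamma (Complex b t)) \<le> norm (\<Prod>i<n. Complex (b + real i) t) * norm (Gamma (Complex b t))"
      by (intro mult_right_mono prod_Complex_lower) auto
    also have "\<dots> = norm (Gamma (Complex (b + real n) t))"
      using h by (subst Gamma_shift) (auto simp: norm_mult)
    also have "\<dots> \<le> C * norm (Gamma (Complex a t))"
      using h by (intro C) auto
    finally show "\<bar>t\<bar> ^ n * norm (Gamma (Complex b t)) \<le> C * norm (Gamma (Complex a t))" .
  qed
qed

text \<open>The point 1 - s has height -t. Conjugation does not change the modulus of Gamma and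
  brings both gamma factors to height t, as the comparison lemmas require.\<close>

lemma norm_chi:
  assumes "norm eps = 1" "N > 0" "t \<noteq> 0"
  shows "norm (chi k N eps (Complex \<sigma> t)) = (sqrt (real N) / (2 * pi)) powr (1 - 2 * \<sigma>)
    * norm (Gamma (Complex (1 - \<sigma> + (real k - 1) / 2) t)) / norm (Gamma (Complex (\<sigma> + (real k - 1) / 2) t))"
proof -
  define c where "c = sqrt (real N) / (2 * pi)"
  have c: "c > 0" using assms by (simp add: c_def)
  have nc: "norm (complex_of_real c powr z) = c powr Re z" for z
    using c by (simp add: norm_powr_real_powr)
  have "1 - Complex \<sigma> t + of_real ((real k - 1) / 2) = cnj (Complex (1 - \<sigma> + (real k - 1) / 2) t)"
    "Complex \<sigma> t + of_real ((real k - 1) / 2) = Complex (\<sigma> + (real k - 1) / 2) t"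
    by (simp_all add: complex_eq_iff)
  then have "norm (chi k N eps (Complex \<sigma> t)) = c powr (1 - \<sigma>) * norm (Gamma (Complex (1 - \<sigma> + (real k - 1) / 2) t))
      / (c powr \<sigma> * norm (Gamma (Complex (\<sigma> + (real k - 1) / 2) t)))"
    using assms by (simp add: chi_def gamma_factor_def norm_mult norm_divide c_def[symmetric] nc cnj_Gamma[symmetric])
  also have "c powr (1 - \<sigma>) = c powr (1 - 2 * \<sigma>) * c powr \<sigma>" by (simp add: powr_add[symmetric])
  finally show ?thesis using c by (simp add: c_def[symmetric])
qed

lemma powr_bounded:
  fixes c K :: real
  assumes "c > 0"
  shows "\<exists>C>0. \<forall>x. \<bar>x\<bar> \<le> K \<longrightarrow> c powr x \<le> C"
proof (intro exI[of _ "exp (K * \<bar>ln c\<bar>)"] conjI allI impI)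
  fix x assume "\<bar>x\<bar> \<le> K"
  have "x * ln c \<le> \<bar>x\<bar> * \<bar>ln c\<bar>" by (metis abs_ge_self abs_mult)
  also have "\<dots> \<le> K * \<bar>ln c\<bar>" using \<open>\<bar>x\<bar> \<le> K\<close> by (intro mult_right_mono) auto
  finally show "c powr x \<le> exp (K * \<bar>ln c\<bar>)" using assms by (simp add: powr_def)
qed auto

text \<open>The real parts of the two gamma factors differ by 1 - 2 \<sigma>, so chi has order
  |t|^(1 - 2 \<sigma>). Rounding the exponent up to an integer gives one bound for a whole range of
  real parts.\<close>

lemma chi_upper_bound:
  fixes K :: real
  assumes "norm eps = 1" "N > 0"
  shows "\<exists>C>0. \<forall>\<sigma> t. \<bar>\<sigma>\<bar> \<le> K \<and> 1 - 2 * \<sigma> \<le> real n \<and> \<bar>t\<bar> \<ge> 1 \<longrightarrow> norm (chi k N eps (Complex \<sigma> t)) \<le> C * \<bar>t\<bar> ^ n"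
proof -
  define K' where "K' = K + 1 + real k"
  obtain C where C: "C > 0" "\<And>a b t. \<bar>a\<bar> \<le> K' \<Longrightarrow> \<bar>b\<bar> \<le> K' \<Longrightarrow> b \<le> a + real n \<Longrightarrow> \<bar>t\<bar> \<ge> 1 \<Longrightarrow>
     norm (Gamma (Complex b t)) \<le> C * \<bar>t\<bar> ^ n * norm (Gamma (Complex a t))"
    using norm_Gamma_compare_up[of K' n] by blast
  obtain D where D: "D > 0" "\<And>x. \<bar>x\<bar> \<le> 1 + 2 * K \<Longrightarrow> (sqrt (real N) / (2 * pi)) powr x \<le> D"
    using powr_bounded[of "sqrt (real N) / (2 * pi)" "1 + 2 * K"] \<open>N > 0\<close> by auto
  show ?thesis
  proof (intro exI[of _ "D * C"] conjI allI impI)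
    show "D * C > 0" using C D by simp
    fix \<sigma> t :: real assume h: "\<bar>\<sigma>\<bar> \<le> K \<and> 1 - 2 * \<sigma> \<le> real n \<and> \<bar>t\<bar> \<ge> 1"
    then have t: "t \<noteq> 0" by auto
    define a b where "a = \<sigma> + (real k - 1) / 2" and "b = 1 - \<sigma> + (real k - 1) / 2"
    have "norm (Gamma (Complex b t)) \<le> C * \<bar>t\<bar> ^ n * norm (Gamma (Complex a t))"
      using h by (intro C) (auto simp: a_def b_def K'_def field_simps abs_le_iff)
    then have "norm (Gamma (Complex b t)) / norm (Gamma (Complex a t)) \<le> C * \<bar>t\<bar> ^ n"
      using C by (cases "Gamma (Complex a t) = 0") (auto simp: field_simps)
    moreover have "(sqrt (real N) / (2 * pi)) powr (1 - 2 * \<sigma>) \<le> D"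
      using h by (intro D) (auto simp: abs_le_iff)
    ultimately have "(sqrt (real N) / (2 * pi)) powr (1 - 2 * \<sigma>) * (norm (Gamma (Complex b t)) / norm (Gamma (Complex a t))) \<le> D * (C * \<bar>t\<bar> ^ n)"
      using D by (intro mult_mono) auto
    then show "norm (chi k N eps (Complex \<sigma> t)) \<le> D * C * \<bar>t\<bar> ^ n"
      unfolding norm_chi[OF assms t] a_def b_def by (simp add: mult_ac)
  qed
qed

text \<open>The same order, read as decay to the right of the critical line. At \<sigma> = 1/2 + A
  the exponent n = 2 A is exact, and there the contour shift gets its gain.\<close>

lemma chi_lower_power_bound:
  fixes K :: real
  assumes "norm eps = 1" "N > 0"
  shows "\<exists>C>0. \<forall>\<sigma> t. \<bar>\<sigma>\<bar> \<le> K \<and> real n \<le> 2 * \<sigma> - 1 \<and> \<bar>t\<bar> \<ge> 1 \<longrightarrow> \<bar>t\<bar> ^ n * norm (chi k N eps (Complex \<sigma> t)) \<le> C"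
proof -
  define K' where "K' = K + 1 + real k"
  obtain C where C: "C > 0" "\<And>a b t. \<bar>a\<bar> \<le> K' \<Longrightarrow> \<bar>b\<bar> \<le> K' \<Longrightarrow> b + real n \<le> a \<Longrightarrow> \<bar>t\<bar> \<ge> 1 \<Longrightarrow>
     \<bar>t\<bar> ^ n * norm (Gamma (Complex b t)) \<le> C * norm (Gamma (Complex a t))"
    using norm_Gamma_compare_down[of K' n] by blast
  obtain D where D: "D > 0" "\<And>x. \<bar>x\<bar> \<le> 1 + 2 * K \<Longrightarrow> (sqrt (real N) / (2 * pi)) powr x \<le> D"
    using powr_bounded[of "sqrt (real N) / (2 * pi)" "1 + 2 * K"] \<open>N > 0\<close> by auto
  show ?thesis
  proof (intro exI[of _ "D * C"] conjI allI impI)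
    show "D * C > 0" using C D by simp
    fix \<sigma> t :: real assume h: "\<bar>\<sigma>\<bar> \<le> K \<and> real n \<le> 2 * \<sigma> - 1 \<and> \<bar>t\<bar> \<ge> 1"
    then have t: "t \<noteq> 0" by auto
    define a b where "a = \<sigma> + (real k - 1) / 2" and "b = 1 - \<sigma> + (real k - 1) / 2"
    have "\<bar>t\<bar> ^ n * norm (Gamma (Complex b t)) \<le> C * norm (Gamma (Complex a t))"
      using h by (intro C) (auto simp: a_def b_def K'_def field_simps abs_le_iff)
    then have "\<bar>t\<bar> ^ n * (norm (Gamma (Complex b t)) / norm (Gamma (Complex a t))) \<le> C"
      using C by (cases "Gamma (Complex a t) = 0") (auto simp: field_simps)
    moreover have "(sqrt (real N) / (2 * pi)) powr (1 - 2 * \<sigma>) \<le> D"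
      using h by (intro D) (auto simp: abs_le_iff)
    ultimately have "(sqrt (real N) / (2 * pi)) powr (1 - 2 * \<sigma>) * (\<bar>t\<bar> ^ n * (norm (Gamma (Complex b t)) / norm (Gamma (Complex a t)))) \<le> D * C"
      using D by (intro mult_mono) auto
    then show "\<bar>t\<bar> ^ n * norm (chi k N eps (Complex \<sigma> t)) \<le> D * C"
      unfolding norm_chi[OF assms t] a_def b_def by (simp add: mult_ac)
  qed
qed

section \<open>Decay of cusp forms on the imaginary axis\<close>

lemma periodic_of_int:
  fixes g :: "complex \<Rightarrow> complex" and p :: real
  assumes per: "\<And>z. Im z > 0 \<Longrightarrow> g (z + of_real p) = g z" and "Im z > 0"
  shows "g (z + of_int m * of_real p) = g z"
proof -
  have nat: "g (z + of_nat n * of_real p) = g z" if "Im z > 0" for z n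
  proof (induction n)
    case (Suc n)
    show ?case using per[of "z + of_nat n * of_real p"] Suc that by (simp add: algebra_simps)
  qed simp
  show ?thesis
  proof (cases "m \<ge> 0")
    case True
    then show ?thesis using nat[of z "nat m"] assms by simp
  next
    case False
    then show ?thesis using nat[of "z + of_int m * of_real p" "nat (-m)"] assms by (simp add: algebra_simps)
  qed
qed

text \<open>In the variable \<open>q = exp (2 \<pi> i z / p)\<close> the function has a removable singularity with value 0 at \<open>q = 0\<close>.\<close>

lemma periodic_exp_decay:
  fixes g :: "complex \<Rightarrow> complex" and p :: real
  assumes hol: "g holomorphic_on upper_half_plane" and "p > 0"
    and per: "\<And>z. Im z > 0 \<Longrightarrow> g (z + of_real p) = g z"
    and lim: "(g \<longlongrightarrow> 0) (filtercomap Im at_top)"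
  shows "\<exists>C Y. \<forall>z. Im z \<ge> Y \<longrightarrow> norm (g z) \<le> C * exp (- 2 * pi * Im z / p)"
proof -
  define c where "c = of_real p / (2 * of_real pi * \<i>)"
  have c0: "c \<noteq> 0" using \<open>p > 0\<close> by (auto simp: c_def)
  have c_alt: "c = - \<i> * of_real (p / (2 * pi))" by (simp add: c_def field_simps)
  define h where "h q = (if q = 0 then 0 else g (c * Ln q))" for q
  have Im_c: "Im (c * z) = - (p / (2 * pi)) * Re z" for z unfolding c_alt by simp
  have Im_pos: "Im (c * Ln q) > 0" if "q \<noteq> 0" "norm q < 1" for q
    unfolding Im_c using that \<open>p > 0\<close> by (intro mult_neg_neg) (auto simp: field_simps)
  have opH: "open upper_half_plane" unfolding upper_half_plane_def by (rule open_halfspace_Im_gt)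
  have gc: "g (z + c * (2 * of_int m * of_real pi * \<i>)) = g z" if "Im z > 0" for z m
    using periodic_of_int[where g = g and p = p and z = z and m = m] per that by (simp add: c_def mult_ac)
  have h1: "h holomorphic_on (ball 0 1 - \<real>\<^sub>\<le>\<^sub>0)"
  proof (rule holomorphic_transform[of "g \<circ> (\<lambda>q. c * Ln q)"])
    show "g \<circ> (\<lambda>q. c * Ln q) holomorphic_on (ball 0 1 - \<real>\<^sub>\<le>\<^sub>0)"
      by (rule holomorphic_on_compose_gen[OF _ hol])
        (auto intro!: holomorphic_intros Im_pos simp: upper_half_plane_def)
  qed (auto simp: h_def)
  \<comment> \<open>\<open>Ln\<close> jumps across the negative axis. Near that axis the branch
    \<open>Ln (- q) + \<i> * pi\<close> is used instead; it differs from \<open>Ln q\<close> by a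
    multiple of 2 pi i, which becomes a multiple of the period p after multiplication by c.\<close>
  have h2: "h holomorphic_on (ball 0 1 \<inter> {q. Re q < 0})"
  proof (rule holomorphic_transform[of "g \<circ> (\<lambda>q. c * (Ln (- q) + \<i> * pi))"])
    have "Im (c * (Ln (- q) + \<i> * pi)) > 0" if "Re q < 0" "norm q < 1" for q
    proof -
      have "q \<noteq> 0" using that by auto
      then show ?thesis unfolding Im_c using that \<open>p > 0\<close> by (intro mult_neg_neg) (auto simp: field_simps)
    qed
    then show "g \<circ> (\<lambda>q. c * (Ln (- q) + \<i> * pi)) holomorphic_on (ball 0 1 \<inter> {q. Re q < 0})"
      by (intro holomorphic_on_compose_gen[OF _ hol])
        (auto intro!: holomorphic_intros simp: upper_half_plane_def complex_nonpos_Reals_iff simp del: times_complex.sel)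
    fix q assume q: "q \<in> ball 0 1 \<inter> {q. Re q < 0}"
    then have "q \<noteq> 0" by auto
    have "exp (Ln (- q) + \<i> * pi) = exp (Ln q)"
      using \<open>q \<noteq> 0\<close> by (simp add: exp_add)
    then obtain m :: int where m: "Ln (- q) + \<i> * pi = Ln q + of_int (2 * m) * pi * \<i>"
      by (auto simp: exp_eq)
    have "c * (Ln (- q) + \<i> * pi) = c * Ln q + c * (2 * of_int m * of_real pi * \<i>)"
      unfolding m by (simp add: algebra_simps)
    then show "(g \<circ> (\<lambda>q. c * (Ln (- q) + \<i> * pi))) q = h q"
      using gc[of "c * Ln q" m] Im_pos[of q] q \<open>q \<noteq> 0\<close> by (simp add: h_def)
  qed
  have "h holomorphic_on ((ball 0 1 - \<real>\<^sub>\<le>\<^sub>0) \<union> (ball 0 1 \<inter> {q. Re q < 0}))"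
    by (rule holomorphic_on_Un[OF h1 h2]) (auto intro!: open_Int open_halfspace_Re_lt open_Diff)
  moreover have "(ball 0 1 - \<real>\<^sub>\<le>\<^sub>0) \<union> (ball 0 1 \<inter> {q. Re q < 0}) = ball 0 1 - {0}"
    by (auto simp: complex_nonpos_Reals_iff complex_eq_iff)
  ultimately have h3: "h holomorphic_on (ball 0 1 - {0})" by simp
  have h0: "(h \<longlongrightarrow> 0) (at 0)"
  proof (rule tendstoI)
    fix e :: real assume "e > 0"
    from tendstoD[OF lim this] obtain Y where Y: "\<And>z. Im z \<ge> Y \<Longrightarrow> norm (g z) < e"
      by (auto simp: eventually_filtercomap_at_top_linorder)
    have "eventually (\<lambda>q. q \<noteq> 0 \<and> norm q < exp (- (2 * pi * Y / p))) (at (0::complex))"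
      unfolding eventually_at by (rule exI[of _ "exp (- (2 * pi * Y / p))"]) auto
    then show "eventually (\<lambda>q. dist (h q) 0 < e) (at 0)"
    proof eventually_elim
      case (elim q)
      then have "ln (norm q) < - (2 * pi * Y / p)" by (metis exp_gt_zero ln_exp ln_less_cancel_iff zero_less_norm_iff)
      then have "Im (c * Ln q) \<ge> Y" unfolding Im_c using elim \<open>p > 0\<close> by (simp add: field_simps)
      then show ?case using Y elim by (simp add: h_def)
    qed
  qed
  have "h holomorphic_on ball 0 1"
  proof (rule no_isolated_singularity[OF _ h3])
    show "continuous_on (ball 0 1) h"
    proof (rule continuous_at_imp_continuous_on, safe)
      fix q :: complex assume "q \<in> ball 0 1"
      then show "isCont h q"
        using h0 h3 by (cases "q = 0") (auto simp: isCont_def h_def[of 0] intro!: continuous_on_interior[THEN isCont_def[THEN iffD1]] dest!: holomorphic_on_imp_continuous_on simp: interior_open open_delete)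
    qed
  qed auto
  then obtain d where "(h has_field_derivative d) (at 0)"
    by (meson centre_in_ball field_differentiable_def holomorphic_on_imp_differentiable_at open_ball zero_less_one)
  \<comment> \<open>Because h vanishes at 0, h q / q stays bounded near 0. This turns mere
    convergence to 0 at the cusp into decay like |q|, which is the exponential in the claim.\<close>
  then have "((\<lambda>q. h q / q) \<longlongrightarrow> d) (at 0)"
    by (simp add: has_field_derivative_iff h_def[of 0])
  from tendstoD[OF this zero_less_one] obtain r where r: "r > 0" "\<And>q. q \<noteq> 0 \<Longrightarrow> norm q < r \<Longrightarrow> norm (h q / q - d) < 1"
    by (auto simp: eventually_at dist_norm)
  show ?thesis
  \<comment> \<open>The second entry of the maximum makes |q| at most r / 2; the entry 1 keeps z in
    the upper half plane.\<close>
  proof (rule exI[of _ "norm d + 1"], rule exI[of _ "max 1 (- p / (2 * pi) * ln (r / 2))"], intro allI impI)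
    fix z assume z: "max 1 (- p / (2 * pi) * ln (r / 2)) \<le> Im z"
    define q where "q = exp (z / c)"
    have zc: "z / c = \<i> * of_real (2 * pi / p) * z" using \<open>p > 0\<close> by (simp add: c_def field_simps)
    have nq: "norm q = exp (- 2 * pi * Im z / p)" unfolding q_def norm_exp_eq_Re zc by simp
    have "- 2 * pi * Im z / p \<le> ln (r / 2)" using z \<open>p > 0\<close> by (auto simp: field_simps)
    then have "exp (- 2 * pi * Im z / p) \<le> r / 2" using r by (metis exp_le_cancel_iff exp_ln half_gt_zero)
    then have "norm q < r" unfolding nq using r by linarith
    then have "norm (h q / q - d) < 1" using r by (auto simp: q_def)
    then have "norm (h q / q) \<le> norm d + 1" using norm_triangle_sub[of "h q / q" d] by linarith
    then have hq: "norm (h q) \<le> (norm d + 1) * norm q" by (simp add: norm_divide q_def field_simps)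
    have "exp (Ln q) = exp (z / c)" by (simp add: q_def)
    then obtain m :: int where m: "Ln q = z / c + of_int (2 * m) * pi * \<i>" by (auto simp: exp_eq)
    have "c * Ln q = z + c * (2 * of_int m * of_real pi * \<i>)" using c0 by (simp add: m field_simps)
    then have "h q = g z" using gc[of z m] z by (simp add: h_def q_def)
    then show "norm (g z) \<le> (norm d + 1) * exp (- 2 * pi * Im z / p)" using hq nq by simp
  qed
qed

lemma exp_minus_le_power:
  fixes x :: real
  assumes "x > 0"
  shows "exp (- x) * x ^ n \<le> fact n"
proof -
  have s: "(\<lambda>i. x ^ i / fact i) sums exp x"
    using exp_converges[of x] by (simp add: scaleR_conv_of_real field_simps)
  have "(\<Sum>i\<in>{n}. x ^ i / fact i) \<le> (\<Sum>i. x ^ i / fact i)"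
    using s assms by (intro sum_le_suminf) (auto simp: sums_iff)
  then have "x ^ n / fact n \<le> exp x" using s by (simp add: sums_iff)
  then show ?thesis by (simp add: exp_minus field_simps)
qed

text \<open>For large y this is the decay of f at infinity. For small y the inversion z -> -1/z
  moves the cusp 0 to infinity and gives decay like exp (- c / y), which beats every power of y.
  With B arbitrary the bound makes the Mellin integral converge at 0 for every exponent.\<close>

lemma cusp_form_imaginary_axis:
  assumes f: "f \<in> cusp_forms k N" and "N > 0"
  shows "\<exists>C>0. \<forall>y>0. norm (f (Complex 0 y)) \<le> C * (y ^ B * exp (- y))"
proof -
  have hol: "f holomorphic_on upper_half_plane"
    and inv: "\<And>A z. A \<in> Gamma0 N \<Longrightarrow> Im z > 0 \<Longrightarrow> slash k A f z = f z"
    and cusp: "\<And>A. A \<in> SL2Z \<Longrightarrow> (slash k A f \<longlongrightarrow> 0) (filtercomap Im at_top)"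
    using f by (auto simp: cusp_forms_def upper_half_plane_def)
  define U S where "U = (vector [vector [1, 1], vector [0, 1]] :: int^2^2)"
    and "S = (vector [vector [0, -1], vector [1, 0]] :: int^2^2)"
  have id: "mat 1 \<in> SL2Z" by (simp add: SL2Z_def)
  have [simp]: "slash k (mat 1) f = f"
    by (simp add: slash_def moebius_def automorphy_def mat_def fun_eq_iff)
  have flim: "(f \<longlongrightarrow> 0) (filtercomap Im at_top)" using cusp[OF id] by simp
  have "U \<in> Gamma0 N" by (simp add: Gamma0_def SL2Z_def U_def det_2 vector_2)
  from inv[OF this] have fper: "f (z + of_real 1) = f z" if "Im z > 0" for z
    using that by (simp add: slash_def moebius_def automorphy_def U_def vector_2)
  define g where "g = slash k S f"
  have g: "g z = f (- 1 / z) / z ^ k" for z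
    by (simp add: g_def slash_def moebius_def automorphy_def S_def vector_2)
  have "S \<in> SL2Z" by (simp add: SL2Z_def S_def det_2 vector_2)
  from cusp[OF this] have glim: "(g \<longlongrightarrow> 0) (filtercomap Im at_top)" by (simp add: g_def)
  have Imi: "Im (- 1 / z) > 0" if "Im z > 0" for z
    using that by (auto simp: Im_divide intro!: divide_pos_pos add_nonneg_pos)
  have ghol: "g holomorphic_on upper_half_plane"
  proof -
    have "(f \<circ> (\<lambda>z. - 1 / z)) holomorphic_on upper_half_plane"
      using Imi by (intro holomorphic_on_compose_gen[OF _ hol]) (auto intro!: holomorphic_intros simp: upper_half_plane_def)
    then have "(\<lambda>z. f (- 1 / z)) holomorphic_on upper_half_plane" unfolding o_def .
    then show ?thesis unfolding g[abs_def]
      by (intro holomorphic_on_divide holomorphic_on_power holomorphic_on_ident) (auto simp: upper_half_plane_def)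
  qed
  \<comment> \<open>At the cusp 0 the period is N: the lower triangular matrix with entry -N is the
    conjugate of the translation by N under the inversion.\<close>
  have gper: "g (z + of_real (real N)) = g z" if z: "Im z > 0" for z
  proof -
    define A where "A = (vector [vector [1, 0], vector [- int N, 1]] :: int^2^2)"
    have A: "A \<in> Gamma0 N" by (simp add: Gamma0_def SL2Z_def A_def det_2 vector_2)
    have z0: "z \<noteq> 0" "z + of_nat N \<noteq> 0" using z by (auto simp: complex_eq_iff)
    have au: "automorphy A (- 1 / z) = (z + of_nat N) / z"
      using z0 by (simp add: automorphy_def A_def vector_2 field_simps)
    have mo: "moebius A (- 1 / z) = - 1 / (z + of_nat N)"
      unfolding moebius_def au using z0 by (simp add: A_def vector_2 field_simps)
    from inv[OF A Imi[OF z]] show ?thesis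
      unfolding slash_def au mo g using z0 by (simp add: field_simps power_divide)
  qed
  obtain C1 Y1 where 1: "\<And>z. Im z \<ge> Y1 \<Longrightarrow> norm (f z) \<le> C1 * exp (- 2 * pi * Im z / 1)"
    using periodic_exp_decay[OF hol zero_less_one fper flim] by blast
  obtain C2 Y2 where 2: "\<And>z. Im z \<ge> Y2 \<Longrightarrow> norm (g z) \<le> C2 * exp (- 2 * pi * Im z / real N)"
    using periodic_exp_decay[OF ghol _ gper glim] \<open>N > 0\<close> by auto
  \<comment> \<open>Cut points at least 1: beyond Z1 the factor y^B is at least 1, and below 1 / Z2
    one has y <= 1. Between them compactness suffices.\<close>
  define Z1 Z2 where "Z1 = max 1 Y1" and "Z2 = max 1 Y2"
  have "1 / Z2 > 0" by (simp add: Z2_def)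
  then have "0 < y" if "1 / Z2 \<le> y" for y using that by linarith
  then have "continuous_on {1 / Z2..Z1} (\<lambda>y. f (Complex 0 y))"
    unfolding Complex_eq
    by (intro continuous_on_compose2[OF holomorphic_on_imp_continuous_on[OF hol]] continuous_intros)
       (auto simp: upper_half_plane_def)
  then have "bounded ((\<lambda>y. f (Complex 0 y)) ` {1 / Z2..Z1})"
    by (intro compact_imp_bounded compact_continuous_image) auto
  then obtain M where M: "M > 0" "\<And>y. y \<in> {1 / Z2..Z1} \<Longrightarrow> norm (f (Complex 0 y)) \<le> M"
    by (auto simp: bounded_pos)
  define m where "m = (1 / Z2) ^ B * exp (- Z1)"
  have m: "m > 0" by (auto simp: m_def Z2_def)
  define c where "c = 2 * pi / real N"
  have c: "c > 0" using \<open>N > 0\<close> by (simp add: c_def)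
  \<comment> \<open>From exp (- x) <= n! / x^n with x = c / y and n = B + k. The k surplus powers of
    y cancel the factor y^k of the slash action, and exp 1 pays for inserting exp (- y) when y <=
    1.\<close>
  define C3 where "C3 = \<bar>C2\<bar> * (fact (B + k) / c ^ (B + k) * exp 1)"
  show ?thesis
  proof (intro exI[of _ "\<bar>C1\<bar> + C3 + M / m"] conjI allI impI)
    show "\<bar>C1\<bar> + C3 + M / m > 0" using M m c by (auto simp: C3_def intro!: add_nonneg_pos)
    fix y :: real assume y: "y > 0"
    have C0: "0 \<le> \<bar>C1\<bar>" "0 \<le> C3" "0 \<le> M / m" using M m c by (auto simp: C3_def)
    have dom: "X * (y ^ B * exp (- y)) \<le> (\<bar>C1\<bar> + C3 + M / m) * (y ^ B * exp (- y))"
      if "X \<in> {\<bar>C1\<bar>, C3, M / m}" for X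
      using that C0 y by (intro mult_right_mono) auto
    consider "y \<ge> Z1" | "1 / Z2 \<le> y" "y \<le> Z1" | "y \<le> 1 / Z2" by linarith
    then show "norm (f (Complex 0 y)) \<le> (\<bar>C1\<bar> + C3 + M / m) * (y ^ B * exp (- y))"
    proof cases
      case 1
      have "norm (f (Complex 0 y)) \<le> C1 * exp (- 2 * pi * y)" using \<open>\<And>z. Im z \<ge> Y1 \<Longrightarrow> _\<close>[of "Complex 0 y"] 1 by (simp add: Z1_def)
      also have "\<dots> \<le> \<bar>C1\<bar> * exp (- 2 * pi * y)" by (intro mult_right_mono) auto
      also have "\<dots> \<le> \<bar>C1\<bar> * (1 * exp (- y))" using y pi_gt3 by (intro mult_left_mono) auto
      also have "\<dots> \<le> \<bar>C1\<bar> * (y ^ B * exp (- y))"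
        using 1 by (intro mult_left_mono mult_right_mono one_le_power) (auto simp: Z1_def)
      also note dom[of "\<bar>C1\<bar>"]
      finally show ?thesis by simp
    next
      case 2
      have "m \<le> y ^ B * exp (- y)" unfolding m_def
        using 2 y by (intro mult_mono power_mono) (auto simp: Z2_def)
      then have "M \<le> M / m * (y ^ B * exp (- y))" using M m by (simp add: field_simps)
      then show ?thesis using M(2)[of y] 2 dom[of "M / m"] by auto
    next
      case 3
      have Z2: "Z2 > 0" by (simp add: Z2_def)
      have "1 / Z2 \<le> 1" by (simp add: Z2_def)
      then have y1: "y \<le> 1" using 3 by linarith
      have "1 / y \<ge> Z2" using 3 y Z2 by (simp add: field_simps)
      then have y2: "1 / y \<ge> Y2" by (simp add: Z2_def)
      have e: "- 1 / Complex 0 (1 / y) = Complex 0 y" using y by (simp add: complex_eq_iff Re_divide Im_divide power2_eq_square)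
      have ny: "norm (Complex 0 (1 / y)) = 1 / y" using y by (simp add: cmod_def)
      have "norm (g (Complex 0 (1 / y))) = norm (f (Complex 0 y)) * y ^ k"
        unfolding g e norm_divide norm_power ny using y by (simp add: field_simps)
      then have "norm (f (Complex 0 y)) * y ^ k \<le> C2 * exp (- c / y)"
        using \<open>\<And>z. Im z \<ge> Y2 \<Longrightarrow> _\<close>[of "Complex 0 (1 / y)"] y2 by (simp add: c_def mult.commute)
      also have "\<dots> \<le> \<bar>C2\<bar> * exp (- (c / y))" by (simp add: mult_right_mono)
      also have "\<dots> \<le> \<bar>C2\<bar> * (fact (B + k) / (c / y) ^ (B + k))"
        using exp_minus_le_power[of "c / y" "B + k"] c y by (intro mult_left_mono) (auto simp: field_simps)
      also have "\<dots> = \<bar>C2\<bar> * (fact (B + k) / c ^ (B + k)) * y ^ B * y ^ k"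
        using y by (simp add: power_divide power_add field_simps)
      finally have "norm (f (Complex 0 y)) \<le> \<bar>C2\<bar> * (fact (B + k) / c ^ (B + k)) * y ^ B"
        using y by (subst (asm) mult_le_cancel_right_pos) auto
      also have "\<dots> = \<bar>C2\<bar> * (fact (B + k) / c ^ (B + k)) * (y ^ B * (exp 1 * exp (- 1)))"
        by (simp add: exp_minus)
      also have "\<dots> \<le> \<bar>C2\<bar> * (fact (B + k) / c ^ (B + k)) * (y ^ B * (exp 1 * exp (- y)))"
        using c y y1 by (intro mult_left_mono) auto
      also have "\<dots> = C3 * (y ^ B * exp (- y))" by (simp add: C3_def)
      also note dom[of C3]
      finally show ?thesis by simp
    qed
  qed
qed

section \<open>The Mellin transform\<close>

text \<open>With a = 2 pi n this is the Mellin transform of the n-th Fourier term on the imaginary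
  axis.\<close>

lemma Gamma_integral_scaled:
  fixes a :: real and z :: complex
  assumes "a > 0" "Re z > 0"
  shows "set_integrable lborel {0<..} (\<lambda>y. of_real y powr (z - 1) * of_real (exp (- a * y)))"
    and "(LINT y:{0<..}|lborel. of_real y powr (z - 1) * of_real (exp (- a * y))) = Gamma z * of_real a powr (- z)"
proof -
  define F :: "real \<Rightarrow> complex" where "F y = indicator {0<..} y *\<^sub>R (of_real y powr (z - 1) * of_real (exp (- y)))" for y
  have meas: "F \<in> borel_measurable lborel" unfolding F_def by measurable
  have "integrable lebesgue F"
    using absolutely_integrable_Gamma_integral'[OF assms(2)]
    by (simp add: F_def[abs_def] set_integrable_def exp_minus divide_inverse of_real_inverse)
  then have int: "integrable lborel F" using meas by (simp add: integrable_completion)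
  have "(LINT y:{0<..}|lborel. of_real y powr (z - 1) * complex_of_real (exp (- y))) = integral {0<..} (\<lambda>y. of_real y powr (z - 1) * of_real (exp (- y)))"
    using int by (intro set_borel_integral_eq_integral) (simp add: F_def[abs_def] set_integrable_def)
  also have "\<dots> = Gamma z"
    using Gamma_integral_complex'[OF assms(2)] by (intro integral_unique) (simp add: exp_minus divide_inverse of_real_inverse)
  finally have val: "integral\<^sup>L lborel F = Gamma z" by (simp add: F_def[abs_def] set_lebesgue_integral_def)
  define H :: "real \<Rightarrow> complex" where "H y = indicator {0<..} y *\<^sub>R (of_real y powr (z - 1) * of_real (exp (- a * y)))" for y
  have sc: "F (0 + a * y) = of_real a powr (z - 1) * H y" for y
    using assms by (auto simp: F_def H_def indicator_def zero_less_mult_iff powr_times_real)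
  have "integrable lborel (\<lambda>y. F (0 + a * y))" using int assms by (intro lborel_integrable_real_affine) auto
  then show "set_integrable lborel {0<..} (\<lambda>y. of_real y powr (z - 1) * of_real (exp (- a * y)))"
    unfolding sc set_integrable_def H_def[symmetric] using assms
      integrable_mult_right[of "inverse (of_real a powr (z - 1))" lborel "\<lambda>y. of_real a powr (z - 1) * H y"]
    by (simp add: mult.assoc[symmetric])
  have "Gamma z = \<bar>a\<bar> *\<^sub>R (\<integral>y. F (0 + a * y) \<partial>lborel)"
    using assms by (subst val[symmetric], intro lborel_integral_real_affine) auto
  also have "\<dots> = of_real a powr z * (LINT y:{0<..}|lborel. of_real y powr (z - 1) * of_real (exp (- a * y)))"
    unfolding sc integral_mult_right_zero using assms
    by (simp add: set_lebesgue_integral_def H_def scaleR_conv_of_real powr_diff)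
  finally show "(LINT y:{0<..}|lborel. of_real y powr (z - 1) * of_real (exp (- a * y))) = Gamma z * of_real a powr (- z)"
    using assms by (simp add: powr_minus field_simps)
qed

lemma Gamma_integral_scaled_real:
  assumes "a > 0" "x > 0"
  shows "set_integrable lborel {0<..} (\<lambda>y::real. y powr (x - 1) * exp (- a * y))"
    and "(LINT y:{0<..}|lborel. y powr (x - 1) * exp (- a * y)) = Gamma x * a powr (- x)"
proof -
  have e: "complex_of_real y powr (of_real x - 1) * of_real (exp (- a * y)) = of_real (y powr (x - 1) * exp (- a * y))" if "y > 0" for y
    using that powr_of_real[of y "x - 1"] by simp
  have i: "set_integrable lborel {0<..} (\<lambda>y. complex_of_real (y powr (x - 1) * exp (- a * y)))"
    using Gamma_integral_scaled(1)[of a "of_real x"] assms e by (subst set_integrable_cong[OF refl refl e[symmetric]]) auto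
  then show j: "set_integrable lborel {0<..} (\<lambda>y::real. y powr (x - 1) * exp (- a * y))"
    by (simp add: complex_of_real_integrable_eq[symmetric] set_integrable_def scaleR_conv_of_real flip: of_real_mult)
  have "(LINT y:{0<..}|lborel. complex_of_real (y powr (x - 1) * exp (- a * y)))
      = (LINT y:{0<..}|lborel. complex_of_real y powr (of_real x - 1) * of_real (exp (- a * y)))"
    by (rule set_lebesgue_integral_cong) (use e in auto)
  also have "\<dots> = Gamma (of_real x) * of_real a powr (- of_real x)"
    using Gamma_integral_scaled(2)[of a "of_real x"] assms by auto
  also have "\<dots> = of_real (Gamma x * a powr (- x))" using assms by (simp add: Gamma_complex_of_real powr_of_real flip: of_real_minus)
  also have "(LINT y:{0<..}|lborel. complex_of_real (y powr (x - 1) * exp (- a * y))) = of_real (LINT y:{0<..}|lborel. y powr (x - 1) * exp (- a * y))"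
    by (rule set_integral_complex_of_real)
  finally show "(LINT y:{0<..}|lborel. y powr (x - 1) * exp (- a * y)) = Gamma x * a powr (- x)"
    by (metis of_real_eq_iff)
qed

definition mellin :: "(real \<Rightarrow> complex) \<Rightarrow> complex \<Rightarrow> complex" where
  "mellin F z = (LINT y:{0<..}|lborel. F y * of_real y powr (z - 1))"

text \<open>Decay faster than any power at both ends makes the integral converge for every z, and
  |y^(z - 1)| depends on Re z only, hence a bound in vertical strips that is uniform in the height.
  For holomorphy the domination is proved with a spare factor y + 1/y, which measures how fast the
  truncated integrals converge.\<close>

lemma mellin_entire_bounded:
  assumes cont: "continuous_on {0<..} F"
    and dec: "\<And>B::nat. \<exists>C>0. \<forall>y>0. norm (F y) \<le> C * (y ^ B * exp (- y))"
  shows "mellin F holomorphic_on UNIV" and "\<exists>C. \<forall>z. \<bar>Re z\<bar> \<le> real K \<longrightarrow> norm (mellin F z) \<le> C"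
proof -
  \<comment> \<open>After K + 2 powers of y are taken from the decay of F, the exponents left over
    for |Re z| <= K lie between 0 and 2 K + 2, and 1 + y^(2 K + 2) dominates all of these
    powers.\<close>
  define dom where "dom C K y = C * ((1 + y ^ (2 * K + 2)) * exp (- y))" for C :: real and K :: nat and y :: real
  have dom_int: "set_integrable lborel {0<..} (dom C K)" for C K
  proof -
    have "set_integrable lborel {0<..} (\<lambda>y. C * (y powr (1 - 1) * exp (- 1 * y) + y powr (real (2 * K + 3) - 1) * exp (- 1 * y)))"
      by (intro set_integrable_mult_right set_integral_add Gamma_integral_scaled_real) auto
    moreover have "y powr (real (2 * K + 3) - 1) = y ^ (2 * K + 2)" if "y > 0" for y :: real
    proof -
      have "real (2 * K + 3) - 1 = real (2 * K + 2)" by simp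
      then show ?thesis using that powr_realpow by metis
    qed
    ultimately show ?thesis
      by (elim iffD1[OF set_integrable_cong, rotated -1]) (auto simp: dom_def algebra_simps)
  qed
  have dom_bound: "\<exists>C>0. \<forall>z y. \<bar>Re z\<bar> \<le> real K \<longrightarrow> y > 0 \<longrightarrow>
      norm (F y * of_real y powr (z - 1)) * (y + 1 / y) \<le> dom C K y" for K
  proof -
    obtain C where C: "C > 0" "\<And>y. y > 0 \<Longrightarrow> norm (F y) \<le> C * (y ^ (K + 2) * exp (- y))" using dec by blast
    show ?thesis
    proof (intro exI[of _ "2 * C"] conjI allI impI)
      show "2 * C > 0" using C by simp
      fix z :: complex and y :: real assume h: "\<bar>Re z\<bar> \<le> real K" "y > 0"
      have pw: "y powr a \<le> 1 + y ^ (2 * K + 2)" if "0 \<le> a" "a \<le> real (2 * K + 2)" for a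
      proof (cases "y \<le> 1")
        case True
        then have "y powr a \<le> 1" using h that by (intro powr_le1) auto
        then show ?thesis using h by (smt (verit) zero_le_power)
      next
        case False
        then have "y powr a \<le> y powr (real (2 * K + 2))" using that by (intro powr_mono) auto
        then show ?thesis using h by (subst (asm) powr_realpow) auto
      qed
      have "norm (F y * of_real y powr (z - 1)) * (y + 1 / y) \<le> C * (y ^ (K + 2) * exp (- y)) * y powr (Re z - 1) * (y + 1 / y)"
        unfolding norm_mult using h C(1) C(2)[OF h(2)] by (intro mult_right_mono mult_mono) (auto simp: norm_powr_real_powr simp del: power_Suc)
      also have "\<dots> = C * exp (- y) * (y powr (Re z + real K + 2) + y powr (Re z + real K))"
      proof -
        have "y powr real (K + 2) = y ^ (K + 2)" using h by (intro powr_realpow)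
        then have "y ^ (K + 2) = y powr (real K + 2)" by (simp add: add_ac)
        then have "y ^ (K + 2) * y powr (Re z - 1) * (y + 1 / y) = y powr (real K + 2) * y powr (Re z - 1) * (y powr 1 + y powr (-1))"
          using h by (simp add: powr_minus divide_inverse)
        also have "\<dots> = y powr (real K + 2 + (Re z - 1) + 1) + y powr (real K + 2 + (Re z - 1) + - 1)"
          by (simp only: powr_add distrib_left)
        also have "real K + 2 + (Re z - 1) + 1 = Re z + real K + 2" by simp
        also have "real K + 2 + (Re z - 1) + - 1 = Re z + real K" by simp
        finally show ?thesis by (simp add: mult_ac)
      qed
      also have "\<dots> \<le> C * exp (- y) * ((1 + y ^ (2 * K + 2)) + (1 + y ^ (2 * K + 2)))"
        using h C by (intro mult_left_mono add_mono pw) auto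
      finally show "norm (F y * of_real y powr (z - 1)) * (y + 1 / y) \<le> dom (2 * C) K y"
        by (simp add: dom_def algebra_simps)
    qed
  qed
  have y1: "1 \<le> y + 1 / y" if "y > 0" for y :: real
    using that by (cases "y \<ge> 1") (auto simp: field_simps intro: add_increasing add_increasing2)
  define u where "u z y = indicator {0<..} y *\<^sub>R (F y * of_real y powr (z - 1))" for z :: complex and y :: real
  have meas: "u z \<in> borel_measurable lborel" for z
  proof -
    have "continuous_on {0<..} (\<lambda>y. F y * of_real y powr (z - 1))"
      by (intro continuous_intros cont) (auto simp: complex_nonpos_Reals_iff)
    then show ?thesis unfolding u_def
      by (simp add: borel_measurable_continuous_on_indicator)
  qed
  have mel: "mellin F z = integral\<^sup>L lborel (u z)" for z
    by (simp add: mellin_def set_lebesgue_integral_def u_def[abs_def])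
  define du where "du C K y = indicator {0<..} y *\<^sub>R dom C K y" for C K y
  have du_int: "integrable lborel (du C K)" for C K
    using dom_int[of C K] by (simp add: set_integrable_def du_def[abs_def])
  have u_int: "integrable lborel (u z)" for z
  proof -
    define K where "K = nat \<lceil>\<bar>Re z\<bar>\<rceil>"
    have K: "\<bar>Re z\<bar> \<le> real K" by (simp add: K_def)
    obtain C where C: "C > 0" "\<And>y. y > 0 \<Longrightarrow> norm (F y * of_real y powr (z - 1)) * (y + 1 / y) \<le> dom C K y"
      using dom_bound[of K] K by blast
    have "norm (u z y) \<le> norm (du C K y)" for y
    proof (cases "y > 0")
      case True
      have "norm (F y * of_real y powr (z - 1)) * 1 \<le> norm (F y * of_real y powr (z - 1)) * (y + 1 / y)"
        using y1[OF True] by (intro mult_left_mono) auto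
      then show ?thesis using C(2)[OF True] True by (simp add: u_def du_def)
    qed (simp add: u_def)
    then show ?thesis by (intro Bochner_Integration.integrable_bound[OF du_int meas]) auto
  qed
  show "\<exists>C. \<forall>z. \<bar>Re z\<bar> \<le> real K \<longrightarrow> norm (mellin F z) \<le> C" for K
  proof -
    obtain C where C: "C > 0" "\<And>y z. \<bar>Re z\<bar> \<le> real K \<Longrightarrow> y > 0 \<Longrightarrow> norm (F y * of_real y powr (z - 1)) * (y + 1 / y) \<le> dom C K y"
      using dom_bound[of K] by blast
    show ?thesis
    proof (intro exI allI impI)
      fix z assume z: "\<bar>Re z\<bar> \<le> real K"
      have "norm (u z y) \<le> du C K y" for y
      proof (cases "y > 0")
        case True
        have "norm (F y * of_real y powr (z - 1)) * 1 \<le> norm (F y * of_real y powr (z - 1)) * (y + 1 / y)"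
          using y1[OF True] by (intro mult_left_mono) auto
        then show ?thesis using C(2)[OF z True] True by (simp add: u_def du_def)
      qed (simp add: u_def du_def)
      then show "norm (mellin F z) \<le> integral\<^sup>L lborel (du C K)"
        unfolding mel by (intro Bochner_Integration.integral_norm_bound_integral u_int du_int) auto
    qed
  qed
  define M where "M n z = integral (cbox (1 / real (Suc n)) (real (Suc n))) (\<lambda>y. F y * exp ((z - 1) * of_real (ln y)))" for n z
  have pos: "y > 0" if "y \<in> cbox (1 / real (Suc n)) (real (Suc n))" for y n
  proof -
    have "1 / real (Suc n) > 0" by simp
    then show ?thesis using that by (simp only: cbox_interval atLeastAtMost_iff) linarith
  qed
  have cF: "continuous_on (cbox (1 / real (Suc n)) (real (Suc n))) F" for n
    by (rule continuous_on_subset[OF cont]) (use pos in auto)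
  have Mhol: "M n holomorphic_on UNIV" for n
    unfolding M_def
  proof (rule leibniz_rule_holomorphic)
    fix z t show "((\<lambda>z. F t * exp ((z - 1) * of_real (ln t))) has_field_derivative
        F t * (exp ((z - 1) * of_real (ln t)) * of_real (ln t))) (at z within UNIV)"
      by (auto intro!: derivative_eq_intros)
  next
    fix z :: complex
    show "(\<lambda>y. F y * exp ((z - 1) * of_real (ln y))) integrable_on cbox (1 / real (Suc n)) (real (Suc n))"
      using pos by (intro integrable_continuous continuous_intros cF) force+
  next
    show "continuous_on (UNIV \<times> cbox (1 / real (Suc n)) (real (Suc n)))
     (\<lambda>(z, t). F t * (exp ((z - 1) * complex_of_real (ln t)) * complex_of_real (ln t)))"
      unfolding split_beta using pos
      by (intro continuous_intros continuous_on_compose2[OF cF]) force+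
  qed auto
  show "mellin F holomorphic_on UNIV"
  proof (rule holomorphic_uniform_sequence[OF open_UNIV Mhol])
    fix x :: complex
    define K where "K = nat \<lceil>\<bar>Re x\<bar>\<rceil> + 1"
    have K: "\<bar>Re z\<bar> \<le> real K" if "z \<in> cball x 1" for z
    proof -
      have "\<bar>Re (x - z)\<bar> \<le> 1" using that abs_Re_le_cmod[of "x - z"] by (simp add: dist_norm)
      moreover have "\<bar>Re x\<bar> \<le> real (nat \<lceil>\<bar>Re x\<bar>\<rceil>)" by (rule real_nat_ceiling_ge)
      ultimately have "\<bar>Re z\<bar> \<le> real (nat \<lceil>\<bar>Re x\<bar>\<rceil>) + 1" by (simp only: minus_complex.sel)
      then show ?thesis by (simp add: K_def del: of_nat_nat)
    qed
    obtain C where C: "C > 0" "\<And>y z. \<bar>Re z\<bar> \<le> real K \<Longrightarrow> y > 0 \<Longrightarrow> norm (F y * of_real y powr (z - 1)) * (y + 1 / y) \<le> dom C K y"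
      using dom_bound[of K] by blast
    define J where "J = integral\<^sup>L lborel (du C K)"
    \<comment> \<open>Outside the interval of truncation y + 1/y is at least n + 1, so the spare
      factor yields the rate 1 / (n + 1), uniformly on the ball.\<close>
    have key: "norm (M n z - mellin F z) \<le> J / real (Suc n)" if z: "z \<in> cball x 1" for n z
    proof -
      let ?S = "cbox (1 / real (Suc n)) (real (Suc n))"
      define v where "v y = indicator ?S y *\<^sub>R (F y * exp ((z - 1) * of_real (ln y)))" for y
      have si: "set_integrable lborel ?S (\<lambda>y. F y * exp ((z - 1) * of_real (ln y)))"
        unfolding set_integrable_def
        by (intro borel_integrable_compact continuous_intros cF) (use pos[of _ n] in force)+
      have Mv: "M n z = integral\<^sup>L lborel v"
        using set_borel_integral_eq_integral(2)[OF si] by (simp add: M_def v_def[abs_def] set_lebesgue_integral_def)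
      have v_int: "integrable lborel v" using si by (simp add: v_def[abs_def] set_integrable_def)
      have "norm (v y - u z y) \<le> du C K y / real (Suc n)" for y
      proof (cases "y > 0")
        case True
        have e: "exp ((z - 1) * of_real (ln y)) = of_real y powr (z - 1)"
          using True by (simp add: powr_def Ln_of_real)
        show ?thesis
        proof (cases "y \<in> ?S")
          case True
          then show ?thesis using \<open>y > 0\<close> e C(1) by (simp add: u_def v_def du_def dom_def)
        next
          case False
          have "real (Suc n) \<le> y + 1 / y"
          proof (cases "y > real (Suc n)")
            case True
            then show ?thesis using \<open>y > 0\<close> by (smt (verit) divide_pos_pos)
          next
            case f2: False
            then have "y < 1 / real (Suc n)" using False by auto
            then have "real (Suc n) < 1 / y" using \<open>y > 0\<close> by (simp add: field_simps)
            then show ?thesis using \<open>y > 0\<close> by linarith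
          qed
          then have "norm (F y * of_real y powr (z - 1)) * real (Suc n) \<le> norm (F y * of_real y powr (z - 1)) * (y + 1 / y)"
            by (intro mult_left_mono) auto
          also have "\<dots> \<le> dom C K y" using C(2)[OF K[OF z] \<open>y > 0\<close>] .
          finally show ?thesis using \<open>y > 0\<close> False by (simp add: u_def v_def du_def field_simps del: of_nat_Suc)
        qed
      next
        case False
        then have "y \<notin> ?S" using pos by blast
        then show ?thesis using False by (simp add: u_def v_def du_def)
      qed
      then have "norm (integral\<^sup>L lborel (\<lambda>y. v y - u z y)) \<le> integral\<^sup>L lborel (\<lambda>y. du C K y / real (Suc n))"
        by (intro Bochner_Integration.integral_norm_bound_integral) (auto intro: u_int v_int du_int simp del: of_nat_Suc)
      then show ?thesis using u_int v_int by (simp add: Mv mel J_def)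
    qed
    have "uniform_limit (cball x 1) M (mellin F) sequentially"
    proof (rule uniform_limitI)
      fix e :: real assume "e > 0"
      have "(\<lambda>n. J / real (Suc n)) \<longlonglongrightarrow> 0"
        by (rule tendsto_divide_0[OF tendsto_const filterlim_at_top_imp_at_infinity])
          (rule filterlim_compose[OF filterlim_real_sequentially filterlim_Suc])
      from order_tendstoD(2)[OF this \<open>e > 0\<close>]
      show "\<forall>\<^sub>F n in sequentially. \<forall>z\<in>cball x 1. dist (M n z) (mellin F z) < e"
      proof eventually_elim
        case (elim n)
        show ?case
        proof
          fix z assume "z \<in> cball x 1"
          from key[OF this, of n] elim show "dist (M n z) (mellin F z) < e" unfolding dist_norm by linarith
        qed
      qed
    qed
    then show "\<exists>d>0. cball x d \<subseteq> UNIV \<and> uniform_limit (cball x d) M (mellin F) sequentially"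
      by (intro exI[of _ 1]) auto
  qed
qed

section \<open>Polynomial growth of the L-function\<close>

text \<open>A Phragmen-Lindelof principle for a half strip; the factor \<open>exp (d s\<^sup>2)\<close> absorbs any
  exponential growth, and \<open>d\<close> tends to 0 in the end.\<close>

lemma half_strip_polynomial_bound:
  fixes F :: "complex \<Rightarrow> complex" and a b :: real
  assumes hol: "F holomorphic_on {s. Im s > 0}"
    and growth: "\<And>s. a \<le> Re s \<Longrightarrow> Re s \<le> b \<Longrightarrow> Im s \<ge> 1 \<Longrightarrow> norm (F s) \<le> C * exp (K * Im s)"
    and left: "\<And>t. t \<ge> 1 \<Longrightarrow> norm (F (Complex a t)) \<le> D * t ^ m"
    and right: "\<And>t. t \<ge> 1 \<Longrightarrow> norm (F (Complex b t)) \<le> D * t ^ m"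
  shows "\<exists>E>0. \<forall>s. a \<le> Re s \<and> Re s \<le> b \<and> Im s \<ge> 1 \<longrightarrow> norm (F s) \<le> E * Im s ^ m"
proof -
  define M where "M = max \<bar>a\<bar> \<bar>b\<bar>"
  have M: "\<bar>Re s\<bar> \<le> M" if "a \<le> Re s" "Re s \<le> b" for s using that by (auto simp: M_def)
  \<comment> \<open>D serves the two vertical edges and |C| exp |K| the bottom edge, where Im s = 1.
    The top edge is brought below the same constant by its height. Nothing here depends on
    d.\<close>
  define E0 where "E0 = \<bar>D\<bar> + \<bar>C\<bar> * exp \<bar>K\<bar>"
  have "0 \<le> \<bar>C\<bar> * exp \<bar>K\<bar>" by simp
  then have E0: "E0 \<ge> 0" "D \<le> E0" "\<bar>C\<bar> * exp \<bar>K\<bar> \<le> E0" unfolding E0_def by linarith+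
  have main: "norm (F s / s ^ m * exp (of_real d * s\<^sup>2)) \<le> E0 * exp (d * M\<^sup>2)"
    if s: "a \<le> Re s" "Re s \<le> b" "Im s \<ge> 1" and d: "d > 0" for s d
  proof -
    define G where "G s = F s / s ^ m * exp (of_real d * s\<^sup>2)" for s
    have ne: "norm (exp (of_real d * s\<^sup>2)) \<le> exp (d * M\<^sup>2) * exp (- d * (Im s)\<^sup>2)" if "a \<le> Re s" "Re s \<le> b" for s
    proof -
      have "(Re s)\<^sup>2 \<le> M\<^sup>2" using M[OF that] by (simp add: abs_le_square_iff[symmetric] M_def)
      then have "d * (Re s)\<^sup>2 \<le> d * M\<^sup>2" using d by simp
      then show ?thesis by (simp add: norm_exp_eq_Re power2_eq_square exp_add[symmetric] algebra_simps)
    qed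
    \<comment> \<open>The height Y of the rectangle: for y >= |K| / d the Gaussian factor has
      overtaken exp (K y), so the top edge contributes no more than \<open>E0\<close>.\<close>
    have "eventually (\<lambda>y. \<bar>C\<bar> * exp (K * y - d * y\<^sup>2) \<le> E0 \<and> y > Im s) at_top"
    proof (rule eventually_conj)
      have "eventually (\<lambda>y. y \<ge> \<bar>K\<bar> / d \<and> y \<ge> 0) at_top"
        by (intro eventually_conj eventually_ge_at_top)
      then show "eventually (\<lambda>y. \<bar>C\<bar> * exp (K * y - d * y\<^sup>2) \<le> E0) at_top"
      proof eventually_elim
        case (elim y)
        then have "\<bar>K\<bar> * y \<le> d * y * y" using d by (intro mult_right_mono) (auto simp: field_simps)
        moreover have "K * y \<le> \<bar>K\<bar> * y" using elim by (intro mult_right_mono) auto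
        ultimately have "K * y - d * y\<^sup>2 \<le> \<bar>K\<bar>" by (simp add: power2_eq_square mult.assoc)
        then show ?case by (intro order_trans[OF _ E0(3)] mult_left_mono) auto
      qed
    qed (rule eventually_gt_at_top)
    then obtain Y where Y: "\<bar>C\<bar> * exp (K * Y - d * Y\<^sup>2) \<le> E0" "Y > Im s"
      by (auto dest!: eventually_happens simp: trivial_limit_at_top_linorder)
    define R where "R = cbox (Complex a 1) (Complex b Y)"
    have R: "z \<in> R \<longleftrightarrow> a \<le> Re z \<and> Re z \<le> b \<and> 1 \<le> Im z \<and> Im z \<le> Y" for z
      by (auto simp: R_def in_cbox_complex_iff)
    have Ghol: "G holomorphic_on {s. Im s > 0}"
      unfolding G_def by (intro holomorphic_intros hol) auto
    have RH: "R \<subseteq> {s. Im s > 0}" using R by auto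
    have "norm (G s) \<le> E0 * exp (d * M\<^sup>2)"
    proof (rule maximum_modulus_frontier[of G R])
      show "G holomorphic_on interior R" using RH interior_subset by (intro holomorphic_on_subset[OF Ghol]) blast
      show "continuous_on (closure R) G"
        using RH by (intro continuous_on_subset[OF holomorphic_on_imp_continuous_on[OF Ghol]]) (simp add: R_def)
      show "bounded R" by (simp add: R_def)
      show "s \<in> R" using s Y by (simp add: R)
      fix z assume z: "z \<in> frontier R"
      have int: "interior R = box (Complex a 1) (Complex b Y)" by (simp add: R_def)
      have zR: "z \<in> R" using z by (simp add: R_def frontier_def)
      have "\<not> (a < Re z \<and> Re z < b \<and> 1 < Im z \<and> Im z < Y)"
        using z by (auto simp: frontier_def int in_box_complex_iff)
      then consider "Re z = a" | "Re z = b" | "Im z = 1" | "Im z = Y" using zR R by force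
      then have *: "norm (F z) * exp (- d * (Im z)\<^sup>2) \<le> E0 * Im z ^ m"
      proof cases
        case 1
        then have "z = Complex a (Im z)" by (simp add: complex_eq_iff)
        then have "norm (F z) \<le> D * Im z ^ m" using left[of "Im z"] zR R by metis
        also have "\<dots> \<le> E0 * Im z ^ m" using zR R by (intro mult_right_mono[OF E0(2)]) auto
        finally have "norm (F z) * exp (- d * (Im z)\<^sup>2) \<le> (E0 * Im z ^ m) * 1"
          using d E0 zR R by (intro mult_mono) auto
        then show ?thesis by simp
      next
        case 2
        then have "z = Complex b (Im z)" by (simp add: complex_eq_iff)
        then have "norm (F z) \<le> D * Im z ^ m" using right[of "Im z"] zR R by metis
        also have "\<dots> \<le> E0 * Im z ^ m" using zR R by (intro mult_right_mono[OF E0(2)]) auto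
        finally have "norm (F z) * exp (- d * (Im z)\<^sup>2) \<le> (E0 * Im z ^ m) * 1"
          using d E0 zR R by (intro mult_mono) auto
        then show ?thesis by simp
      next
        case 3
        have "norm (F z) \<le> C * exp K" using growth[of z] zR R 3 by auto
        also have "\<dots> \<le> \<bar>C\<bar> * exp \<bar>K\<bar>" by (intro mult_mono) auto
        also note E0(3)
        finally have "norm (F z) * exp (- d * (Im z)\<^sup>2) \<le> E0 * 1" using d E0 by (intro mult_mono) auto
        then show ?thesis using 3 by simp
      next
        case 4
        have "norm (F z) \<le> C * exp (K * Y)" using growth[of z] zR R 4 by auto
        also have "\<dots> \<le> \<bar>C\<bar> * exp (K * Y)" by (intro mult_right_mono) auto
        finally have "norm (F z) * exp (- d * (Im z)\<^sup>2) \<le> \<bar>C\<bar> * exp (K * Y) * exp (- d * Y\<^sup>2)"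
          unfolding 4 by (intro mult_right_mono) auto
        also have "\<dots> \<le> E0" using Y(1) by (simp add: exp_diff exp_minus field_simps)
        also have "\<dots> \<le> E0 * Im z ^ m" using E0 zR R by (simp add: mult_le_cancel_left1)
        finally show ?thesis .
      qed
      have Im1: "Im z \<ge> 1" using zR R by auto
      have nz: "Im z ^ m \<le> norm z ^ m"
        using abs_Im_le_cmod[of z] Im1 by (intro power_mono) auto
      have z0: "norm z > 0" using Im1 by auto
      have "norm (G z) \<le> norm (F z) / norm z ^ m * (exp (d * M\<^sup>2) * exp (- d * (Im z)\<^sup>2))"
        unfolding G_def norm_mult norm_divide norm_power using ne[of z] zR R by (intro mult_left_mono) auto
      also have "\<dots> = norm (F z) * exp (- d * (Im z)\<^sup>2) * exp (d * M\<^sup>2) / norm z ^ m" by simp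
      also have "\<dots> \<le> E0 * Im z ^ m * exp (d * M\<^sup>2) / norm z ^ m"
        using * by (intro divide_right_mono mult_right_mono) auto
      also have "\<dots> \<le> E0 * norm z ^ m * exp (d * M\<^sup>2) / norm z ^ m"
        using nz E0 by (intro divide_right_mono mult_right_mono mult_left_mono) auto
      also have "\<dots> = E0 * exp (d * M\<^sup>2)" using z0 by simp
      finally show "norm (G z) \<le> E0 * exp (d * M\<^sup>2)" .
    qed
    then show ?thesis by (simp add: G_def)
  qed
  show ?thesis
  proof (intro exI[of _ "(E0 + 1) * (M + 1) ^ m"] conjI allI impI)
    have "M \<ge> 0" by (simp add: M_def)
    then show "(E0 + 1) * (M + 1) ^ m > 0" using E0 by auto
    fix s assume s: "a \<le> Re s \<and> Re s \<le> b \<and> Im s \<ge> 1"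
    \<comment> \<open>For fixed s the estimate holds for every d > 0 with the same
      \<open>E0\<close>, so d may tend to 0. The rectangle, which did depend on d, is no longer
      visible.\<close>
    have "((\<lambda>d. norm (F s / s ^ m * exp (of_real d * s\<^sup>2))) \<longlongrightarrow> norm (F s / s ^ m * exp (of_real 0 * s\<^sup>2))) (at_right 0)"
      by (intro tendsto_intros)
    moreover have "((\<lambda>d. E0 * exp (d * M\<^sup>2)) \<longlongrightarrow> E0 * exp (0 * M\<^sup>2)) (at_right 0)"
      by (intro tendsto_intros)
    ultimately have "norm (F s / s ^ m * exp (of_real 0 * s\<^sup>2)) \<le> E0 * exp (0 * M\<^sup>2)"
      by (intro tendsto_le[OF trivial_limit_at_right_real])
        (use main s in \<open>auto simp: eventually_at_right_field intro!: exI[of _ 1]\<close>)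
    moreover have s0: "norm s > 0" using s by auto
    ultimately have "norm (F s) \<le> E0 * norm s ^ m" by (simp add: norm_divide norm_power field_simps)
    also have "\<dots> \<le> E0 * ((M + 1) * Im s) ^ m"
    proof -
      have "norm s \<le> M + Im s" using cmod_le[of s] M[of s] s by auto
      also have "\<dots> \<le> M * Im s + Im s" using s \<open>M \<ge> 0\<close> by (simp add: mult_le_cancel_left1)
      finally show ?thesis using E0 by (intro mult_left_mono power_mono) (auto simp: algebra_simps)
    qed
    also have "\<dots> \<le> (E0 + 1) * ((M + 1) * Im s) ^ m" using s \<open>M \<ge> 0\<close> by (intro mult_right_mono) auto
    finally show "norm (F s) \<le> (E0 + 1) * (M + 1) ^ m * Im s ^ m" by (simp add: power_mult_distrib)
  qed
qed

section \<open>A priori exponential growth of L from the Mellin transform, then polynomial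
  growth\<close>

lemma norm_Gamma_le_Gamma_Re:
  assumes "Re z > 0"
  shows "norm (Gamma z) \<le> Gamma (Re z)"
proof -
  have "Gamma z = (LINT y:{0<..}|lborel. of_real y powr (z - 1) * of_real (exp (- 1 * y)))"
    using Gamma_integral_scaled(2)[of 1 z] assms by simp
  also have "norm \<dots> \<le> (LINT y:{0<..}|lborel. norm (of_real y powr (z - 1) * of_real (exp (- 1 * y)) :: complex))"
    by (intro set_integral_norm_bound Gamma_integral_scaled assms) auto
  also have "\<dots> = (LINT y:{0<..}|lborel. y powr (Re z - 1) * exp (- 1 * y))"
    by (rule set_lebesgue_integral_cong) (auto simp: norm_mult norm_powr_real_powr)
  also have "\<dots> = Gamma (Re z)" using Gamma_integral_scaled_real(2)[of 1 "Re z"] assms by simp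
  finally show ?thesis .
qed

text \<open>The reflection formula turns 1 / Gamma z into Gamma (1 - z) sin (pi z) / pi. The gamma
  factor is bounded in a strip away from the real axis, and the sine contributes exp (pi
  |t|).\<close>

lemma norm_inverse_Gamma_le:
  fixes K :: real
  shows "\<exists>C. \<forall>x t. \<bar>x\<bar> \<le> K \<and> \<bar>t\<bar> \<ge> 1 \<longrightarrow> norm (inverse (Gamma (Complex x t))) \<le> C * exp (pi * \<bar>t\<bar>)"
proof -
  obtain C where C: "C > 0" "\<And>a b t. \<bar>a\<bar> \<le> \<bar>K\<bar> + 1 \<Longrightarrow> \<bar>b\<bar> \<le> \<bar>K\<bar> + 1 \<Longrightarrow> b \<le> a \<Longrightarrow> \<bar>t\<bar> \<ge> 1 \<Longrightarrow>
     norm (Gamma (Complex b t)) \<le> C * norm (Gamma (Complex a t))"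
    using norm_Gamma_compare[of "\<bar>K\<bar> + 1"] by blast
  show ?thesis
  proof (rule exI[of _ "C * Gamma (\<bar>K\<bar> + 1) / pi"], intro allI impI)
    fix x t :: real assume h: "\<bar>x\<bar> \<le> K \<and> \<bar>t\<bar> \<ge> 1"
    define z where "z = Complex x t"
    have "1 - z = Complex (1 - x) (- t)" by (simp add: z_def complex_eq_iff)
    then have "norm (Gamma (1 - z)) = norm (Gamma (Complex (1 - x) (- t)))" by simp
    also have "\<dots> \<le> C * norm (Gamma (Complex (\<bar>K\<bar> + 1) (- t)))"
      using h by (intro C) auto
    also have "\<dots> \<le> C * Gamma (\<bar>K\<bar> + 1)"
      using C norm_Gamma_le_Gamma_Re[of "Complex (\<bar>K\<bar> + 1) (- t)"] by (intro mult_left_mono) auto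
    finally have 1: "norm (Gamma (1 - z)) \<le> C * Gamma (\<bar>K\<bar> + 1)" .
    have 2: "norm (sin (of_real pi * z)) \<le> exp (pi * \<bar>t\<bar>)"
      using cmod_sin_le_exp[of 1 "of_real pi * z"] by (simp add: z_def abs_mult)
    have nz: "z \<notin> \<int>\<^sub>\<le>\<^sub>0" "1 - z \<notin> \<int>\<^sub>\<le>\<^sub>0" using h by (auto elim!: nonpos_Ints_cases simp: z_def complex_eq_iff)
    have "rGamma z = Gamma (1 - z) * sin (of_real pi * z) / of_real pi"
      using rGamma_reflection_complex[of z] nz by (simp add: rGamma_inverse_Gamma field_simps Gamma_eq_zero_iff)
    then have "norm (rGamma z) = norm (Gamma (1 - z)) * norm (sin (of_real pi * z)) / pi"
      by (simp add: norm_mult norm_divide)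
    also have "\<dots> \<le> C * Gamma (\<bar>K\<bar> + 1) * exp (pi * \<bar>t\<bar>) / pi"
      using 1 2 C by (intro divide_right_mono mult_mono) auto
    finally show "norm (inverse (Gamma (Complex x t))) \<le> C * Gamma (\<bar>K\<bar> + 1) / pi * exp (pi * \<bar>t\<bar>)"
      by (simp add: rGamma_inverse_Gamma z_def)
  qed
qed

text \<open>The 3 is made up of 1 for the divisor function, estimated by n, and 2 for comparison
  with the series of inverse squares.\<close>

lemma norm_dirichlet_term_le:
  assumes lam: "\<forall>n\<ge>1. norm (lam n) \<le> real (card {d. d dvd n}) * real n powr \<theta>"
    and \<sigma>: "\<sigma> \<ge> \<theta> + 3" and "n \<ge> 1"
  shows "norm (lam n) * real n powr (- \<sigma>) \<le> inverse (real n ^ 2)"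
proof -
  have "d \<in> {1..n}" if "d dvd n" for d
    using that \<open>n \<ge> 1\<close> dvd_imp_le[of d n] by (cases "d = 0") auto
  then have "card {d. d dvd n} \<le> card {1..n}" by (intro card_mono) auto
  then have "real (card {d. d dvd n}) * real n powr \<theta> \<le> real n * real n powr \<theta>" by (intro mult_right_mono) auto
  then have "norm (lam n) \<le> real n * real n powr \<theta>"
    using lam \<open>n \<ge> 1\<close> order_trans by blast
  then have "norm (lam n) * real n powr (- \<sigma>) \<le> real n powr 1 * real n powr \<theta> * real n powr (- \<sigma>)"
    using \<open>n \<ge> 1\<close> by (intro mult_right_mono) auto
  also have "\<dots> = real n powr (1 + \<theta> + - \<sigma>)" by (simp only: powr_add)
  also have "\<dots> \<le> real n powr (- 2)" using \<sigma> \<open>n \<ge> 1\<close> by (intro powr_mono) auto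
  also have "\<dots> = inverse (real n ^ 2)" using \<open>n \<ge> 1\<close> by (simp add: powr_minus powr_numeral)
  finally show ?thesis .
qed

text \<open>\<open>has_dirichlet_series\<close> leaves the half plane of convergence unspecified; c
  is an integer beyond that abscissa and beyond the point where zeta(2) majorises the
  series.\<close>

lemma L_function_bounded_right:
  assumes L: "is_L_function lam L"
    and lam: "\<forall>n\<ge>1. norm (lam n) \<le> real (card {d. d dvd n}) * real n powr \<theta>"
  shows "\<exists>c::nat. \<exists>C>0. c \<ge> 2 \<and> (\<forall>s. Re s \<ge> real c \<longrightarrow>
    (\<lambda>n. lam (Suc n) * of_nat (Suc n) powr (- s)) sums L s \<and> norm (L s) \<le> C) \<and> real c \<ge> \<theta> + 3"
proof -
  obtain c where c: "\<And>s. Re s > c \<Longrightarrow> (\<lambda>n. lam (Suc n) * of_nat (Suc n) powr (- s)) sums L s"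
    using L by (auto simp: is_L_function_def has_dirichlet_series_def)
  define c' where "c' = nat \<lceil>\<bar>c\<bar> + \<bar>\<theta>\<bar>\<rceil> + 4"
  have c': "real c' \<ge> \<bar>c\<bar> + \<bar>\<theta>\<bar> + 4"
    using real_nat_ceiling_ge[of "\<bar>c\<bar> + \<bar>\<theta>\<bar>"] unfolding c'_def of_nat_add by linarith
  define C where "C = (\<Sum>n. inverse (real (Suc n) ^ 2))"
  have sC: "summable (\<lambda>n. inverse (real (Suc n) ^ 2))"
    using inverse_power_summable[of 2, where 'a = real] by (subst summable_Suc_iff) simp
  have "norm (L s) \<le> C" if s: "Re s \<ge> real c'" for s
  proof -
    have "(\<lambda>n. lam (Suc n) * of_nat (Suc n) powr (- s)) sums L s" using c s c' by auto
    then have Ls: "L s = (\<Sum>n. lam (Suc n) * of_nat (Suc n) powr (- s))" by (simp add: sums_iff)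
    show ?thesis unfolding Ls C_def
    proof (rule norm_suminf_le[OF _ sC])
      fix n
      show "norm (lam (Suc n) * of_nat (Suc n) powr (- s)) \<le> inverse (real (Suc n) ^ 2)"
        using norm_dirichlet_term_le[OF lam, of "Re s" "Suc n"] s c'
        by (simp add: norm_mult norm_powr_real_powr del: of_nat_Suc)
    qed
  qed
  moreover have "C > 0" unfolding C_def by (rule suminf_pos[OF sC]) auto
  moreover have "real c' \<ge> \<theta> + 3" "c' \<ge> 2" "\<And>s. Re s \<ge> real c' \<Longrightarrow> Re s > c"
    using c' by linarith+
  ultimately show ?thesis using c by blast
qed

text \<open>Where the Dirichlet series converges absolutely, the Fourier expansion may be integrated
  term by term; the factor n^\<kappa> in its coefficients accounts for the argument s + \<kappa>.
  Both sides are holomorphic in the upper half plane, which contains no pole of Gamma, so the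
  identity extends to all of it.\<close>

lemma L_function_mellin:
  assumes prim: "primitive_cusp_form k N f lam" and "N > 0"
    and L: "is_L_function lam L"
    and lam: "\<forall>n\<ge>1. norm (lam n) \<le> real (card {d. d dvd n}) * real n powr \<theta>"
    and s: "Im s > 0"
  defines "\<kappa> \<equiv> (real k - 1) / 2"
  shows "L s * Gamma (s + of_real \<kappa>) * of_real (2 * pi) powr (- (s + of_real \<kappa>)) = mellin (\<lambda>y. f (Complex 0 y)) (s + of_real \<kappa>)"
proof -
  define F where "F y = f (Complex 0 y)" for y
  have f: "f \<in> cusp_forms k N" using prim by (simp add: primitive_cusp_form_def new_cusp_forms_def)
  have fser: "\<And>z. Im z > 0 \<Longrightarrow> (\<lambda>n. lam (Suc n) * of_nat (Suc n) powr of_real \<kappa> * exp (2 * of_real pi * \<i> * of_nat (Suc n) * z)) sums f z"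
    using prim by (simp add: primitive_cusp_form_def upper_half_plane_def \<kappa>_def)
  obtain c :: nat where c: "c \<ge> 2" "real c \<ge> \<theta> + 3"
    "\<And>s. Re s \<ge> real c \<Longrightarrow> (\<lambda>n. lam (Suc n) * of_nat (Suc n) powr (- s)) sums L s"
    using L_function_bounded_right[OF L lam] by blast
  have cont: "continuous_on {0<..} F"
    unfolding F_def Complex_eq using f
    by (intro continuous_on_compose2[OF holomorphic_on_imp_continuous_on[of f upper_half_plane]] continuous_intros)
      (auto simp: upper_half_plane_def cusp_forms_def)
  have mhol: "mellin F holomorphic_on UNIV"
    using mellin_entire_bounded(1)[OF cont] cusp_form_imaginary_axis[OF f \<open>N > 0\<close>] unfolding F_def by blast
  have eq: "L s * Gamma (s + of_real \<kappa>) * of_real (2 * pi) powr (- (s + of_real \<kappa>)) = mellin F (s + of_real \<kappa>)"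
    if s: "Re s \<ge> real c" for s
  proof -
    define z where "z = s + of_real \<kappa>"
    have z: "Re z > 0" using s c by (simp add: z_def \<kappa>_def field_simps)
    define b where "b n = 2 * pi * real (Suc n)" for n
    have b: "b n > 0" for n by (simp add: b_def)
    define A where "A n = lam (Suc n) * of_nat (Suc n) powr of_real \<kappa>" for n
    define u where "u n y = indicator {0<..} y *\<^sub>R (A n * (of_real y powr (z - 1) * of_real (exp (- b n * y))))" for n and y :: real
    have int: "integrable lborel (u n)" for n
      using set_integrable_mult_right[OF Gamma_integral_scaled(1)[OF b z]]
      by (simp add: u_def[abs_def] set_integrable_def)
    have val: "integral\<^sup>L lborel (u n) = lam (Suc n) * of_nat (Suc n) powr (- s) * (Gamma z * of_real (2 * pi) powr (- z))" for n
    proof -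
      have "integral\<^sup>L lborel (u n) = A n * (Gamma z * of_real (b n) powr (- z))"
        using Gamma_integral_scaled(2)[OF b z, of n]
        by (simp add: u_def[abs_def] set_lebesgue_integral_def flip: mult_scaleR_right)
      also have "of_real (b n) powr (- z) = of_real (2 * pi) powr (- z) * of_nat (Suc n) powr (- z)"
        unfolding b_def of_real_mult[of "2 * pi"] by (subst powr_times_real) auto
      also have "- z = - s - of_real \<kappa>" by (simp add: z_def)
      also have "complex_of_nat (Suc n) powr (- s - of_real \<kappa>) = of_nat (Suc n) powr (- s) / of_nat (Suc n) powr of_real \<kappa>"
        by (rule powr_diff)
      finally show ?thesis unfolding A_def by (simp add: z_def del: of_nat_Suc)
    qed
    have nval: "(\<integral>y. norm (u n y) \<partial>lborel) = norm (lam (Suc n)) * real (Suc n) powr (- Re s) * (Gamma (Re z) * (2 * pi) powr (- Re z))" for n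
    proof -
      have "norm (u n y) = norm (A n) * (indicator {0<..} y *\<^sub>R (y powr (Re z - 1) * exp (- b n * y)))" for y
        by (auto simp: u_def norm_mult norm_powr_real_powr indicator_def)
      then have "(\<integral>y. norm (u n y) \<partial>lborel) = norm (A n) * (Gamma (Re z) * b n powr (- Re z))"
        using Gamma_integral_scaled_real(2)[OF b z, of n] by (simp add: set_lebesgue_integral_def)
      also have "b n powr (- Re z) = (2 * pi) powr (- Re z) * real (Suc n) powr (- Re z)"
        unfolding b_def by (subst powr_mult) auto
      also have "- Re z = - Re s - \<kappa>" by (simp add: z_def)
      also have "real (Suc n) powr (- Re s - \<kappa>) = real (Suc n) powr (- Re s) / real (Suc n) powr \<kappa>"
        by (rule powr_diff)
      finally show ?thesis unfolding A_def
        by (simp add: z_def norm_mult norm_powr_real_powr del: of_nat_Suc)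
    qed
    have summ: "summable (\<lambda>n. norm (lam (Suc n)) * real (Suc n) powr (- Re s))"
    proof (rule summable_comparison_test'[of "\<lambda>n. inverse (real (Suc n) ^ 2)" 0])
      show "summable (\<lambda>n. inverse (real (Suc n) ^ 2))"
        using inverse_power_summable[of 2, where 'a = real] by (subst summable_Suc_iff) simp
    qed (use norm_dirichlet_term_le[OF lam, of "Re s"] s c in \<open>auto simp del: of_nat_Suc\<close>)
    have sumF: "(\<lambda>n. u n y) sums (indicator {0<..} y *\<^sub>R (F y * of_real y powr (z - 1)))" for y
    proof (cases "y > 0")
      case True
      have "(\<lambda>n. A n * exp (2 * of_real pi * \<i> * of_nat (Suc n) * Complex 0 y) * of_real y powr (z - 1)) sums (F y * of_real y powr (z - 1))"
        unfolding F_def A_def using fser[of "Complex 0 y"] True by (intro sums_mult2) simp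
      moreover have "u n y = A n * exp (2 * of_real pi * \<i> * of_nat (Suc n) * Complex 0 y) * of_real y powr (z - 1)" for n
      proof -
        have "2 * of_real pi * \<i> * of_nat (Suc n) * Complex 0 y = of_real (- b n * y)"
          by (simp add: complex_eq_iff b_def)
        then have "exp (2 * of_real pi * \<i> * of_nat (Suc n) * Complex 0 y) = of_real (exp (- b n * y))"
          by (simp only: exp_of_real)
        then show ?thesis using True by (simp only: u_def) simp
      qed
      ultimately show ?thesis using True by simp
    qed (simp add: u_def)
    have "(\<lambda>n. integral\<^sup>L lborel (u n)) sums (\<integral>y. (\<Sum>n. u n y) \<partial>lborel)"
    proof (rule sums_integral[OF int])
      have "summable (\<lambda>n. norm (u n y))" for y
      proof (cases "y > 0")
        case True
        \<comment> \<open>Pointwise absolute summability for fixed y: the exponential is traded for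
          (b n * y)^(-m) with m >= Re z, which leaves a multiple of the absolutely convergent
          Dirichlet series at Re s.\<close>
        have n1: "norm (u n y) \<le> norm (lam (Suc n)) * real (Suc n) powr (- Re s) * (y powr (Re z - 1) * (fact (nat \<lceil>Re z\<rceil>) / y ^ nat \<lceil>Re z\<rceil>))" for n
        proof -
          define m where "m = nat \<lceil>Re z\<rceil>"
          have m: "real m \<ge> Re z" using real_nat_ceiling_ge by (simp add: m_def)
          have bpos: "b n * y > 0" using b True by simp
          have "real (Suc n) powr Re z \<le> real (Suc n) powr real m" using m by (intro powr_mono) auto
          also have "\<dots> = real (Suc n) ^ m" by (subst powr_realpow) auto
          also have "\<dots> \<le> b n ^ m" using pi_gt3 unfolding b_def by (intro power_mono) (auto simp: mult_le_cancel_right1)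
          finally have bm: "1 / b n ^ m \<le> real (Suc n) powr (- Re z)"
            using b by (simp add: powr_minus inverse_eq_divide frac_le)
          have "exp (- (b n * y)) \<le> fact m / (b n * y) ^ m"
            using exp_minus_le_power[OF bpos, of m] zero_less_power[OF bpos, of m] by (simp add: pos_le_divide_eq)
          also have "\<dots> = fact m / y ^ m * (1 / b n ^ m)" by (simp add: power_mult_distrib)
          also have "\<dots> \<le> fact m / y ^ m * real (Suc n) powr (- Re z)"
            using True by (intro mult_left_mono bm) auto
          finally have e: "exp (- (b n * y)) \<le> fact m / y ^ m * real (Suc n) powr (- Re z)" .
          have "norm (u n y) = norm (lam (Suc n)) * real (Suc n) powr \<kappa> * (y powr (Re z - 1) * exp (- (b n * y)))"
            using True by (simp add: u_def A_def norm_mult norm_powr_real_powr del: of_nat_Suc)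
          also have "\<dots> \<le> norm (lam (Suc n)) * real (Suc n) powr \<kappa> * (y powr (Re z - 1) * (fact m / y ^ m * real (Suc n) powr (- Re z)))"
            using e by (intro mult_left_mono) auto
          also have "real (Suc n) powr (- Re z) = real (Suc n) powr (- Re s) / real (Suc n) powr \<kappa>"
            unfolding powr_diff[symmetric] by (simp add: z_def)
          finally show ?thesis by (simp add: m_def mult_ac del: of_nat_Suc)
        qed
        show ?thesis
          by (rule summable_comparison_test'[OF summable_mult2[OF summ,
                of "y powr (Re z - 1) * (fact (nat \<lceil>Re z\<rceil>) / y ^ nat \<lceil>Re z\<rceil>)"], of 0]) (simp only: real_norm_def abs_norm_cancel n1)
      qed (simp add: u_def)
      then show "AE y in lborel. summable (\<lambda>n. norm (u n y))" by simp
      show "summable (\<lambda>n. \<integral>y. norm (u n y) \<partial>lborel)"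
        unfolding nval by (intro summable_mult2 summ)
    qed
    also have "(\<integral>y. (\<Sum>n. u n y) \<partial>lborel) = mellin F z"
      using sumF by (simp add: mellin_def set_lebesgue_integral_def sums_iff)
    finally have "(\<lambda>n. integral\<^sup>L lborel (u n)) sums mellin F z" .
    moreover have "(\<lambda>n. integral\<^sup>L lborel (u n)) sums (L s * (Gamma z * of_real (2 * pi) powr (- z)))"
      unfolding val using c(3)[OF s] by (rule sums_mult2)
    ultimately show ?thesis using sums_unique2 by (fastforce simp: z_def mult_ac)
  qed
  have "L s * Gamma (s + of_real \<kappa>) * of_real (2 * pi) powr (- (s + of_real \<kappa>)) = mellin F (s + of_real \<kappa>)"
  proof (rule analytic_continuation_open[of "{s. Im s > 0} \<inter> {s. Re s > real c}" "{s. Im s > 0}"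
      "\<lambda>s. L s * Gamma (s + of_real \<kappa>) * of_real (2 * pi) powr (- (s + of_real \<kappa>))" "\<lambda>s. mellin F (s + of_real \<kappa>)"])
    show "open ({s. Im s > 0} \<inter> {s. Re s > real c})" "open {s. Im s > 0}"
      by (auto intro!: open_Int open_halfspace_Im_gt open_halfspace_Re_gt)
    have "Complex (real c + 1) 1 \<in> {s. Im s > 0} \<inter> {s. Re s > real c}" by simp
    then show "{s. Im s > 0} \<inter> {s. Re s > real c} \<noteq> {}" by blast
    show "connected {s. Im s > 0}" by (intro convex_connected convex_halfspace_Im_gt)
    have Lhol: "L holomorphic_on UNIV" using L by (simp add: is_L_function_def)
    have "s + of_real \<kappa> \<notin> \<int>\<^sub>\<le>\<^sub>0" if "Im s > 0" for s using that by (auto elim!: nonpos_Ints_cases simp: complex_eq_iff)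
    then show "(\<lambda>s. L s * Gamma (s + of_real \<kappa>) * of_real (2 * pi) powr (- (s + of_real \<kappa>))) holomorphic_on {s. Im s > 0}"
      by (intro holomorphic_intros holomorphic_on_subset[OF Lhol]) (auto simp: complex_nonpos_Reals_iff)
    have "(mellin F \<circ> (\<lambda>s. s + of_real \<kappa>)) holomorphic_on {s. Im s > 0}"
      by (intro holomorphic_on_compose holomorphic_on_subset[OF mhol] holomorphic_intros) auto
    then show "(\<lambda>s. mellin F (s + of_real \<kappa>)) holomorphic_on {s. Im s > 0}" by (simp add: o_def)
  qed (use eq s in auto)
  then show ?thesis by (simp add: F_def[abs_def])
qed

text \<open>The Mellin transform is bounded in vertical strips, so dividing by the gamma factor
  leaves only the growth of 1 / Gamma.\<close>

lemma L_function_exponential_bound: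
  fixes K :: real
  assumes prim: "primitive_cusp_form k N f lam" and "N > 0"
    and L: "is_L_function lam L"
    and lam: "\<forall>n\<ge>1. norm (lam n) \<le> real (card {d. d dvd n}) * real n powr \<theta>"
  shows "\<exists>C. \<forall>s. \<bar>Re s\<bar> \<le> K \<and> Im s \<ge> 1 \<longrightarrow> norm (L s) \<le> C * exp (pi * Im s)"
proof -
  define F where "F y = f (Complex 0 y)" for y
  define \<kappa> where "\<kappa> = (real k - 1) / 2"
  define K' where "K' = nat \<lceil>K + real k + 1\<rceil>"
  have K': "\<bar>Re s + \<kappa>\<bar> \<le> real K'" if "\<bar>Re s\<bar> \<le> K" for s
  proof -
    have "\<bar>\<kappa>\<bar> \<le> real k + 1" by (simp add: \<kappa>_def)
    then show ?thesis using that real_nat_ceiling_ge[of "K + real k + 1"] unfolding K'_def by linarith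
  qed
  have f: "f \<in> cusp_forms k N" using prim by (simp add: primitive_cusp_form_def new_cusp_forms_def)
  have cont: "continuous_on {0<..} F"
    unfolding F_def Complex_eq using f
    by (intro continuous_on_compose2[OF holomorphic_on_imp_continuous_on[of f upper_half_plane]] continuous_intros)
      (auto simp: upper_half_plane_def cusp_forms_def)
  obtain C1 where C1: "\<And>z. \<bar>Re z\<bar> \<le> real K' \<Longrightarrow> norm (mellin F z) \<le> C1"
    using mellin_entire_bounded(2)[OF cont, of K'] cusp_form_imaginary_axis[OF f \<open>N > 0\<close>] unfolding F_def by blast
  obtain C2 where C2: "\<And>x t. \<bar>x\<bar> \<le> real K' \<Longrightarrow> \<bar>t\<bar> \<ge> 1 \<Longrightarrow> norm (inverse (Gamma (Complex x t))) \<le> C2 * exp (pi * \<bar>t\<bar>)"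
    using norm_inverse_Gamma_le[of "real K'"] by blast
  obtain C3 where C3: "C3 > 0" "\<And>x. \<bar>x\<bar> \<le> real K' \<Longrightarrow> (2 * pi) powr x \<le> C3"
    using powr_bounded[of "2 * pi" "real K'"] by auto
  show ?thesis
  proof (rule exI[of _ "C1 * C2 * C3"], intro allI impI)
    fix s assume s: "\<bar>Re s\<bar> \<le> K \<and> Im s \<ge> 1"
    define z where "z = s + of_real \<kappa>"
    have z: "\<bar>Re z\<bar> \<le> real K'" "Im z \<ge> 1" using s K' by (auto simp: z_def)
    have zC: "z = Complex (Re z) (Im z)" by simp
    have nz: "Gamma z \<noteq> 0" using z by (auto simp: Gamma_eq_zero_iff elim!: nonpos_Ints_cases)
    have "L s * Gamma z * of_real (2 * pi) powr (- z) = mellin F z"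
      using L_function_mellin[OF prim \<open>N > 0\<close> L lam, of s] s by (simp add: z_def \<kappa>_def F_def[abs_def])
    then have "L s = mellin F z * inverse (Gamma z) * of_real (2 * pi) powr z"
      using nz by (simp add: powr_minus field_simps)
    then have e: "norm (L s) = norm (mellin F z) * norm (inverse (Gamma z)) * (2 * pi) powr Re z"
      by (simp add: norm_mult norm_powr_real_powr del: norm_inverse)
    have c2: "0 \<le> C2 * exp (pi * \<bar>Im z\<bar>)"
      using C2[OF z(1), of "Im z"] z norm_ge_zero order_trans by (metis abs_ge_self)
    have "norm (mellin F z) * norm (inverse (Gamma z)) * (2 * pi) powr Re z \<le> C1 * (C2 * exp (pi * \<bar>Im z\<bar>)) * C3"
      using C1[OF z(1)] C2[OF z(1), of "Im z"] C3(2)[OF z(1)] z C3(1) c2 norm_ge_zero[of "mellin F z"]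
      by (intro mult_mono) (auto intro!: mult_nonneg_nonneg intro: order_trans[OF norm_ge_zero])
    then show "norm (L s) \<le> C1 * C2 * C3 * exp (pi * Im s)" unfolding e using s by (simp add: z_def mult_ac)
  qed
qed

text \<open>The point is that m does not depend on K: going K to the left costs exactly 2 K in the
  exponent beyond a fixed power. A worse slope in K could exceed what the powers of chi gain in the
  contour shift.\<close>

lemma L_function_polynomial_bound:
  assumes prim: "primitive_cusp_form k N f lam" and "N > 0"
    and L: "is_L_function lam L" and eps: "is_root_number k N L eps"
    and lam: "\<forall>n\<ge>1. norm (lam n) \<le> real (card {d. d dvd n}) * real n powr \<theta>"
  shows "\<exists>m. \<forall>K::nat. \<exists>C>0. \<forall>s. Im s \<ge> 1 \<and> Re s \<ge> - real K \<longrightarrow> norm (L s) \<le> C * Im s ^ (2 * K + m)"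
proof -
  obtain c C where c: "C > 0" "c \<ge> 2" "real c \<ge> \<theta> + 3" "\<And>s. Re s \<ge> real c \<Longrightarrow> norm (L s) \<le> C"
    using L_function_bounded_right[OF L lam] by blast
  have ne: "norm eps = 1" using eps by (auto simp: is_root_number_def)
  have func: "L s = chi k N eps s * L (1 - s)" if "Im s \<noteq> 0" for s
  proof -
    have n1: "s + of_real ((real k - 1) / 2) \<notin> \<int>\<^sub>\<le>\<^sub>0" "1 - s + of_real ((real k - 1) / 2) \<notin> \<int>\<^sub>\<le>\<^sub>0"
      using that by (auto elim!: nonpos_Ints_cases simp: complex_eq_iff)
    have "gamma_factor k N s \<noteq> 0" using n1 \<open>N > 0\<close> by (auto simp: gamma_factor_def Gamma_eq_zero_iff)
    moreover have "gamma_factor k N s * L s = eps * gamma_factor k N (1 - s) * L (1 - s)"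
      using eps n1 by (auto simp: is_root_number_def)
    ultimately show ?thesis by (simp add: chi_def field_simps)
  qed
  \<comment> \<open>Here Re (1 - s) >= c, so the reflected value of L is bounded and all the growth
    is that of chi.\<close>
  have left: "\<exists>D>0. \<forall>s. Im s \<ge> 1 \<and> - real K \<le> Re s \<and> Re s \<le> 1 - real c \<and> 1 - 2 * Re s \<le> real n \<longrightarrow> norm (L s) \<le> D * Im s ^ n" for K n :: nat
  proof -
    obtain D where D: "D > 0" "\<And>\<sigma> t. \<bar>\<sigma>\<bar> \<le> real K \<Longrightarrow> 1 - 2 * \<sigma> \<le> real n \<Longrightarrow> \<bar>t\<bar> \<ge> 1 \<Longrightarrow> norm (chi k N eps (Complex \<sigma> t)) \<le> D * \<bar>t\<bar> ^ n"
      using chi_upper_bound[OF ne \<open>N > 0\<close>, of "real K" n k] by blast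
    show ?thesis
    proof (intro exI[of _ "D * C"] conjI allI impI)
      show "D * C > 0" using D c by simp
      fix s assume s: "Im s \<ge> 1 \<and> - real K \<le> Re s \<and> Re s \<le> 1 - real c \<and> 1 - 2 * Re s \<le> real n"
      have "norm (L s) = norm (chi k N eps (Complex (Re s) (Im s))) * norm (L (1 - s))"
        using func[of s] s by (simp add: norm_mult)
      also have "\<dots> \<le> (D * \<bar>Im s\<bar> ^ n) * C"
        using s c D by (intro mult_mono D(2) c(4)) auto
      finally show "norm (L s) \<le> D * C * Im s ^ n" using s by (simp add: mult_ac)
    qed
  qed
  \<comment> \<open>On the edge Re s = 1 - c of the middle strip chi has order |t|^(2 c - 1),
    rounded up to 2 c.\<close>
  obtain D0 where D0: "D0 > 0" "\<And>s. Im s \<ge> 1 \<Longrightarrow> - real c \<le> Re s \<Longrightarrow> Re s \<le> 1 - real c \<Longrightarrow> 1 - 2 * Re s \<le> real (2 * c) \<Longrightarrow> norm (L s) \<le> D0 * Im s ^ (2 * c)"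
    using left[of c "2 * c"] by blast
  obtain C4 where C4: "\<And>s. \<bar>Re s\<bar> \<le> real c \<Longrightarrow> Im s \<ge> 1 \<Longrightarrow> norm (L s) \<le> C4 * exp (pi * Im s)"
    using L_function_exponential_bound[OF prim \<open>N > 0\<close> L lam, of "real c"] by blast
  have "\<exists>E>0. \<forall>s. 1 - real c \<le> Re s \<and> Re s \<le> real c \<and> Im s \<ge> 1 \<longrightarrow> norm (L s) \<le> E * Im s ^ (2 * c)"
  proof (rule half_strip_polynomial_bound[where C = C4 and K = pi and D = "D0 + C"])
    show "L holomorphic_on {s. Im s > 0}" using L by (auto simp: is_L_function_def intro: holomorphic_on_subset)
    show "norm (L s) \<le> C4 * exp (pi * Im s)" if "1 - real c \<le> Re s" "Re s \<le> real c" "1 \<le> Im s" for s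
      using that c by (intro C4) auto
    fix t :: real assume t: "t \<ge> 1"
    have "norm (L (Complex (1 - real c) t)) \<le> D0 * t ^ (2 * c)"
      using D0(2)[of "Complex (1 - real c) t"] t by simp
    also have "\<dots> \<le> (D0 + C) * t ^ (2 * c)" using c t by (intro mult_right_mono) auto
    finally show "norm (L (Complex (1 - real c) t)) \<le> (D0 + C) * t ^ (2 * c)" .
    have "norm (L (Complex (real c) t)) \<le> C * 1" using c(4)[of "Complex (real c) t"] by simp
    also have "\<dots> \<le> (D0 + C) * t ^ (2 * c)" using c t D0 by (intro mult_mono one_le_power) auto
    finally show "norm (L (Complex (real c) t)) \<le> (D0 + C) * t ^ (2 * c)" .
  qed
  then obtain E where E: "E > 0" "\<And>s. 1 - real c \<le> Re s \<Longrightarrow> Re s \<le> real c \<Longrightarrow> Im s \<ge> 1 \<Longrightarrow> norm (L s) \<le> E * Im s ^ (2 * c)"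
    by blast
  show ?thesis
  proof (rule exI[of _ "2 * c"], rule allI)
    fix K :: nat
    obtain D where D: "D > 0" "\<And>s. Im s \<ge> 1 \<Longrightarrow> - real K \<le> Re s \<Longrightarrow> Re s \<le> 1 - real c \<Longrightarrow> 1 - 2 * Re s \<le> real (2 * K + 2 * c) \<Longrightarrow> norm (L s) \<le> D * Im s ^ (2 * K + 2 * c)"
      using left[of K "2 * K + 2 * c"] by blast
    show "\<exists>C>0. \<forall>s. Im s \<ge> 1 \<and> Re s \<ge> - real K \<longrightarrow> norm (L s) \<le> C * Im s ^ (2 * K + 2 * c)"
    proof (intro exI[of _ "C + E + D"] conjI allI impI)
      show "C + E + D > 0" using c E D by simp
      fix s assume s: "Im s \<ge> 1 \<and> Re s \<ge> - real K"
      define p where "p = Im s ^ (2 * K + 2 * c)"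
      have p1: "1 \<le> p" using s by (simp add: p_def)
      consider "Re s \<ge> real c" | "1 - real c \<le> Re s" "Re s \<le> real c" | "Re s \<le> 1 - real c" by linarith
      then have "\<exists>X\<in>{C, E, D}. norm (L s) \<le> X * p"
      proof cases
        case 1
        then have "norm (L s) \<le> C * 1" using c by simp
        also have "\<dots> \<le> C * p" using c p1 by (intro mult_left_mono) auto
        finally show ?thesis by blast
      next
        case 2
        then have "norm (L s) \<le> E * Im s ^ (2 * c)" using E s by simp
        also have "\<dots> \<le> E * p" unfolding p_def using s E by (intro mult_left_mono power_increasing) auto
        finally show ?thesis by blast
      next
        case 3
        then have "norm (L s) \<le> D * p" unfolding p_def using D(2)[of s] s c by simp
        then show ?thesis by blast
      qed
      moreover have "X * p \<le> (C + E + D) * p" if "X \<in> {C, E, D}" for X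
        using that c E D p1 by (intro mult_right_mono) auto
      ultimately show "norm (L s) \<le> (C + E + D) * Im s ^ (2 * K + 2 * c)" unfolding p_def by force
    qed
  qed
qed

section \<open>Size of the mollified factors\<close>

text \<open>Cauchy's inequality on the unit circle around s; this is why L is controlled one unit
  further left and further down. As ln T >= 1, the powers of 1 / (2 ln T) are at most 1 and the
  constant does not depend on T.\<close>

lemma V_op_bound:
  assumes L: "L holomorphic_on UNIV"
    and bound: "\<And>s. Im s \<ge> 1 \<Longrightarrow> Re s \<ge> a - 1 \<Longrightarrow> norm (L s) \<le> C * Im s ^ p" and "C \<ge> 0"
  shows "\<exists>C'>0. \<forall>T s. ln T \<ge> 1 \<and> Im s \<ge> 2 \<and> Re s \<ge> a \<longrightarrow> norm (V_op Q T L s) \<le> C' * Im s ^ p"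
proof -
  define C' where "C' = (\<Sum>i\<le>degree Q. norm (coeff Q i) * (fact i * (C * 2 ^ p))) + 1"
  have "(\<Sum>i\<le>degree Q. norm (coeff Q i) * (fact i * (C * 2 ^ p))) \<ge> 0"
    using \<open>C \<ge> 0\<close> by (intro sum_nonneg mult_nonneg_nonneg) auto
  then have C': "C' > 0" by (simp add: C'_def)
  show ?thesis
  proof (intro exI[of _ C'] conjI allI impI C')
    fix T :: real and s assume h: "ln T \<ge> 1 \<and> Im s \<ge> 2 \<and> Re s \<ge> a"
    have d: "norm ((deriv ^^ i) L s) \<le> fact i * (C * 2 ^ p * Im s ^ p)" for i
    proof -
      have "norm ((deriv ^^ i) L s) \<le> fact i * (C * (2 * Im s) ^ p) / 1 ^ i"
      proof (rule Cauchy_inequality)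
        fix w assume w: "norm (s - w) = 1"
        then have "\<bar>Re (s - w)\<bar> \<le> 1" "\<bar>Im (s - w)\<bar> \<le> 1" using abs_Re_le_cmod abs_Im_le_cmod by metis+
        then have 1: "Im w \<ge> 1" "Re w \<ge> a - 1" "Im w \<le> 2 * Im s" using h by (auto simp: abs_le_iff)
        have "norm (L w) \<le> C * Im w ^ p" by (rule bound) (use 1 in auto)
        also have "\<dots> \<le> C * (2 * Im s) ^ p" using 1 \<open>C \<ge> 0\<close> by (intro mult_left_mono power_mono) auto
        finally show "norm (L w) \<le> C * (2 * Im s) ^ p" .
      qed (use L in \<open>auto intro: holomorphic_on_subset holomorphic_on_imp_continuous_on\<close>)
      then show ?thesis by (simp add: power_mult_distrib mult_ac)
    qed
    have "norm (V_op Q T L s) \<le> (\<Sum>i\<le>degree Q. norm (coeff Q i) * (fact i * (C * 2 ^ p)) * Im s ^ p)"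
      unfolding V_op_def
    proof (rule sum_norm_le)
      fix i
      have "norm (complex_of_real (- 1 / (2 * ln T)) ^ i) \<le> 1"
        using h unfolding norm_power norm_of_real by (intro power_le_one) (auto simp: field_simps)
      then have "norm (coeff Q i * complex_of_real (- 1 / (2 * ln T)) ^ i * (deriv ^^ i) L s)
          \<le> norm (coeff Q i) * 1 * (fact i * (C * 2 ^ p * Im s ^ p))"
        unfolding norm_mult using d[of i] by (intro mult_mono) auto
      then show "norm (coeff Q i * complex_of_real (- 1 / (2 * ln T)) ^ i * (deriv ^^ i) L s)
          \<le> norm (coeff Q i) * (fact i * (C * 2 ^ p)) * Im s ^ p" by (simp add: mult_ac)
    qed
    also have "\<dots> \<le> C' * Im s ^ p"
      unfolding sum_distrib_right[symmetric] C'_def using h by (intro mult_right_mono) auto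
    finally show "norm (V_op Q T L s) \<le> C' * Im s ^ p" .
  qed
qed

section \<open>Coefficients and size of the Dirichlet polynomials\<close>

lemma dirichlet_conv_power_polynomial:
  assumes lam: "\<forall>n\<ge>1. norm (lam n) \<le> real (card {d. d dvd n}) * real n powr \<theta>"
  shows "\<exists>p. \<forall>n\<ge>1. norm (dirichlet_conv_power lam m n) \<le> real n ^ p"
proof (induction m)
  case 0
  then show ?case by (auto intro!: exI[of _ 0])
next
  case (Suc m)
  then obtain p where p: "\<And>n. n \<ge> 1 \<Longrightarrow> norm (dirichlet_conv_power lam m n) \<le> real n ^ p" by blast
  have sub: "{d. d dvd n} \<subseteq> {1..n}" if "n \<ge> 1" for n :: nat
    using that dvd_imp_le by (auto simp: Suc_le_eq intro: Nat.gr0I)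
  have card: "card {d. d dvd n} \<le> n" if "n \<ge> 1" for n :: nat
    using card_mono[OF _ sub[OF that]] by simp
  define b where "b = 1 + nat \<lceil>\<theta>\<rceil>"
  have lb: "norm (lam n) \<le> real n ^ b" if "n \<ge> 1" for n
  proof -
    have "norm (lam n) \<le> real (card {d. d dvd n}) * real n powr \<theta>" using lam that by blast
    also have "\<dots> \<le> real n * real n powr real (nat \<lceil>\<theta>\<rceil>)"
      using that card[OF that] real_nat_ceiling_ge[of \<theta>] by (intro mult_mono powr_mono) auto
    also have "\<dots> = real n ^ b" using that by (simp add: b_def powr_realpow)
    finally show ?thesis .
  qed
  show ?case
  proof (intro exI[of _ "b + p + 1"] allI impI)
    fix n :: nat assume n: "n \<ge> 1"
    have "norm (dirichlet_conv_power lam (Suc m) n) \<le> (\<Sum>d | d dvd n. real n ^ b * real n ^ p)"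
      unfolding dirichlet_conv_power.simps dirichlet_conv_def
    proof (rule sum_norm_le)
      fix d assume "d \<in> {d. d dvd n}"
      then have d: "d \<ge> 1" "d \<le> n" "n div d \<ge> 1" "n div d \<le> n"
        using sub[OF n] by (auto simp: Suc_le_eq div_greater_zero_iff)
      have "norm (lam d) \<le> real n ^ b" using lb[OF d(1)] d by (meson of_nat_0_le_iff of_nat_le_iff order_trans power_mono)
      moreover have "norm (dirichlet_conv_power lam m (n div d)) \<le> real n ^ p"
        using p[OF d(3)] d by (meson of_nat_0_le_iff of_nat_le_iff order_trans power_mono)
      ultimately show "norm (lam d * dirichlet_conv_power lam m (n div d)) \<le> real n ^ b * real n ^ p"
        unfolding norm_mult by (intro mult_mono) auto
    qed
    also have "\<dots> \<le> real n * (real n ^ b * real n ^ p)"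
      using card[OF n] by (simp add: mult_right_mono)
    finally show "norm (dirichlet_conv_power lam (Suc m) n) \<le> real n ^ (b + p + 1)" by (simp add: power_add mult_ac)
  qed
qed

text \<open>Convergence at a single integer p forces the terms a n / n^p to tend to 0, hence to be
  bounded. Applied to mu, this needs no information about 1 / L^m except that its series converges
  somewhere.\<close>

lemma dirichlet_coefficients_polynomial:
  assumes "has_dirichlet_series a F"
  shows "\<exists>p C. C > 0 \<and> (\<forall>n\<ge>1. norm (a n) \<le> C * real n ^ p)"
proof -
  obtain c where c: "\<And>s. Re s > c \<Longrightarrow> (\<lambda>n. a (Suc n) * of_nat (Suc n) powr (- s)) sums F s"
    using assms by (auto simp: has_dirichlet_series_def)
  define p where "p = nat \<lceil>\<bar>c\<bar> + 1\<rceil>"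
  have "real p > c" using real_nat_ceiling_ge[of "\<bar>c\<bar> + 1"] unfolding p_def by linarith
  then have "summable (\<lambda>n. a (Suc n) * of_nat (Suc n) powr (- of_nat p))"
    using c[of "of_nat p"] by (simp add: sums_iff)
  then have "Bseq (\<lambda>n. a (Suc n) * of_nat (Suc n) powr (- of_nat p))"
    by (intro convergent_imp_Bseq) (auto simp: convergent_def dest: summable_LIMSEQ_zero)
  then obtain C where C: "C > 0" "\<And>n. norm (a (Suc n) * of_nat (Suc n) powr (- of_nat p)) \<le> C"
    by (auto simp: Bseq_def)
  show ?thesis
  proof (rule exI[of _ p], rule exI[of _ C], intro conjI allI impI)
    show "C > 0" by fact
    fix n :: nat assume n: "n \<ge> 1"
    then obtain n' where n': "n = Suc n'" by (cases n) auto
    have "norm (of_nat n powr (- of_nat p) :: complex) = 1 / real n ^ p"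
      using n by (simp add: norm_divide norm_power powr_minus powr_realpow inverse_eq_divide)
    then have "norm (a n) * (1 / real n ^ p) \<le> C"
      using C(2)[of n'] by (simp add: norm_mult n' del: of_nat_Suc)
    then show "norm (a n) \<le> C * real n ^ p" using n by (simp add: field_simps)
  qed
qed

text \<open>\<open>psi\<close> without its power of chi. This part is entire and gets one crude
  estimate for all real parts, whereas the powers of chi need separate bounds on either side of the
  critical line.\<close>

definition mollifier_sum :: "(nat \<Rightarrow> complex) \<Rightarrow> (nat \<Rightarrow> complex) \<Rightarrow> complex poly
    \<Rightarrow> real \<Rightarrow> real \<Rightarrow> nat \<Rightarrow> complex \<Rightarrow> complex" where
  "mollifier_sum lam mu P \<sigma> M m s = (\<Sum>(h, k) | h > 0 \<and> k > 0 \<and> real (h * k) \<le> M.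
        mu h * dirichlet_conv_power lam (m - 1) k
          * of_nat h powr of_real (\<sigma> - 1 / 2) * of_nat k powr of_real (1 / 2 - \<sigma>)
          / (of_nat h powr s * of_nat k powr (1 - s)) * poly_bracket P M (h * k))"

lemma psi_mollifier_sum:
  "psi X lam mu P \<sigma> M m s = X (s + 1 / 2 - of_real \<sigma>) ^ (m - 1) * mollifier_sum lam mu P \<sigma> M m s"
  by (simp add: psi_def mollifier_sum_def)

lemma mollifier_sum_holomorphic: "mollifier_sum lam mu P \<sigma> M m holomorphic_on A"
  unfolding mollifier_sum_def[abs_def] split_beta
  by (intro holomorphic_intros) auto

lemma hyperbola_subset:
  assumes "M \<ge> 0"
  shows "{(h::nat, k::nat). h > 0 \<and> k > 0 \<and> real (h * k) \<le> M} \<subseteq> {1..nat \<lfloor>M\<rfloor>} \<times> {1..nat \<lfloor>M\<rfloor>}"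
proof safe
  fix h k :: nat assume h: "0 < h" "0 < k" "real (h * k) \<le> M"
  then have "h \<le> h * k" "k \<le> h * k" by simp_all
  then have "real h \<le> real (h * k)" "real k \<le> real (h * k)" by (simp_all only: of_nat_le_iff)
  then have "real h \<le> M" "real k \<le> M" using h by linarith+
  then show "h \<in> {1..nat \<lfloor>M\<rfloor>}" "k \<in> {1..nat \<lfloor>M\<rfloor>}" using h by (auto simp: le_nat_floor)
qed

text \<open>At distance y from the line a term has the weight (h / k)^y (h k)^(-1/2), which is at
  most M^|y| and so at most T^(|y| / 4). Everything else is a fixed power of T, and a does not
  depend on y.\<close>

lemma mollifier_sum_bound:
  assumes lam: "\<forall>n\<ge>1. norm (lam n) \<le> real (card {d. d dvd n}) * real n powr \<theta>"
    and mu: "has_dirichlet_series mu F"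
  shows "\<exists>a C. C > 0 \<and> (\<forall>T \<nu> \<sigma> y t. T \<ge> 1 \<and> \<nu> \<le> 1 / 4 \<longrightarrow>
    norm (mollifier_sum lam mu P \<sigma> (T powr \<nu>) m (Complex (\<sigma> - y) t)) \<le> C * T powr (real a + \<bar>y\<bar> / 4))"
proof -
  obtain p where p: "\<And>n. n \<ge> 1 \<Longrightarrow> norm (dirichlet_conv_power lam (m - 1) n) \<le> real n ^ p"
    using dirichlet_conv_power_polynomial[OF lam] by blast
  obtain r C where C: "C > 0" "\<And>n. n \<ge> 1 \<Longrightarrow> norm (mu n) \<le> C * real n ^ r"
    using dirichlet_coefficients_polynomial[OF mu] by blast
  have "bounded ((\<lambda>x. poly P (of_real x)) ` {0..1})"
    by (intro compact_imp_bounded compact_continuous_image continuous_intros) auto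
  then obtain E where E: "E > 0" "\<And>x. x \<in> {0..1} \<Longrightarrow> norm (poly P (of_real x)) \<le> E"
    by (auto simp: bounded_pos)
  show ?thesis
  proof (rule exI[of _ "r + p + 2"], rule exI[of _ "C * E"], intro conjI allI impI)
    show "C * E > 0" using C E by simp
    fix T \<nu> \<sigma> y t :: real assume h: "T \<ge> 1 \<and> \<nu> \<le> 1 / 4"
    define M where "M = T powr \<nu>"
    define S where "S = {(h::nat, k::nat). h > 0 \<and> k > 0 \<and> real (h * k) \<le> M}"
    have "T powr \<nu> \<le> T powr (1 / 4)" using h by (intro powr_mono) auto
    then have M: "0 < M" "M \<le> T powr (1 / 4)" using h by (auto simp: M_def)
    have rhs0: "0 \<le> C * E * T powr (real (r + p + 2) + \<bar>y\<bar> / 4)" using C E by simp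
    show "norm (mollifier_sum lam mu P \<sigma> (T powr \<nu>) m (Complex (\<sigma> - y) t)) \<le> C * E * T powr (real (r + p + 2) + \<bar>y\<bar> / 4)"
    proof (cases "M < 1")
      case True
      have "S = {}"
      proof -
        have False if "(h, k) \<in> S" for h k
        proof -
          have "h * k \<ge> 1" using that by (auto simp: S_def Suc_le_eq)
          then have "real (h * k) \<ge> 1" by linarith
          then show False using that True by (auto simp: S_def)
        qed
        then show ?thesis by auto
      qed
      then show ?thesis using rhs0 unfolding mollifier_sum_def M_def[symmetric] S_def[symmetric] by simp
    next
      case False
      then have M1: "M \<ge> 1" by simp
      have fin: "finite S" and card: "real (card S) \<le> M ^ 2"
      proof -
        have sub: "S \<subseteq> {1..nat \<lfloor>M\<rfloor>} \<times> {1..nat \<lfloor>M\<rfloor>}" using hyperbola_subset[of M] M1 by (simp add: S_def)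
        then show "finite S" by (rule finite_subset) auto
        have "card S \<le> nat \<lfloor>M\<rfloor> * nat \<lfloor>M\<rfloor>" using card_mono[OF _ sub] by simp
        then have "real (card S) \<le> real (nat \<lfloor>M\<rfloor>) * real (nat \<lfloor>M\<rfloor>)" by (metis of_nat_le_iff of_nat_mult)
        also have "\<dots> \<le> M * M" using M1 by (intro mult_mono) auto
        finally show "real (card S) \<le> M ^ 2" by (simp add: power2_eq_square)
      qed
      have summand: "norm (mu h * dirichlet_conv_power lam (m - 1) k
          * of_nat h powr of_real (\<sigma> - 1 / 2) * of_nat k powr of_real (1 / 2 - \<sigma>)
          / (of_nat h powr (Complex (\<sigma> - y) t) * of_nat k powr (1 - Complex (\<sigma> - y) t)) * poly_bracket P M (h * k))
          \<le> C * E * M ^ (r + p) * M powr \<bar>y\<bar>" if "(h, k) \<in> S" for h k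
      proof -
        have hk: "h \<ge> 1" "k \<ge> 1" "real (h * k) \<le> M" using that by (auto simp: S_def)
        have "h \<le> h * k" "k \<le> h * k" using hk by simp_all
        then have "real h \<le> real (h * k)" "real k \<le> real (h * k)" by (simp_all only: of_nat_le_iff)
        then have hM: "real h \<le> M" "real k \<le> M" using hk by linarith+
        have 1: "norm (mu h) \<le> C * M ^ r"
          using C hk hM order_trans[OF C(2)[of h]] by (simp add: power_mono)
        have 2: "norm (dirichlet_conv_power lam (m - 1) k) \<le> M ^ p"
          using hk hM order_trans[OF p[of k]] by (simp add: power_mono)
        have 3: "norm (of_nat h powr of_real (\<sigma> - 1 / 2) * of_nat k powr of_real (1 / 2 - \<sigma>)
          / (of_nat h powr (Complex (\<sigma> - y) t) * of_nat k powr (1 - Complex (\<sigma> - y) t)) :: complex) \<le> M powr \<bar>y\<bar>"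
        proof -
          have "norm (of_nat h powr of_real (\<sigma> - 1 / 2) * of_nat k powr of_real (1 / 2 - \<sigma>)
            / (of_nat h powr (Complex (\<sigma> - y) t) * of_nat k powr (1 - Complex (\<sigma> - y) t)) :: complex)
            = real h powr (\<sigma> - 1 / 2) * real k powr (1 / 2 - \<sigma>) / (real h powr (\<sigma> - y) * real k powr (1 - (\<sigma> - y)))"
            by (simp add: norm_mult norm_divide norm_powr_real_powr)
          also have "\<dots> = real h powr (\<sigma> - 1 / 2 - (\<sigma> - y)) * real k powr (1 / 2 - \<sigma> - (1 - (\<sigma> - y)))"
            by (simp only: powr_diff times_divide_times_eq)
          also have "\<dots> = real h powr (y - 1 / 2) * real k powr (- y - 1 / 2)"
            by (simp add: algebra_simps)
          also have "\<dots> \<le> M powr \<bar>y\<bar>"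
          proof (cases "y \<ge> 0")
            case True
            have "real h powr (y - 1 / 2) \<le> real h powr y" using hk by (intro powr_mono) auto
            also have "\<dots> \<le> M powr y" using hM True by (intro powr_mono2) auto
            finally have "real h powr (y - 1 / 2) \<le> M powr y" .
            moreover have "real k powr (- y - 1 / 2) \<le> real k powr 0" using hk True by (intro powr_mono) auto
            ultimately have "real h powr (y - 1 / 2) * real k powr (- y - 1 / 2) \<le> M powr y * 1"
              using hk by (intro mult_mono) auto
            then show ?thesis using True by simp
          next
            case False
            have "real k powr (- y - 1 / 2) \<le> real k powr (- y)" using hk by (intro powr_mono) auto
            also have "\<dots> \<le> M powr (- y)" using hM False by (intro powr_mono2) auto
            finally have "real k powr (- y - 1 / 2) \<le> M powr (- y)" .
            moreover have "real h powr (y - 1 / 2) \<le> real h powr 0" using hk False by (intro powr_mono) auto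
            ultimately have "real h powr (y - 1 / 2) * real k powr (- y - 1 / 2) \<le> 1 * M powr (- y)"
              using hk by (intro mult_mono) auto
            then show ?thesis using False by simp
          qed
          finally show ?thesis .
        qed
        have 4: "norm (poly_bracket P M (h * k)) \<le> E"
        proof -
          have hk1: "real (h * k) \<ge> 1" using hk by (metis mult_le_mono nat_mult_1 of_nat_1 of_nat_le_iff)
          have "ln (M / real (h * k)) \<le> ln M" "0 \<le> ln (M / real (h * k))"
            using hk1 hk(3) M1 by (auto simp: ln_div)
          \<comment> \<open>For M = 1 the denominator is 0 and the quotient is 0 by convention,
            which still lies in the unit interval.\<close>
          then have "ln (M / real (h * k)) / ln M \<in> {0..1}" using M1
            by (auto simp: divide_le_eq_1 zero_le_divide_iff)
          then show ?thesis unfolding poly_bracket_def by (rule E(2))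
        qed
        have "norm (mu h) * norm (dirichlet_conv_power lam (m - 1) k) *
            norm (of_nat h powr of_real (\<sigma> - 1 / 2) * of_nat k powr of_real (1 / 2 - \<sigma>)
          / (of_nat h powr (Complex (\<sigma> - y) t) * of_nat k powr (1 - Complex (\<sigma> - y) t)) :: complex) *
            norm (poly_bracket P M (h * k)) \<le> (C * M ^ r) * M ^ p * M powr \<bar>y\<bar> * E"
          using 1 2 3 4 C M by (intro mult_mono) auto
        then show ?thesis by (simp add: norm_mult norm_divide power_add mult_ac)
      qed
      have "norm (mollifier_sum lam mu P \<sigma> M m (Complex (\<sigma> - y) t)) \<le> real (card S) * (C * E * M ^ (r + p) * M powr \<bar>y\<bar>)"
        unfolding mollifier_sum_def S_def[symmetric] by (rule sum_norm_bound) (use summand in auto)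
      also have "\<dots> \<le> M ^ 2 * (C * E * M ^ (r + p) * M powr \<bar>y\<bar>)"
        using card C E M by (intro mult_right_mono) auto
      also have "\<dots> = C * E * (M powr real (r + p + 2) * M powr \<bar>y\<bar>)"
        unfolding powr_realpow[OF M(1)] by (simp add: power_add mult_ac power2_eq_square)
      also have "\<dots> = C * E * M powr (real (r + p + 2) + \<bar>y\<bar>)" by (simp only: powr_add)
      also have "\<dots> \<le> C * E * (T powr (1 / 4)) powr (real (r + p + 2) + \<bar>y\<bar>)"
        using C E M by (intro mult_left_mono powr_mono2) auto
      also have "\<dots> = C * E * T powr (1 / 4 * (real (r + p + 2) + \<bar>y\<bar>))" by (simp only: powr_powr)
      also have "\<dots> \<le> C * E * T powr (real (r + p + 2) + \<bar>y\<bar> / 4)"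
        using C E h by (intro mult_left_mono powr_mono) (auto simp: field_simps)
      finally show ?thesis by (simp add: M_def)
    qed
  qed
qed

section \<open>Shifting the contour\<close>

text \<open>Removes the boundary terms when integrating by parts against derivatives of the
  weight.\<close>

lemma higher_deriv_zero_outside:
  fixes w :: "real \<Rightarrow> real"
  assumes "\<And>t. w t \<noteq> 0 \<Longrightarrow> a \<le> t \<and> t \<le> b" and "t < a \<or> b < t"
  shows "(deriv ^^ n) w t = 0"
  using assms(2)
proof (induction n arbitrary: t)
  case 0
  then show ?case using assms(1)[of t] by fastforce
next
  case (Suc n)
  have "open ({..<a} \<union> {b<..})" by auto
  moreover have "t \<in> {..<a} \<union> {b<..}" using Suc.prems by auto
  ultimately have "((deriv ^^ n) w has_field_derivative 0) (at t)"
    by (rule has_field_derivative_transform_within_open[of "\<lambda>_. 0" 0 t, OF _ _ _ sym, rotated])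
       (use Suc.IH in auto)
  then show ?case by (simp add: DERIV_imp_deriv)
qed

text \<open>The one-variable form of the almost analytic extension: moving the contour by \<open>A\<close> costs only terms
  with derivatives of the weight, and the last of them is estimated trivially.\<close>

lemma contour_shift_bound:
  fixes w :: "real \<Rightarrow> real" and G :: "complex \<Rightarrow> complex"
  assumes smooth: "\<And>n t. (deriv ^^ n) w field_differentiable (at t)"
    and vanish: "\<And>n. (deriv ^^ n) w a = 0" "\<And>n. (deriv ^^ n) w b = 0"
    and hol: "G holomorphic_on S" "open S"
    and sub: "\<And>t y. a \<le> t \<Longrightarrow> t \<le> b \<Longrightarrow> 0 \<le> y \<Longrightarrow> y \<le> A \<Longrightarrow> Complex t y \<in> S"
    and "a \<le> b" "0 \<le> A"
    and D: "\<And>n t. \<bar>(deriv ^^ n) w t\<bar> \<le> D n"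
    and E: "\<And>t. a \<le> t \<Longrightarrow> t \<le> b \<Longrightarrow> norm (G (Complex t A)) \<le> E"
    and F: "\<And>t y. a \<le> t \<Longrightarrow> t \<le> b \<Longrightarrow> 0 \<le> y \<Longrightarrow> y \<le> A \<Longrightarrow> norm (G (Complex t y)) \<le> F"
  shows "norm (integral {a..b} (\<lambda>t. of_real (w t) * G (of_real t)))
    \<le> (b - a) * ((\<Sum>n<K. A ^ n * D n) * E + A ^ K * D K * F)"
proof -
  define W where "W n = (deriv ^^ n) w" for n
  have W: "(W n has_real_derivative W (Suc n) t) (at t within X)" for n t X
    using smooth[of n t] unfolding W_def
    by (auto simp: field_differentiable_derivI has_field_derivative_at_within)
  have cW: "continuous_on X (W n)" for n X
    using W DERIV_continuous_on by blast
  have cG: "continuous_on S G" using hol holomorphic_on_imp_continuous_on by blast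
  have hG': "deriv G holomorphic_on S" using hol by (simp add: holomorphic_deriv)
  have cG': "continuous_on S (deriv G)" using hG' holomorphic_on_imp_continuous_on by blast
  have D0: "D n \<ge> 0" for n using D[of n 0] abs_ge_zero order_trans by blast
  have cC: "continuous_on X (\<lambda>p. Complex (p1 p) (p2 p))" if "continuous_on X p1" "continuous_on X p2"
    for X :: "'x::topological_space set" and p1 p2
    using that unfolding Complex_eq by (intro continuous_intros)
  define I where "I n y = integral {a..b} (\<lambda>t. of_real (W n t) * G (Complex t y))" for n y
  have bound: "norm (I n y) \<le> (b - a) * (D n * U)"
    if y: "0 \<le> y" "y \<le> A" and U: "\<And>t. a \<le> t \<Longrightarrow> t \<le> b \<Longrightarrow> norm (G (Complex t y)) \<le> U" for n y U
  proof -
    have "norm (integral {a..b} (\<lambda>t. of_real (W n t) * G (Complex t y))) \<le> D n * U * (b - a)"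
    proof (rule integral_bound)
      show "continuous_on {a..b} (\<lambda>t. of_real (W n t) * G (Complex t y))"
        using sub y by (intro continuous_intros cW continuous_on_compose2[OF cG] cC) auto
      fix t assume "t \<in> {a..b}"
      then show "norm (of_real (W n t) * G (Complex t y)) \<le> D n * U"
        using D[of n t] U[of t] D0[of n] unfolding norm_mult by (intro mult_mono) (auto simp: W_def)
    qed (use \<open>a \<le> b\<close> in auto)
    then show ?thesis by (simp add: I_def mult_ac)
  qed
  have Gt: "((\<lambda>t. G (Complex t y)) has_vector_derivative deriv G (Complex t y)) (at t within X)"
    if "Complex t y \<in> S" for t y X
  proof -
    have "((\<lambda>t. Complex t y) has_vector_derivative 1) (at t within X)"
      unfolding Complex_eq by (auto intro!: derivative_eq_intros)
    from field_vector_diff_chain_within[OF this, of G "deriv G (Complex t y)"] show ?thesis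
      using holomorphic_derivI[OF hol that] by (simp add: o_def has_field_derivative_at_within)
  qed
  have Gy: "((\<lambda>y. G (Complex t y)) has_vector_derivative \<i> * deriv G (Complex t y)) (at y within X)"
    if "Complex t y \<in> S" for t y X
  proof -
    have "((\<lambda>y. Complex t y) has_vector_derivative \<i>) (at y within X)"
      unfolding Complex_eq by (auto intro!: derivative_eq_intros)
    from field_vector_diff_chain_within[OF this, of G "deriv G (Complex t y)"] show ?thesis
      using holomorphic_derivI[OF hol that] by (simp add: o_def has_field_derivative_at_within)
  qed
  \<comment> \<open>By the Cauchy-Riemann equations the y-derivative of G is i times its
    t-derivative, which integration by parts moves onto the weight. So the derivative of
    \<open>I n\<close> is -i times \<open>I (Suc n)\<close>, and w itself never leaves the real
    line.\<close>
  have dI: "(I n has_vector_derivative - \<i> * I (Suc n) y) (at y within {0..A})"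
    if y: "y \<in> {0..A}" for n y
  proof -
    have "((\<lambda>y. integral (cbox a b) (\<lambda>t. of_real (W n t) * G (Complex t y))) has_vector_derivative
        integral (cbox a b) (\<lambda>t. of_real (W n t) * (\<i> * deriv G (Complex t y)))) (at y within {0..A})"
    proof (rule leibniz_rule_vector_derivative)
      fix y t assume "y \<in> {0..A}" "t \<in> cbox a b"
      then show "((\<lambda>x. complex_of_real (W n t) * G (Complex t x)) has_vector_derivative
            complex_of_real (W n t) * (\<i> * deriv G (Complex t y))) (at y within {0..A})"
        using sub by (intro has_vector_derivative_mult_right Gy) auto
    next
      fix y assume "y \<in> {0..A}"
      then show "(\<lambda>t. complex_of_real (W n t) * G (Complex t y)) integrable_on cbox a b"
        using sub by (intro integrable_continuous continuous_intros cW continuous_on_compose2[OF cG] cC) auto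
    next
      show "continuous_on ({0..A} \<times> cbox a b) (\<lambda>(y, t). complex_of_real (W n t) * (\<i> * deriv G (Complex t y)))"
        using sub unfolding split_beta
        by (intro continuous_intros continuous_on_compose2[OF cW[of UNIV]] continuous_on_compose2[OF cG'] cC) auto
    qed (use y in auto)
    moreover have "integral {a..b} (\<lambda>t. of_real (W n t) * (\<i> * deriv G (Complex t y))) = - \<i> * I (Suc n) y"
    proof -
      have "((\<lambda>t. of_real (W n t) * deriv G (Complex t y) + of_real (W (Suc n) t) * G (Complex t y)) has_integral
          (of_real (W n b) * G (Complex b y) - of_real (W n a) * G (Complex a y))) {a..b}"
      proof (rule fundamental_theorem_of_calculus[OF \<open>a \<le> b\<close>])
        fix t assume t: "t \<in> {a..b}"
        have "((\<lambda>t. complex_of_real (W n t)) has_vector_derivative of_real (W (Suc n) t)) (at t within {a..b})"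
          using W[of n t "{a..b}"]
          by (simp add: has_vector_derivative_of_real has_real_derivative_iff_has_vector_derivative)
        from has_vector_derivative_mult[OF this Gt] show "((\<lambda>t. complex_of_real (W n t) * G (Complex t y)) has_vector_derivative
             complex_of_real (W n t) * deriv G (Complex t y) + complex_of_real (W (Suc n) t) * G (Complex t y))
             (at t within {a..b})"
          using sub t y by auto
      qed
      then have *: "((\<lambda>t. of_real (W n t) * deriv G (Complex t y) + of_real (W (Suc n) t) * G (Complex t y)) has_integral 0) {a..b}"
        using vanish by (simp add: W_def)
      have "((\<lambda>t. of_real (W (Suc n) t) * G (Complex t y)) has_integral I (Suc n) y) {a..b}"
        unfolding I_def using sub y
        by (intro integrable_integral integrable_continuous_real continuous_intros cW continuous_on_compose2[OF cG] cC) auto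
      from has_integral_diff[OF * this] have "((\<lambda>t. of_real (W n t) * deriv G (Complex t y)) has_integral - I (Suc n) y) {a..b}"
        by simp
      from has_integral_mult_right[OF this, of \<i>] show ?thesis
        by (intro integral_unique) (simp add: mult_ac)
    qed
    ultimately show ?thesis by (simp add: I_def[abs_def])
  qed
  have step: "norm (I n y) \<le> norm (I n A) + A * B" if y: "0 \<le> y" "y \<le> A"
    and B: "\<And>z. 0 \<le> z \<Longrightarrow> z \<le> A \<Longrightarrow> norm (I (Suc n) z) \<le> B" for n y B
  proof -
    have "B \<ge> 0" using B[of 0] \<open>0 \<le> A\<close> norm_ge_zero order_trans by blast
    have "norm (I n A - I n y) \<le> B * norm (A - y)"
    proof (rule differentiable_bound[of "{0..A}" "I n" "\<lambda>z h. h *\<^sub>R (- \<i> * I (Suc n) z)"])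
      fix z assume z: "z \<in> {0..A}"
      show "(I n has_derivative (\<lambda>h. h *\<^sub>R (- \<i> * I (Suc n) z))) (at z within {0..A})"
        using dI[OF z, of n] by (simp add: has_vector_derivative_def)
      show "onorm (\<lambda>h. h *\<^sub>R (- \<i> * I (Suc n) z)) \<le> B"
        using B[of z] z by (intro onorm_le) (auto simp: norm_mult mult.commute[of B] intro!: mult_left_mono)
    qed (use y in auto)
    also have "\<dots> \<le> B * A" using y \<open>B \<ge> 0\<close> by (intro mult_left_mono) auto
    finally show ?thesis using norm_triangle_sub[of "I n y" "I n A"] by (simp add: norm_minus_commute mult_ac)
  qed
  \<comment> \<open>Each application of \<open>step\<close> leaves one integral at height A,
    estimated by E, and passes to the next derivative at the cost of a factor A. After K rounds the
    remaining integral is estimated by F. The start m is arbitrary so that the induction can move on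
    to \<open>Suc m\<close>.\<close>
  have main: "\<forall>y. 0 \<le> y \<and> y \<le> A \<longrightarrow> norm (I m y) \<le> (b - a) * ((\<Sum>n<K. A ^ n * D (m + n)) * E + A ^ K * D (m + K) * F)" for K m
  proof (induction K arbitrary: m)
    case 0
    then show ?case using bound[of _ F m] F by simp
  next
    case (Suc K)
    show ?case
    proof (intro allI impI)
      fix y assume y: "0 \<le> y \<and> y \<le> A"
      have "norm (I m y) \<le> norm (I m A) + A * ((b - a) * ((\<Sum>n<K. A ^ n * D (Suc m + n)) * E + A ^ K * D (Suc m + K) * F))"
        using Suc[of "Suc m"] y by (intro step) auto
      also have "norm (I m A) \<le> (b - a) * (D m * E)" using E \<open>0 \<le> A\<close> by (intro bound) auto
      also have "(b - a) * (D m * E) + A * ((b - a) * ((\<Sum>n<K. A ^ n * D (Suc m + n)) * E + A ^ K * D (Suc m + K) * F))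
         = (b - a) * ((\<Sum>n<Suc K. A ^ n * D (m + n)) * E + A ^ Suc K * D (m + Suc K) * F)"
        by (simp only: sum.lessThan_Suc_shift) (simp add: algebra_simps sum_distrib_left)
      finally show "norm (I m y) \<le> (b - a) * ((\<Sum>n<Suc K. A ^ n * D (m + n)) * E + A ^ Suc K * D (m + Suc K) * F)" by simp
    qed
  qed
  have "integral {a..b} (\<lambda>t. of_real (w t) * G (of_real t)) = I 0 0"
    by (simp add: I_def W_def complex_of_real_def)
  then show ?thesis using main[of 0 K] \<open>0 \<le> A\<close> by simp
qed

section \<open>The mixed moment for fixed j\<close>

lemma chi_holomorphic:
  assumes "N > 0"
  shows "chi k N eps holomorphic_on {s. Im s > 0}"
proof -
  have n1: "s + of_real ((real k - 1) / 2) \<notin> \<int>\<^sub>\<le>\<^sub>0" "1 - s + of_real ((real k - 1) / 2) \<notin> \<int>\<^sub>\<le>\<^sub>0" if "Im s > 0" for s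
    using that by (auto elim!: nonpos_Ints_cases simp: complex_eq_iff)
  have c: "complex_of_real (sqrt (real N) / (2 * pi)) \<notin> \<real>\<^sub>\<le>\<^sub>0" "complex_of_real (sqrt (real N) / (2 * pi)) \<noteq> 0"
    using assms by (auto simp: complex_nonpos_Reals_iff not_le)
  show ?thesis
    unfolding chi_def[abs_def] gamma_factor_def using n1 c
    by (intro holomorphic_intros) (auto simp: Gamma_eq_zero_iff)
qed

lemma V_op_holomorphic:
  assumes "L holomorphic_on UNIV"
  shows "V_op Q T L holomorphic_on S"
  unfolding V_op_def[abs_def]
  by (intro holomorphic_intros holomorphic_on_subset[OF holomorphic_higher_deriv[OF assms open_UNIV]]) auto

lemma nu_le:
  assumes "\<theta> \<ge> 0" "\<epsilon> > 0"
  shows "nu \<theta> \<epsilon> m \<le> 1 / 4"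
  using assms by (auto simp: nu_def field_simps add_increasing)

text \<open>Two derivatives of the weight save (ln T / T)^2, which is therefore at most 4 / T; this
  keeps logarithms out of the final count.\<close>

lemma ln_squared_le:
  assumes "(T::real) \<ge> 1"
  shows "(ln T)\<^sup>2 \<le> 4 * T"
proof -
  have "ln T = 2 * ln (sqrt T)" using assms by (simp add: ln_sqrt)
  also have "\<dots> \<le> 2 * sqrt T" using ln_le_minus_one[of "sqrt T"] assms by auto
  finally have "(ln T)\<^sup>2 \<le> (2 * sqrt T)\<^sup>2" using assms by (intro power_mono) auto
  then show ?thesis using assms by (simp add: power_mult_distrib)
qed

text \<open>Up to a power of \<open>T\<close> that does not depend on \<open>A\<close>, shifting the contour by \<open>A\<close> to the left gains
  \<open>T^(-2jA)\<close> from the powers of \<open>chi\<close> and loses \<open>T^(2A)\<close> from \<open>V\<close> and \<open>T^(A/2)\<close> from the two Dirichlet polynomials.\<close>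

lemma mixed_moment_bounded:
  fixes k N l j :: nat and R0 :: real and B :: "nat \<Rightarrow> real"
  assumes prim: "primitive_cusp_form k N f lam" and N: "N > 0"
    and L: "is_L_function lam L" and eps: "is_root_number k N L eps"
    and mu1: "has_dirichlet_series mu1 F1" and mu2: "has_dirichlet_series mu2 F2"
    and lam: "\<forall>n\<ge>1. norm (lam n) \<le> real (card {d. d dvd n}) * real n powr \<theta>"
    and \<nu>: "\<nu>1 \<le> 1 / 4" "\<nu>2 \<le> 1 / 4"
    and l: "l \<ge> 1" and j: "j \<ge> 2"
  shows "\<exists>C T0. \<forall>T\<ge>T0. \<forall>R w. 0 < R \<and> R \<le> R0 \<and> admissible_weight B T w \<longrightarrow>
    norm (LINT t|lborel. of_real (w t)
               * of_real ((norm (V_op Q T L (Complex (sigma0 R T) t)))\<^sup>2)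
               * psi (chi k N eps) lam mu1 P1 (sigma0 R T) (T powr \<nu>1) l (Complex (sigma0 R T) t)
               * cnj (psi (chi k N eps) lam mu2 P2 (sigma0 R T) (T powr \<nu>2) (l + j) (Complex (sigma0 R T) t))) \<le> C"
proof -
  have Lhol: "L holomorphic_on UNIV" using L by (simp add: is_L_function_def)
  have ne: "norm eps = 1" using eps by (auto simp: is_root_number_def)
  obtain m0 where LB: "\<And>K::nat. \<exists>C>0. \<forall>s. Im s \<ge> 1 \<and> Re s \<ge> - real K \<longrightarrow> norm (L s) \<le> C * Im s ^ (2 * K + m0)"
    using L_function_polynomial_bound[OF prim N L eps lam] by blast
  obtain a1 C1 where M1: "C1 > 0" "\<And>T \<sigma> y t. T \<ge> 1 \<Longrightarrow>
      norm (mollifier_sum lam mu1 P1 \<sigma> (T powr \<nu>1) l (Complex (\<sigma> - y) t)) \<le> C1 * T powr (real a1 + \<bar>y\<bar> / 4)"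
    using mollifier_sum_bound[OF lam mu1, of P1 l] \<nu>(1) by blast
  obtain a2 C2 where M2: "C2 > 0" "\<And>T \<sigma> y t. T \<ge> 1 \<Longrightarrow>
      norm (mollifier_sum lam mu2 P2 \<sigma> (T powr \<nu>2) (l + j) (Complex (\<sigma> - y) t)) \<le> C2 * T powr (real a2 + \<bar>y\<bar> / 4)"
    using mollifier_sum_bound[OF lam mu2, of P2 "l + j"] \<nu>(2) by blast
  \<comment> \<open>\<open>c0\<close> collects the losses independent of the shift. A is a multiple
    of 4 so that the cost A / 4 = q of each Dirichlet polynomial is an integer. In units of q, V and
    the two polynomials lose 8 + 2 and the surplus powers of chi gain at least 16, so q = c0 + 1
    leaves more than enough for \<open>c0\<close> and one further power of T.\<close>
  define c0 where "c0 = 8 + 2 * m0 + a1 + a2"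
  define q where "q = c0 + 1"
  define A where "A = 4 * q"
  \<comment> \<open>Exponents of V on the left and on the right: the real part of s is at least -(A
    + 1) or -1, and \<open>V_op_bound\<close> needs L one unit further.\<close>
  define p1 p2 where "p1 = 2 * (A + 2) + m0" and "p2 = 4 + m0"
  obtain D1 where D1: "D1 > 0" "\<And>T s. ln T \<ge> 1 \<Longrightarrow> Im s \<ge> 2 \<Longrightarrow> Re s \<ge> - real (A + 1) \<Longrightarrow> norm (V_op Q T L s) \<le> D1 * Im s ^ p1"
  proof -
    obtain C where "C > 0" "\<And>s. Im s \<ge> 1 \<Longrightarrow> Re s \<ge> - real (A + 2) \<Longrightarrow> norm (L s) \<le> C * Im s ^ p1"
      using LB[of "A + 2"] unfolding p1_def by blast
    then show thesis using V_op_bound[OF Lhol, of "- real (A + 1)" C p1 Q] that by fastforce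
  qed
  obtain D2 where D2: "D2 > 0" "\<And>T s. ln T \<ge> 1 \<Longrightarrow> Im s \<ge> 2 \<Longrightarrow> Re s \<ge> - 1 \<Longrightarrow> norm (V_op Q T L s) \<le> D2 * Im s ^ p2"
  proof -
    obtain C where "C > 0" "\<And>s. Im s \<ge> 1 \<Longrightarrow> Re s \<ge> - real 2 \<Longrightarrow> norm (L s) \<le> C * Im s ^ p2"
      using LB[of 2] unfolding p2_def by auto
    then show thesis using V_op_bound[OF Lhol, of "- 1" C p2 Q] that by fastforce
  qed
  \<comment> \<open>Three regimes of chi: growth up to |t|^(2 A) left of the critical line,
    boundedness on and right of it, and full decay at the far end of the shift.\<close>
  obtain X1 where X1: "X1 > 0" "\<And>\<sigma> t. \<bar>\<sigma>\<bar> \<le> real A + 1 \<Longrightarrow> 1 - 2 * \<sigma> \<le> real (2 * A) \<Longrightarrow> \<bar>t\<bar> \<ge> 1 \<Longrightarrow> norm (chi k N eps (Complex \<sigma> t)) \<le> X1 * \<bar>t\<bar> ^ (2 * A)"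
    using chi_upper_bound[OF ne N, of "real A + 1" "2 * A" k] by blast
  obtain X2 where X2: "X2 > 0" "\<And>\<sigma> t. \<bar>\<sigma>\<bar> \<le> real A + 1 \<Longrightarrow> 1 - 2 * \<sigma> \<le> real 0 \<Longrightarrow> \<bar>t\<bar> \<ge> 1 \<Longrightarrow> norm (chi k N eps (Complex \<sigma> t)) \<le> X2 * \<bar>t\<bar> ^ 0"
    using chi_upper_bound[OF ne N, of "real A + 1" 0 k] by blast
  obtain X3 where X3: "X3 > 0" "\<And>\<sigma> t. \<bar>\<sigma>\<bar> \<le> real A + 1 \<Longrightarrow> real (2 * A) \<le> 2 * \<sigma> - 1 \<Longrightarrow> \<bar>t\<bar> \<ge> 1 \<Longrightarrow> \<bar>t\<bar> ^ (2 * A) * norm (chi k N eps (Complex \<sigma> t)) \<le> X3"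
    using chi_lower_power_bound[OF ne N, of "real A + 1" "2 * A" k] by blast
  \<comment> \<open>T^e1 bounds G along the whole shift, with the decay of the second power of chi
    ignored. At the far end that decay is T^(-2 A (l + j - 1)), and the inequality below says that
    it leaves at most 1 / T.\<close>
  define e1 where "e1 = (p1 + 2 * A * (l - 1) + (a1 + q)) + (p2 + (a2 + q))"
  have e1: "e1 + 1 \<le> 2 * A * (l + j - 1)"
  proof -
    have "e1 + 1 = c0 + 10 * q + 1 + 2 * A * (l - 1)" by (simp add: e1_def p1_def p2_def A_def c0_def)
    also have "\<dots> \<le> 16 * q + 2 * A * (l - 1)" by (simp add: q_def)
    also have "\<dots> = 2 * A * (2 + (l - 1))" by (simp add: A_def algebra_simps)
    also have "\<dots> \<le> 2 * A * (l + j - 1)" using l j by (intro mult_le_mono2) auto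
    finally show ?thesis .
  qed
  define K1 where "K1 = (D1 * 4 ^ p1) * (X1 * 4 ^ (2 * A)) ^ (l - 1) * C1"
  define K2 where "K2 = (D2 * 4 ^ p2) * X2 ^ (l + j - 1) * C2"
  define K3 where "K3 = (D2 * 4 ^ p2) * (X3 * 8 ^ (2 * A)) ^ (l + j - 1) * C2"
  have Kpos: "K1 > 0" "K2 > 0" "K3 > 0" using D1 D2 X1 X2 X3 M1 M2 by (auto simp: K1_def K2_def K3_def)
  \<comment> \<open>2 p derivatives of the weight save T^(-p); with p = e1 + 1 the trivially
    estimated last term is also of size 1 / T, which balances the length of the interval of
    integration.\<close>
  define p where "p = e1 + 1"
  define SB where "SB = (\<Sum>n<2 * p. real A ^ n * \<bar>B n\<bar>)"
  have SB: "SB \<ge> 0" by (auto simp: SB_def intro!: sum_nonneg)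
  define C where "C = 4 * (SB * (K1 * K3) + real A ^ (2 * p) * (\<bar>B (2 * p)\<bar> * 4 ^ p) * (K1 * K2))"
  show ?thesis
  \<comment> \<open>16 ensures t >= T / 8 >= 2, as the bounds for V need; exp 1 ensures ln T >= 1;
    exp R0 ensures R / ln T <= 1, so that sigma0 lies between -1/2 and 1/2.\<close>
  proof (rule exI[of _ C], rule exI[of _ "max 16 (max (exp 1) (exp R0))"], intro allI impI)
    fix T R :: real and w :: "real \<Rightarrow> real"
    assume "max 16 (max (exp 1) (exp R0)) \<le> T"
    then have T: "T \<ge> 16" "T \<ge> exp 1" "T \<ge> exp R0" by auto
    assume "0 < R \<and> R \<le> R0 \<and> admissible_weight B T w"
    then have R: "0 < R" "R \<le> R0" and w: "admissible_weight B T w" by auto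
    have lnT: "ln T \<ge> 1" "ln T \<ge> R0" using T by (auto simp: ln_ge_iff)
    define \<sigma> where "\<sigma> = sigma0 R T"
    have "0 \<le> R / ln T" "R / ln T \<le> 1" using R lnT by (auto simp: field_simps)
    then have \<sigma>: "- 1 / 2 \<le> \<sigma>" "\<sigma> \<le> 1 / 2" unfolding \<sigma>_def sigma0_def by linarith+
    \<comment> \<open>In the variable u = s - sigma0 the argument of chi is 1/2 + u, so the critical
      line of chi is u = i t for every R.\<close>
    define H1 where "H1 u = V_op Q T L (of_real \<sigma> + u) * chi k N eps (1 / 2 + u) ^ (l - 1)
      * mollifier_sum lam mu1 P1 \<sigma> (T powr \<nu>1) l (of_real \<sigma> + u)" for u
    define H2 where "H2 u = V_op Q T L (of_real \<sigma> + u) * chi k N eps (1 / 2 + u) ^ (l + j - 1)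
      * mollifier_sum lam mu2 P2 \<sigma> (T powr \<nu>2) (l + j) (of_real \<sigma> + u)" for u
    have cplx: "of_real x + Complex y t = Complex (x + y) t" "1 / 2 + Complex y t = Complex (1 / 2 + y) t" for x y t
      by (auto simp: complex_eq_iff)
    have pw: "t ^ n \<le> 4 ^ n * T ^ n" if "0 \<le> t" "t \<le> 4 * T" for t :: real and n
      using power_mono[OF that(2,1), of n] by (simp add: power_mult_distrib)
    have mol: "T powr (real a + \<bar>y\<bar> / 4) \<le> T ^ (a + q)" if "\<bar>y\<bar> \<le> real A" for a y
    proof -
      have "T powr (real a + \<bar>y\<bar> / 4) \<le> T powr real (a + q)"
        using that T by (intro powr_mono) (auto simp: A_def)
      then show ?thesis using T by (simp only: powr_realpow)
    qed
    have H1b: "norm (H1 (Complex (- y) t)) \<le> K1 * T ^ (p1 + 2 * A * (l - 1) + (a1 + q))"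
      if y: "0 \<le> y" "y \<le> real A" and t: "T / 8 \<le> t" "t \<le> 4 * T" for y t
    proof -
      have t2: "t \<ge> 2" using t T by simp
      have 1: "norm (V_op Q T L (Complex (\<sigma> - y) t)) \<le> (D1 * 4 ^ p1) * T ^ p1"
      proof -
        have "norm (V_op Q T L (Complex (\<sigma> - y) t)) \<le> D1 * t ^ p1"
          using D1(2)[OF lnT(1), of "Complex (\<sigma> - y) t"] t2 y \<sigma> by simp
        also have "\<dots> \<le> D1 * (4 ^ p1 * T ^ p1)" using D1 pw t t2 by (intro mult_left_mono) auto
        finally show ?thesis by simp
      qed
      have 2: "norm (chi k N eps (Complex (1 / 2 - y) t)) \<le> (X1 * 4 ^ (2 * A)) * T ^ (2 * A)"
      proof -
        have "norm (chi k N eps (Complex (1 / 2 - y) t)) \<le> X1 * \<bar>t\<bar> ^ (2 * A)"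
          using t2 y by (intro X1(2)) (auto simp: abs_le_iff)
        also have "\<dots> \<le> X1 * (4 ^ (2 * A) * T ^ (2 * A))" using X1 pw t t2 by (intro mult_left_mono) auto
        finally show ?thesis by simp
      qed
      have 3: "norm (mollifier_sum lam mu1 P1 \<sigma> (T powr \<nu>1) l (Complex (\<sigma> - y) t)) \<le> C1 * T ^ (a1 + q)"
        by (rule order_trans[OF M1(2) mult_left_mono[OF mol]]) (use M1(1) y T in auto)
      have "norm (H1 (Complex (- y) t)) \<le> (D1 * 4 ^ p1) * T ^ p1 * ((X1 * 4 ^ (2 * A)) * T ^ (2 * A)) ^ (l - 1) * (C1 * T ^ (a1 + q))"
        unfolding H1_def cplx norm_mult norm_power
        using 1 2 3 D1 X1 T by (intro mult_mono power_mono) auto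
      also have "\<dots> = K1 * T ^ (p1 + 2 * A * (l - 1) + (a1 + q))"
        by (simp add: K1_def power_mult_distrib power_add power_mult mult_ac)
      finally show ?thesis .
    qed
    have H2b: "norm (H2 (Complex y t)) \<le> (D2 * 4 ^ p2) * X ^ (l + j - 1) * C2 * T ^ (p2 + (a2 + q))"
      if y: "0 \<le> y" "y \<le> real A" and t: "T / 8 \<le> t" "t \<le> 4 * T"
        and X: "norm (chi k N eps (Complex (1 / 2 + y) t)) \<le> X" for y t X
    proof -
      have t2: "t \<ge> 2" using t T by simp
      have X0: "X \<ge> 0" using X norm_ge_zero order_trans by blast
      have 1: "norm (V_op Q T L (Complex (\<sigma> + y) t)) \<le> (D2 * 4 ^ p2) * T ^ p2"
      proof -
        have "norm (V_op Q T L (Complex (\<sigma> + y) t)) \<le> D2 * t ^ p2"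
          using D2(2)[OF lnT(1), of "Complex (\<sigma> + y) t"] t2 y \<sigma> by simp
        also have "\<dots> \<le> D2 * (4 ^ p2 * T ^ p2)" using D2 pw t t2 by (intro mult_left_mono) auto
        finally show ?thesis by simp
      qed
      have 3: "norm (mollifier_sum lam mu2 P2 \<sigma> (T powr \<nu>2) (l + j) (Complex (\<sigma> + y) t)) \<le> C2 * T ^ (a2 + q)"
        using order_trans[OF M2(2)[of T \<sigma> "- y" t] mult_left_mono[OF mol[of "- y" a2], of C2]] M2(1) y T by simp
      have "norm (H2 (Complex y t)) \<le> (D2 * 4 ^ p2) * T ^ p2 * X ^ (l + j - 1) * (C2 * T ^ (a2 + q))"
        unfolding H2_def cplx norm_mult norm_power
        using 1 3 X X0 D2 T by (intro mult_mono power_mono) auto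
      then show ?thesis by (simp add: power_add mult_ac)
    qed
    \<comment> \<open>The double conjugation makes the conjugated factor holomorphic in z. For z = t
      + i y the first factor is evaluated at u = -y + i t and the second at u = y + i t; for real z
      = t both are at i t.\<close>
    define G where "G z = H1 (\<i> * z) * cnj (H2 (\<i> * cnj z))" for z
    have chihol: "(\<lambda>u. chi k N eps (1 / 2 + u)) holomorphic_on {u. Im u > 0}"
    proof -
      have "(chi k N eps \<circ> (\<lambda>u. 1 / 2 + u)) holomorphic_on {u. Im u > 0}"
        by (intro holomorphic_on_compose_gen[OF _ chi_holomorphic[OF N]] holomorphic_intros) auto
      then show ?thesis by (simp add: o_def)
    qed
    have shift: "(\<lambda>u. h (of_real \<sigma> + u)) holomorphic_on S" if "h holomorphic_on UNIV" for h S
    proof -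
      have "(h \<circ> (\<lambda>u. of_real \<sigma> + u)) holomorphic_on S"
        by (intro holomorphic_on_compose_gen[OF _ that] holomorphic_intros) auto
      then show ?thesis by (simp add: o_def)
    qed
    have H1hol: "H1 holomorphic_on {u. Im u > 0}" and H2hol: "H2 holomorphic_on {u. Im u > 0}"
      unfolding H1_def H2_def
      by (intro holomorphic_intros chihol shift[OF V_op_holomorphic[OF Lhol]] shift[OF mollifier_sum_holomorphic])+
    have opRe: "open {z. Re z > 0}" by (rule open_halfspace_Re_gt)
    have rot: "(\<lambda>z. h (\<i> * z)) holomorphic_on {z. Re z > 0}" if "h holomorphic_on {u. Im u > 0}" for h
    proof -
      have "(h \<circ> (\<lambda>z. \<i> * z)) holomorphic_on {z. Re z > 0}"
        by (intro holomorphic_on_compose_gen[OF _ that] holomorphic_intros) auto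
      then show ?thesis by (simp add: o_def)
    qed
    have "cnj ` {z. Re z > 0} = {z. Re z > 0}"
    proof (intro set_eqI iffI)
      fix z assume "z \<in> {z. Re z > 0}"
      then show "z \<in> cnj ` {z. Re z > 0}" by (intro image_eqI[of _ _ "cnj z"]) auto
    qed auto
    then have "cnj \<circ> (\<lambda>z. H2 (\<i> * z)) \<circ> cnj holomorphic_on {z. Re z > 0}"
      using rot[OF H2hol] opRe by (intro holomorphic_on_compose_cnj_cnj) auto
    then have Ghol: "G holomorphic_on {z. Re z > 0}"
      unfolding G_def using rot[OF H1hol] by (intro holomorphic_intros) (auto simp: o_def)
    have Gval: "norm (G (Complex t y)) = norm (H1 (Complex (- y) t)) * norm (H2 (Complex y t))" for t y
    proof -
      have "\<i> * Complex t y = Complex (- y) t" "\<i> * cnj (Complex t y) = Complex y t" by (auto simp: complex_eq_iff)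
      then show ?thesis by (simp add: G_def norm_mult)
    qed
    have Te1: "T ^ e1 = T ^ (p1 + 2 * A * (l - 1) + (a1 + q)) * T ^ (p2 + (a2 + q))"
      by (simp only: e1_def power_add)
    have GF: "norm (G (Complex t y)) \<le> K1 * K2 * T ^ e1"
      if y: "0 \<le> y" "y \<le> real A" and t: "T / 8 \<le> t" "t \<le> 4 * T" for y t
    proof -
      have "norm (chi k N eps (Complex (1 / 2 + y) t)) \<le> X2"
        using X2(2)[of "1 / 2 + y" t] y t T by auto
      from H2b[OF y t this] have "norm (H2 (Complex y t)) \<le> K2 * T ^ (p2 + (a2 + q))" by (simp add: K2_def)
      then have "norm (G (Complex t y)) \<le> (K1 * T ^ (p1 + 2 * A * (l - 1) + (a1 + q))) * (K2 * T ^ (p2 + (a2 + q)))"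
        unfolding Gval using H1b[OF y t] Kpos T by (intro mult_mono) auto
      then show ?thesis by (simp only: Te1 mult_ac)
    qed
    have GE: "norm (G (Complex t (real A))) \<le> K1 * K3 / T" if t: "T / 8 \<le> t" "t \<le> 4 * T" for t
    proof -
      have t0: "t \<ge> 1" using t T by simp
      have "norm (chi k N eps (Complex (1 / 2 + real A) t)) \<le> X3 * 8 ^ (2 * A) / T ^ (2 * A)"
      proof -
        have "(T / 8) ^ (2 * A) \<le> \<bar>t\<bar> ^ (2 * A)" using t T by (intro power_mono) auto
        then have "(T / 8) ^ (2 * A) * norm (chi k N eps (Complex (1 / 2 + real A) t))
            \<le> \<bar>t\<bar> ^ (2 * A) * norm (chi k N eps (Complex (1 / 2 + real A) t))" by (intro mult_right_mono) auto
        also have "\<dots> \<le> X3" using t0 by (intro X3(2)) auto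
        finally show ?thesis using T by (simp add: power_divide field_simps)
      qed
      from H2b[OF _ _ t this] have "norm (H2 (Complex (real A) t)) \<le> (D2 * 4 ^ p2) * (X3 * 8 ^ (2 * A) / T ^ (2 * A)) ^ (l + j - 1) * C2 * T ^ (p2 + (a2 + q))"
        by simp
      also have "\<dots> = K3 * T ^ (p2 + (a2 + q)) / T ^ (2 * A * (l + j - 1))"
        by (simp add: K3_def power_divide power_mult)
      also have "\<dots> \<le> K3 * T ^ (p2 + (a2 + q)) / T ^ (e1 + 1)"
        using e1 Kpos T by (intro divide_left_mono power_increasing) auto
      finally have "norm (G (Complex t (real A))) \<le> (K1 * T ^ (p1 + 2 * A * (l - 1) + (a1 + q))) * (K3 * T ^ (p2 + (a2 + q)) / T ^ (e1 + 1))"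
        unfolding Gval using H1b[OF _ _ t, of "real A"] Kpos T by (intro mult_mono) auto
      also have "\<dots> = K1 * K3 * (T ^ e1 / T ^ (e1 + 1))"
        unfolding Te1 times_divide_eq_right times_divide_eq_left by (simp only: mult_ac)
      also have "\<dots> = K1 * K3 / T" using T by simp
      finally show ?thesis .
    qed
    have sm: "(deriv ^^ n) w field_differentiable (at t)"
      and supp: "w t \<noteq> 0 \<Longrightarrow> T / 4 \<le> t \<and> t \<le> 2 * T"
      and Bw: "\<bar>(deriv ^^ n) w t\<bar> \<le> B n * (T / ln T) powi (- int n)" for n t
      using w unfolding admissible_weight_def by blast+
    have quot: "(T / ln T) powi (- int n) = (ln T / T) ^ n" for n
      by (simp add: power_int_minus power_inverse[symmetric])
    have lnle: "0 \<le> ln T / T" "ln T / T \<le> 1" using lnT T ln_le_minus_one[of T] by (auto simp: field_simps)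
    define D where "D n = B n * (T / ln T) powi (- int n)" for n
    have Dle: "D n \<le> \<bar>B n\<bar>" for n
    proof -
      have "D n \<le> \<bar>B n\<bar> * (ln T / T) ^ n" unfolding D_def quot using lnle by (intro mult_right_mono) auto
      also have "\<dots> \<le> \<bar>B n\<bar> * 1" using lnle by (intro mult_left_mono power_le_one) auto
      finally show ?thesis by simp
    qed
    have DK: "D (2 * p) \<le> \<bar>B (2 * p)\<bar> * 4 ^ p / T ^ p"
    proof -
      have "(ln T / T)\<^sup>2 \<le> 4 / T" using ln_squared_le[of T] T by (simp add: power_divide field_simps power2_eq_square)
      then have "((ln T / T)\<^sup>2) ^ p \<le> (4 / T) ^ p" by (intro power_mono) auto
      then have "\<bar>B (2 * p)\<bar> * (ln T / T) ^ (2 * p) \<le> \<bar>B (2 * p)\<bar> * (4 ^ p / T ^ p)"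
        by (intro mult_left_mono) (auto simp: power_mult power_divide)
      moreover have "D (2 * p) \<le> \<bar>B (2 * p)\<bar> * (ln T / T) ^ (2 * p)"
        unfolding D_def quot using lnle by (intro mult_right_mono) auto
      ultimately show ?thesis by simp
    qed
    have D0: "D n \<ge> 0" for n using Bw[of n 0] abs_ge_zero order_trans unfolding D_def by blast
    \<comment> \<open>The interval is strictly larger than the support of w, so all derivatives of w
      vanish at its end points.\<close>
    have "norm (integral {T / 8..4 * T} (\<lambda>t. of_real (w t) * G (of_real t)))
      \<le> (4 * T - T / 8) * ((\<Sum>n<2 * p. real A ^ n * D n) * (K1 * K3 / T) + real A ^ (2 * p) * D (2 * p) * (K1 * K2 * T ^ e1))"
    proof (rule contour_shift_bound[where S = "{z. Re z > 0}"])
      show "(deriv ^^ n) w (T / 8) = 0" "(deriv ^^ n) w (4 * T) = 0" for n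
        using T by (auto intro!: higher_deriv_zero_outside[where a = "T / 4" and b = "2 * T"] dest: supp)
      show "\<bar>(deriv ^^ n) w t\<bar> \<le> D n" for n t using Bw by (simp add: D_def)
    qed (use sm Ghol opRe T GE GF in auto)
    also have "\<dots> \<le> (4 * T) * (SB * (K1 * K3 / T) + real A ^ (2 * p) * (\<bar>B (2 * p)\<bar> * 4 ^ p / T ^ p) * (K1 * K2 * T ^ e1))"
    proof (intro mult_mono add_mono)
      have "0 \<le> (\<Sum>n<2 * p. real A ^ n * D n)" by (intro sum_nonneg mult_nonneg_nonneg D0) auto
      then show "0 \<le> (\<Sum>n<2 * p. real A ^ n * D n) * (K1 * K3 / T) + real A ^ (2 * p) * D (2 * p) * (K1 * K2 * T ^ e1)"
        using T D0[of "2 * p"] Kpos by (intro add_nonneg_nonneg mult_nonneg_nonneg) auto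
      show "(\<Sum>n<2 * p. real A ^ n * D n) \<le> SB" unfolding SB_def by (intro sum_mono mult_left_mono Dle) auto
    qed (use T SB D0 DK Kpos in \<open>auto intro!: add_nonneg_nonneg mult_nonneg_nonneg sum_nonneg\<close>)
    also have "\<dots> = C"
    proof -
      have "T ^ p = T * T ^ e1" by (simp add: p_def)
      then show ?thesis using T by (simp add: C_def field_simps)
    qed
    finally have main: "norm (integral {T / 8..4 * T} (\<lambda>t. of_real (w t) * G (of_real t))) \<le> C" .
    define g where "g t = complex_of_real (w t)
               * of_real ((norm (V_op Q T L (Complex \<sigma> t)))\<^sup>2)
               * psi (chi k N eps) lam mu1 P1 \<sigma> (T powr \<nu>1) l (Complex \<sigma> t)
               * cnj (psi (chi k N eps) lam mu2 P2 \<sigma> (T powr \<nu>2) (l + j) (Complex \<sigma> t))" for t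
    \<comment> \<open>|V|^2 is written as V times its conjugate, one V going into \<open>H1\<close>
      and the other into \<open>H2\<close>.\<close>
    have gG: "g t = of_real (w t) * G (of_real t)" for t
    proof -
      have e: "of_real \<sigma> + \<i> * of_real t = Complex \<sigma> t" "Complex \<sigma> t + 1 / 2 - of_real \<sigma> = 1 / 2 + \<i> * of_real t"
        by (auto simp: complex_eq_iff)
      show ?thesis unfolding g_def G_def H1_def H2_def psi_mollifier_sum e complex_norm_square
        by (simp add: e mult_ac)
    qed
    have gind: "g t = indicator {T / 8..4 * T} t *\<^sub>R (of_real (w t) * G (of_real t))" for t
    proof (cases "w t = 0")
      case False
      then show ?thesis unfolding gG using supp[of t] T by (auto simp: indicator_def)
    qed (simp add: gG)
    have cont: "continuous_on {T / 8..4 * T} (\<lambda>t. of_real (w t) * G (of_real t))"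
    proof (intro continuous_intros)
      show "continuous_on {T / 8..4 * T} w"
        using sm[of 0] by (intro continuous_at_imp_continuous_on) (auto intro: field_differentiable_imp_continuous_at)
      show "continuous_on {T / 8..4 * T} (\<lambda>t. G (of_real t))"
        using T by (intro continuous_on_compose2[OF holomorphic_on_imp_continuous_on[OF Ghol]] continuous_intros) auto
    qed
    have "(LINT t|lborel. g t) = integral {T / 8..4 * T} (\<lambda>t. of_real (w t) * G (of_real t))"
      using set_borel_integral_eq_integral(2)[of "{T / 8..4 * T}" "\<lambda>t. of_real (w t) * G (of_real t)"]
        borel_integrable_atLeastAtMost'[OF cont]
      by (simp add: gind set_lebesgue_integral_def)
    then show "norm (LINT t|lborel. complex_of_real (w t)
               * of_real ((norm (V_op Q T L (Complex (sigma0 R T) t)))\<^sup>2)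
               * psi (chi k N eps) lam mu1 P1 (sigma0 R T) (T powr \<nu>1) l (Complex (sigma0 R T) t)
               * cnj (psi (chi k N eps) lam mu2 P2 (sigma0 R T) (T powr \<nu>2) (l + j) (Complex (sigma0 R T) t))) \<le> C"
      using main by (simp add: g_def[abs_def] \<sigma>_def)
  qed
qed

section \<open>Uniformity in j and passage from a bounded integral to the stated bound\<close>

theorem theorem2p5:
  fixes k N l :: nat
    and f L :: "complex \<Rightarrow> complex"
    and lam :: "nat \<Rightarrow> complex"
    and mu :: "nat \<Rightarrow> nat \<Rightarrow> complex"
    and eps :: complex
    and \<theta> \<epsilon> \<delta> R0 :: real
    and Q P P' :: "complex poly"
    and B :: "nat \<Rightarrow> real"
  assumes "even k" and "squarefree N"
    and "primitive_cusp_form k N f lam"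
    and "is_L_function lam L"
    and "is_root_number k N L eps"
    and "\<And>m. has_dirichlet_series (mu m) (\<lambda>s. 1 / L s ^ m)"
    and "\<theta> \<ge> 0"
    and "\<And>n. n \<ge> 1 \<Longrightarrow> norm (lam n) \<le> real (card {d. d dvd n}) * real n powr \<theta>"
    and "poly Q 0 = 1" and "\<exists>c. \<forall>x. poly Q x + poly Q (1 - x) = c"
    and "\<epsilon> > 0" and "\<delta> > 0"
    and "l \<ge> 1" and "mollifier_poly l P"
  shows "\<exists>C T0. \<forall>j\<ge>2. mollifier_poly (l + j) P' \<longrightarrow>
           (\<forall>T\<ge>T0. \<forall>R w. 0 < R \<and> R \<le> R0 \<and> admissible_weight B T w \<longrightarrow>
             norm (LINT t|lborel.
               of_real (w t)
               * of_real ((norm (V_op Q T L (Complex (sigma0 R T) t)))\<^sup>2)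
               * psi (chi k N eps) lam (mu l) P (sigma0 R T) (T powr nu \<theta> \<epsilon> l) l
                   (Complex (sigma0 R T) t)
               * cnj (psi (chi k N eps) lam (mu (l + j)) P' (sigma0 R T)
                   (T powr nu \<theta> \<epsilon> (l + j)) (l + j) (Complex (sigma0 R T) t)))
             \<le> C * T * ln T powr (- 1 + \<delta>))"
proof -
  note prim = assms(3) and L = assms(4) and eps = assms(5) and mu = assms(6)
  have lam: "\<forall>n\<ge>1. norm (lam n) \<le> real (card {d. d dvd n}) * real n powr \<theta>" using assms(8) by blast
  have "N \<noteq> 0"
  proof
    assume "N = 0"
    then have "(2::nat)\<^sup>2 dvd N" by simp
    then have "(2::nat) dvd 1" using assms(2) unfolding squarefree_def by blast
    then show False by simp
  qed
  then have N: "N > 0" by simp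
  define I where "I j T R w = (LINT t|lborel.
               of_real (w t)
               * of_real ((norm (V_op Q T L (Complex (sigma0 R T) t)))\<^sup>2)
               * psi (chi k N eps) lam (mu l) P (sigma0 R T) (T powr nu \<theta> \<epsilon> l) l
                   (Complex (sigma0 R T) t)
               * cnj (psi (chi k N eps) lam (mu (l + j)) P' (sigma0 R T)
                   (T powr nu \<theta> \<epsilon> (l + j)) (l + j) (Complex (sigma0 R T) t)))"
    for j T R and w :: "real \<Rightarrow> real"
  have "\<exists>p. \<forall>T\<ge>snd p. \<forall>R w. 0 < R \<and> R \<le> R0 \<and> admissible_weight B T w \<longrightarrow> norm (I j T R w) \<le> fst p" if "j \<ge> 2" for j
    using mixed_moment_bounded[OF prim N L eps mu[of l] mu[of "l + j"] lam nu_le[OF assms(7,11), of l]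
        nu_le[OF assms(7,11), of "l + j"] \<open>l \<ge> 1\<close> that, of R0 B Q P P']
    unfolding I_def split_paired_Ex fst_conv snd_conv .
  then have "\<forall>j\<in>{2..}. \<exists>p. \<forall>T\<ge>snd p. \<forall>R w. 0 < R \<and> R \<le> R0 \<and> admissible_weight B T w \<longrightarrow> norm (I j T R w) \<le> fst p"
    by simp
  from bchoice[OF this] obtain p where p: "\<forall>j\<in>{2..}. \<forall>T\<ge>snd (p j). \<forall>R w. 0 < R \<and> R \<le> R0 \<and> admissible_weight B T w \<longrightarrow> norm (I j T R w) \<le> fst (p j)" ..
  define C T0 where "C j = fst (p j)" and "T0 j = snd (p j)" for j
  have CT: "norm (I j T R w) \<le> C j" if "j \<ge> 2" "T \<ge> T0 j" "0 < R" "R \<le> R0" "admissible_weight B T w" for j T R w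
    using p that by (auto simp: C_def T0_def)
  have I_zero: "I j T R w = 0" if "P' = 0" for j T R w
    using that by (simp add: I_def psi_def poly_bracket_def split_beta)
  \<comment> \<open>The derivative of order degree P' at 0 is a factorial times the leading
    coefficient, hence not 0. For j >= degree P' the vanishing condition would reach this order,
    since m (m - 1) >= m >= degree P'.\<close>
  have few: "j < degree P'" if "j \<ge> 2" "mollifier_poly (l + j) P'" "P' \<noteq> 0" for j
  proof (rule ccontr)
    assume "\<not> j < degree P'"
    define m where "m = l + j"
    have "degree P' \<le> m * (m - 1)"
    proof -
      have "m * 1 \<le> m * (m - 1)" using that \<open>l \<ge> 1\<close> by (intro mult_le_mono2) (auto simp: m_def)
      moreover have "degree P' \<le> m" using \<open>\<not> j < degree P'\<close> by (simp add: m_def)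
      ultimately show ?thesis by linarith
    qed
    moreover have "m \<noteq> 1" using that by (simp add: m_def)
    ultimately have "poly ((pderiv ^^ degree P') P') 0 = 0"
      using that(2) by (auto simp: mollifier_poly_def m_def[symmetric])
    moreover have "poly ((pderiv ^^ degree P') P') 0 = coeff ((pderiv ^^ degree P') P') 0"
      by (simp add: poly_0_coeff_0)
    moreover have "coeff ((pderiv ^^ degree P') P') 0 = fact (degree P') * lead_coeff P'"
      by (simp add: coeff_higher_pderiv pochhammer_fact)
    ultimately show False using \<open>P' \<noteq> 0\<close> by simp
  qed
  \<comment> \<open>Sums over the finitely many possible j serve as common bounds. Absolute values
    are taken because for j < 2 the chosen pair is arbitrary; exp 1 ensures ln T >= 1.\<close>
  define CC where "CC = (\<Sum>j<degree P'. \<bar>C j\<bar>)"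
  define TT where "TT = (\<Sum>j<degree P'. \<bar>T0 j\<bar>) + exp 1"
  show ?thesis
  proof (rule exI[of _ CC], rule exI[of _ TT], intro allI impI)
    fix j T R and w :: "real \<Rightarrow> real"
    assume j: "2 \<le> j" "mollifier_poly (l + j) P'" and T: "TT \<le> T"
      and h: "0 < R \<and> R \<le> R0 \<and> admissible_weight B T w"
    have CC0: "CC \<ge> 0" by (auto simp: CC_def intro!: sum_nonneg)
    have "(\<Sum>j<degree P'. \<bar>T0 j\<bar>) \<ge> 0" by (intro sum_nonneg) auto
    then have Te: "T \<ge> exp 1" using T unfolding TT_def by linarith
    then have T0: "T > 0" using exp_gt_zero[of "1::real"] by linarith
    have lnT: "ln T \<ge> 1" using Te T0 by (simp add: ln_ge_iff)
    have "norm (I j T R w) \<le> CC"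
    proof (cases "P' = 0")
      case True
      then show ?thesis using I_zero CC0 by simp
    next
      case False
      then have jd: "j < degree P'" using few j by blast
      have "\<bar>T0 j\<bar> \<le> (\<Sum>j<degree P'. \<bar>T0 j\<bar>)" "\<bar>C j\<bar> \<le> CC"
        unfolding CC_def using jd by (auto intro!: member_le_sum)
      moreover have "T0 j \<le> T" using calculation T exp_gt_zero[of "1::real"] unfolding TT_def by linarith
      moreover have "norm (I j T R w) \<le> C j" using CT[OF j(1)] calculation(3) h by blast
      ultimately show ?thesis by linarith
    qed
    \<comment> \<open>Since ln T <= T, the quotient T / ln T is at least 1, so a bounded quantity is
      within the claimed order.\<close>
    also have "CC = CC * T * (1 / T)" using T0 by simp
    also have "\<dots> \<le> CC * T * (ln T powr (- 1 + \<delta>))"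
    proof (intro mult_left_mono)
      have "1 / T \<le> 1 / ln T" using lnT T0 ln_le_minus_one[of T] by (intro divide_left_mono) auto
      also have "\<dots> = ln T powr (- 1)" using lnT by (simp add: powr_minus inverse_eq_divide)
      also have "\<dots> \<le> ln T powr (- 1 + \<delta>)" using lnT \<open>\<delta> > 0\<close> by (intro powr_mono) auto
      finally show "1 / T \<le> ln T powr (- 1 + \<delta>)" .
    qed (use CC0 T0 in auto)
    finally have "norm (I j T R w) \<le> CC * T * ln T powr (- 1 + \<delta>)" .
    then show "norm (LINT t|lborel.
               of_real (w t)
               * of_real ((norm (V_op Q T L (Complex (sigma0 R T) t)))\<^sup>2)
               * psi (chi k N eps) lam (mu l) P (sigma0 R T) (T powr nu \<theta> \<epsilon> l) l
                   (Complex (sigma0 R T) t)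
               * cnj (psi (chi k N eps) lam (mu (l + j)) P' (sigma0 R T)
                   (T powr nu \<theta> \<epsilon> (l + j)) (l + j) (Complex (sigma0 R T) t)))
             \<le> CC * T * ln T powr (- 1 + \<delta>)" unfolding I_def .
  qed
qed

end
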